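(* For every integer $n \geq 0$ and every graph $G \in \{\Gamma_{n,4},\Lambda_{n,4},A_{n,4},B_{n,4},C_{n,4},D_{n,4}\}$ (defined below), the independence complex $\mathrm{Ind}(G)$ is homotopy equivalent to a wedge of spheres.
   Context: The independence complex $\mathrm{Ind}(G)$ of a graph $G$ is the simplicial complex on $V(G)$ whose simplices are the independent sets of $G$. For $n \geq 0$, $\Gamma_{n,4}$ has vertices $g_{ij}$, $1 \leq i \leq 3$, $1 \leq j \leq 2n+1$, and edges: $g_{ij}g_{i+1,j}$ for $i=1,2$ and all $j$; $g_{ij}g_{i,j+1}$ for $i=1,2,3$, $j=1,\dots,2n$; and $g_{ij}g_{i+1,j+1}$, $g_{i,j+1}g_{i+1,j}$ for $i=1,2$, $j=1,\dots,2n$ with $i+j \equiv 1 \pmod 2$. Each of the following is $\Gamma_{n,4}$ plus the listed new vertices and edges: - $\Lambda_{n,4}$: vertices $g'_1,g'_2,g'_3$; edges $g'_1g'_2, g'_1g_{11}, g'_1g_{21}, g'_2g'_3, g'_2g_{21}, g'_2g_{11}, g'_3g_{31}$. - $A_{n,4}$: vertex $a_1$; edges $a_1g_{11}, a_1g_{21}$. - $B_{n,4}$: vertices $b_1,\dots,b_4$; edges $b_1b_3, b_1b_4, b_2b_3, b_3b_4, b_2g_{11}, b_2g_{21}, b_3g_{11}, b_3g_{21}, b_4g_{31}$. - $C_{n,4}$: vertex $c_1$; edges $c_1g_{11}, c_1g_{21}, c_1g_{31}$. - $D_{n,4}$: vertices $d_1,\dots,d_4$; edges $d_1d_2, d_1d_3,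 d_1d_4, d_2d_3, d_3d_4, d_2g_{11}, d_2g_{21}, d_3g_{11}, d_3g_{21}, d_4g_{31}$. *)

theory Defs
  imports "HOL-Analysis.Analysis"
begin

text \<open>A graph is a pair of a vertex set and a set of edges, each edge being a two-element set
  of vertices.\<close>

type_synonym 'a graph = "'a set \<times> 'a set set"

definition simple_graph :: "'a graph \<Rightarrow> bool" where
  "simple_graph G \<longleftrightarrow> (\<forall>e \<in> snd G. e \<subseteq> fst G \<and> card e = 2)"

definition extend_graph :: "'a graph \<Rightarrow> 'a set \<Rightarrow> 'a set set \<Rightarrow> 'a graph" where
  "extend_graph G V E = (fst G \<union> V, snd G \<union> E)"

definition independent_set :: "'a graph \<Rightarrow> 'a set \<Rightarrow> bool" where
  "independent_set G S \<longleftrightarrow> S \<subseteq> fst G \<and> (\<forall>u \<in> S. \<forall>v \<in> S. {u, v} \<notin> snd G)"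

definition Ind :: "'a graph \<Rightarrow> 'a set set" where
  "Ind G = {S. independent_set G S}"

text \<open>The geometric realization in barycentric coordinates. The topology is that of pointwise
  convergence; this is the usual (weak) topology whenever the complex has finitely many vertices,
  as all complexes below do. The empty set, which is a member of
  \<open>Ind G\<close>, contributes no point, since the
  coordinates of a point sum to 1.\<close>

definition geometric_realization :: "'a set set \<Rightarrow> ('a \<Rightarrow> real) topology" where
  "geometric_realization K =
     subtopology (powertop_real UNIV)
       {x. (\<forall>v. 0 \<le> x v) \<and> {v. x v \<noteq> 0} \<in> K \<and> (\<Sum>v | x v \<noteq> 0. x v) = 1}"

text \<open>The wedge of the pointed spaces \<open>(X i, p i)\<close>, \<open>i \<in> I\<close>: in the disjoint union all
  base points are identified to the single point \<open>None\<close>, and the result carries the quotient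
  topology (see \<open>quotient_map_wedge\<close> below).\<close>

definition wedge_glue :: "('i \<Rightarrow> 'a) \<Rightarrow> 'i \<times> 'a \<Rightarrow> ('i \<times> 'a) option" where
  "wedge_glue p z = (if snd z = p (fst z) then None else Some z)"

definition wedge_carrier :: "'i set \<Rightarrow> ('i \<Rightarrow> 'a topology) \<Rightarrow> ('i \<Rightarrow> 'a) \<Rightarrow> ('i \<times> 'a) option set" where
  "wedge_carrier I X p = insert None (wedge_glue p ` (SIGMA i:I. topspace (X i)))"

definition wedge :: "'i set \<Rightarrow> ('i \<Rightarrow> 'a topology) \<Rightarrow> ('i \<Rightarrow> 'a) \<Rightarrow> ('i \<times> 'a) option topology" where
  "wedge I X p =
     topology (\<lambda>U. U \<subseteq> wedge_carrier I X p \<and>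
       (\<forall>i \<in> I. openin (X i) {x \<in> topspace (X i). wedge_glue p (i, x) \<in> U}))"

lemma openin_wedge:
  "openin (wedge I X p) U \<longleftrightarrow> U \<subseteq> wedge_carrier I X p \<and>
     (\<forall>i \<in> I. openin (X i) {x \<in> topspace (X i). wedge_glue p (i, x) \<in> U})"
proof -
  define P where "P U i = {x \<in> topspace (X i). wedge_glue p (i, x) \<in> U}" for U i
  define L where "L U \<longleftrightarrow> U \<subseteq> wedge_carrier I X p \<and> (\<forall>i \<in> I. openin (X i) (P U i))" for U
  have P_Int: "P (S \<inter> T) i = P S i \<inter> P T i" and P_Union: "P (\<Union>\<K>) i = (\<Union>K\<in>\<K>. P K i)" for S T \<K> i
    by (auto simp: P_def)
  have "L (S \<inter> T)" if "L S" "L T" for S T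
    using that by (auto simp: L_def P_Int)
  moreover have "L (\<Union>\<K>)" if "\<forall>K\<in>\<K>. L K" for \<K>
    using that by (auto simp: L_def P_Union)
  ultimately have "istopology L"
    by (simp add: istopology_def)
  moreover have "wedge I X p = topology L"
    unfolding wedge_def L_def P_def ..
  ultimately have "openin (wedge I X p) U \<longleftrightarrow> L U"
    by (simp add: topology_inverse')
  then show ?thesis
    by (simp only: L_def P_def)
qed

lemma topspace_wedge [simp]: "topspace (wedge I X p) = wedge_carrier I X p"
proof
  show "topspace (wedge I X p) \<subseteq> wedge_carrier I X p"
    using openin_topspace[of "wedge I X p"] by (simp only: openin_wedge)
  have "{x \<in> topspace (X i). wedge_glue p (i, x) \<in> wedge_carrier I X p} = topspace (X i)"
    if "i \<in> I" for i
    using that by (auto simp: wedge_carrier_def)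
  then have "openin (wedge I X p) (wedge_carrier I X p)"
    by (simp add: openin_wedge)
  then show "wedge_carrier I X p \<subseteq> topspace (wedge I X p)"
    by (rule openin_subset)
qed

lemma quotient_map_wedge:
  assumes "I \<noteq> {}" and "\<And>i. i \<in> I \<Longrightarrow> p i \<in> topspace (X i)"
  shows "quotient_map (sum_topology X I) (wedge I X p) (wedge_glue p)"
proof -
  obtain i where i: "i \<in> I" using assms by blast
  then have "wedge_glue p (i, p i) \<in> wedge_glue p ` (SIGMA i:I. topspace (X i))"
    using assms by blast
  then have "wedge_carrier I X p = wedge_glue p ` (SIGMA i:I. topspace (X i))"
    by (auto simp: wedge_carrier_def wedge_glue_def)
  moreover have "{x. (i, x) \<in> {z \<in> Sigma I (topspace \<circ> X). wedge_glue p z \<in> U}} =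
      {x \<in> topspace (X i). wedge_glue p (i, x) \<in> U}" if "i \<in> I" for i U
    using that by auto
  ultimately show ?thesis
    unfolding quotient_map_def by (simp add: openin_wedge openin_sum_topology o_def)
qed

definition sphere_base :: "nat \<Rightarrow> real" where
  "sphere_base = (\<lambda>j. if j = 0 then 1 else 0)"

lemma sphere_base_in_nsphere: "sphere_base \<in> topspace (nsphere m)"
  unfolding sphere_base_def by (rule in_topspace_nsphere)

definition wedge_of_spheres :: "nat list \<Rightarrow> (nat \<times> (nat \<Rightarrow> real)) option topology" where
  "wedge_of_spheres ds = wedge {..<length ds} (\<lambda>k. nsphere (ds ! k)) (\<lambda>_. sphere_base)"

datatype vertex = Vg nat nat | Vg' nat | Va nat | Vb nat | Vc nat | Vd nat

definition Gamma4 :: "nat \<Rightarrow> vertex graph" where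
  "Gamma4 n =
    ({Vg i j | i j. i \<in> {1..3} \<and> j \<in> {1..2 * n + 1}},
     {{Vg i j, Vg (i + 1) j} | i j. i \<in> {1..2} \<and> j \<in> {1..2 * n + 1}} \<union>
     {{Vg i j, Vg i (j + 1)} | i j. i \<in> {1..3} \<and> j \<in> {1..2 * n}} \<union>
     {{Vg i j, Vg (i + 1) (j + 1)} | i j. i \<in> {1..2} \<and> j \<in> {1..2 * n} \<and> (i + j) mod 2 = 1} \<union>
     {{Vg i (j + 1), Vg (i + 1) j} | i j. i \<in> {1..2} \<and> j \<in> {1..2 * n} \<and> (i + j) mod 2 = 1})"

definition Lambda4 :: "nat \<Rightarrow> vertex graph" where
  "Lambda4 n = extend_graph (Gamma4 n) {Vg' 1, Vg' 2, Vg' 3}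
    {{Vg' 1, Vg' 2}, {Vg' 1, Vg 1 1}, {Vg' 1, Vg 2 1}, {Vg' 2, Vg' 3},
     {Vg' 2, Vg 2 1}, {Vg' 2, Vg 1 1}, {Vg' 3, Vg 3 1}}"

definition A4 :: "nat \<Rightarrow> vertex graph" where
  "A4 n = extend_graph (Gamma4 n) {Va 1} {{Va 1, Vg 1 1}, {Va 1, Vg 2 1}}"

definition B4 :: "nat \<Rightarrow> vertex graph" where
  "B4 n = extend_graph (Gamma4 n) {Vb 1, Vb 2, Vb 3, Vb 4}
    {{Vb 1, Vb 3}, {Vb 1, Vb 4}, {Vb 2, Vb 3}, {Vb 3, Vb 4}, {Vb 2, Vg 1 1}, {Vb 2, Vg 2 1},
     {Vb 3, Vg 1 1}, {Vb 3, Vg 2 1}, {Vb 4, Vg 3 1}}"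

definition C4 :: "nat \<Rightarrow> vertex graph" where
  "C4 n = extend_graph (Gamma4 n) {Vc 1} {{Vc 1, Vg 1 1}, {Vc 1, Vg 2 1}, {Vc 1, Vg 3 1}}"

definition D4 :: "nat \<Rightarrow> vertex graph" where
  "D4 n = extend_graph (Gamma4 n) {Vd 1, Vd 2, Vd 3, Vd 4}
    {{Vd 1, Vd 2}, {Vd 1, Vd 3}, {Vd 1, Vd 4}, {Vd 2, Vd 3}, {Vd 3, Vd 4}, {Vd 2, Vg 1 1},
     {Vd 2, Vg 2 1}, {Vd 3, Vg 1 1}, {Vd 3, Vg 2 1}, {Vd 4, Vg 3 1}}"

lemma simple_graphs_4:
  assumes "G \<in> {Gamma4 n, Lambda4 n, A4 n, B4 n, C4 n, D4 n}"
  shows "simple_graph G" and "finite (fst G)"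
proof -
  have simple: "simple_graph (Gamma4 n)"
    by (auto simp: simple_graph_def Gamma4_def card_insert_if)
  have fin: "finite (fst (Gamma4 n))"
  proof -
    have "fst (Gamma4 n) = (\<lambda>(i, j). Vg i j) ` ({1..3} \<times> {1..2 * n + 1})"
      by (auto simp: Gamma4_def)
    then show ?thesis by simp
  qed
  have extend: "simple_graph (extend_graph (Gamma4 n) V E)"
    if "\<forall>e\<in>E. e \<subseteq> fst (Gamma4 n) \<union> V \<and> card e = 2" for V E
    using simple that by (auto simp: simple_graph_def extend_graph_def)
  have mem: "Vg i (Suc 0) \<in> fst (Gamma4 n)" if "i \<in> {1, 2, 3}" for i
    using that by (auto simp: Gamma4_def)
  show "simple_graph G"
    using assms unfolding insert_iff empty_iff
    by (elim disjE; simp add: simple extend Lambda4_def A4_def B4_def C4_def D4_def mem)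
  show "finite (fst G)"
    using assms fin
    by (auto simp: Lambda4_def A4_def B4_def C4_def D4_def extend_graph_def)
qed

end

theory Submission
  imports Defs
begin

text \<open>If the neighbours of \<open>w\<close> other than \<open>v\<close> are all neighbours of the vertex \<open>v\<close> adjacent to \<open>w\<close>, then the link
  of \<open>v\<close> in the independence complex lies in a cone with apex \<open>w\<close> inside the deletion of \<open>v\<close>, and the
  complex is the wedge of the deletion and of the suspension of the link. The suspension is again an
  independence complex, namely that of the graph without the closed neighbourhood of \<open>v\<close> but with an
  additional isolated edge. Moreover the homotopy type does not change when a vertex \<open>x\<close> is deleted whose
  neighbourhood contains that of another vertex, or when an edge \<open>a b\<close> is inserted or deleted for which some
  vertex is isolated outside the closed neighbourhoods of \<open>a\<close> and \<open>b\<close>. Each of these moves only concerns the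
  left end of the strip. There are seven shapes of the left end, the strip itself among them, such that a
  bounded number of moves splits every strip with such an end into shorter ones, up to contractible pieces,
  and the six families reduce to these shapes as well; the theorem follows by induction on the length.\<close>

section \<open>Pointed homotopy equivalences\<close>

text \<open>A wedge depends on its base points, and the splitting glues at one prescribed vertex
  \<open>w\<close>. Homotopies therefore have to fix the base point throughout: only then can
  equivalences of the two summands be pasted at the common point. A base point can be moved along
  faces only, which fails in a disconnected complex; once an isolated edge has been added, its end
  points are joined to every old vertex and the difficulty disappears. This is why the key graphs
  are treated only with at least one added edge, and why the unsuspended complexes of the six
  families carry an extra connectivity check. The homotopies between realizations are built from
  straight-line homotopies of maps given by explicit weights. The diagonals of the strip depend on
  the parity of \<open>i + j\<close>, so strips are compared under even shifts and the number of
  columns stays odd. Since the list of dimensions has to be nonempty, a flag records in every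
  reduction whether a sphere is certain to survive.\<close>

definition pointed_heq :: "'a topology \<Rightarrow> 'a \<Rightarrow> 'b topology \<Rightarrow> 'b \<Rightarrow> bool" where
  "pointed_heq X p Y q \<longleftrightarrow> p \<in> topspace X \<and> q \<in> topspace Y \<and>
     (\<exists>f g. continuous_map X Y f \<and> continuous_map Y X g \<and> f p = q \<and> g q = p \<and>
       homotopic_with (\<lambda>h. h p = p) X X (g \<circ> f) id \<and>
       homotopic_with (\<lambda>h. h q = q) Y Y (f \<circ> g) id)"

lemma pointed_heq_sym: "pointed_heq X p Y q \<Longrightarrow> pointed_heq Y q X p"
  unfolding pointed_heq_def by blast

lemma pointed_heq_trans:
  assumes "pointed_heq X p Y q" and "pointed_heq Y q Z r"
  shows "pointed_heq X p Z r"
proof -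
  obtain f g where f: "continuous_map X Y f" "continuous_map Y X g" "f p = q" "g q = p"
    and gf: "homotopic_with (\<lambda>h. h p = p) X X (g \<circ> f) id"
    and fg: "homotopic_with (\<lambda>h. h q = q) Y Y (f \<circ> g) id"
    using assms(1) unfolding pointed_heq_def by blast
  obtain h k where h: "continuous_map Y Z h" "continuous_map Z Y k" "h q = r" "k r = q"
    and kh: "homotopic_with (\<lambda>h. h q = q) Y Y (k \<circ> h) id"
    and hk: "homotopic_with (\<lambda>h. h r = r) Z Z (h \<circ> k) id"
    using assms(2) unfolding pointed_heq_def by blast
  have "homotopic_with (\<lambda>j. j p = q) X Y ((k \<circ> h) \<circ> f) (id \<circ> f)"
    using kh f(1) by (rule homotopic_with_compose_continuous_map_right) (simp add: f)
  then have "homotopic_with (\<lambda>j. j p = p) X X (g \<circ> ((k \<circ> h) \<circ> f)) (g \<circ> (id \<circ> f))"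
    using f(2) by (rule homotopic_with_compose_continuous_map_left) (simp add: f)
  then have 1: "homotopic_with (\<lambda>j. j p = p) X X ((g \<circ> k) \<circ> (h \<circ> f)) id"
    using gf by (simp add: comp_assoc) (rule homotopic_with_trans)
  have "homotopic_with (\<lambda>j. j r = q) Z Y ((f \<circ> g) \<circ> k) (id \<circ> k)"
    using fg h(2) by (rule homotopic_with_compose_continuous_map_right) (simp add: h)
  then have "homotopic_with (\<lambda>j. j r = r) Z Z (h \<circ> ((f \<circ> g) \<circ> k)) (h \<circ> (id \<circ> k))"
    using h(1) by (rule homotopic_with_compose_continuous_map_left) (simp add: h)
  then have 2: "homotopic_with (\<lambda>j. j r = r) Z Z ((h \<circ> f) \<circ> (g \<circ> k)) id"
    using hk by (simp add: comp_assoc) (rule homotopic_with_trans)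
  show ?thesis
    unfolding pointed_heq_def
  proof (intro conjI exI)
    show "continuous_map X Z (h \<circ> f)" "continuous_map Z X (g \<circ> k)"
      using f h by (auto intro: continuous_map_compose)
  qed (use 1 2 f h assms in \<open>auto simp: pointed_heq_def\<close>)
qed

lemma homeomorphic_maps_imp_pointed_heq:
  assumes "homeomorphic_maps X Y f g" and "p \<in> topspace X" and "f p = q"
  shows "pointed_heq X p Y q"
proof -
  have fg: "continuous_map X Y f" "continuous_map Y X g"
    "\<And>x. x \<in> topspace X \<Longrightarrow> g (f x) = x" "\<And>y. y \<in> topspace Y \<Longrightarrow> f (g y) = y"
    using assms(1) by (auto simp: homeomorphic_maps_def)
  have q: "q \<in> topspace Y" "g q = p"
    using fg assms by (auto simp: continuous_map_def)
  have "homotopic_with (\<lambda>h. h p = p) X X (g \<circ> f) id"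
    by (rule homotopic_with_equal) (use fg assms q in \<open>auto intro: continuous_map_compose\<close>)
  moreover have "homotopic_with (\<lambda>h. h q = q) Y Y (f \<circ> g) id"
    by (rule homotopic_with_equal) (use fg assms q in \<open>auto intro: continuous_map_compose\<close>)
  ultimately show ?thesis
    unfolding pointed_heq_def using fg assms q by blast
qed

lemma pointed_heq_imp_homotopy_equivalent:
  "pointed_heq X p Y q \<Longrightarrow> X homotopy_equivalent_space Y"
  unfolding pointed_heq_def homotopy_equivalent_space_def
  by (metis homotopic_with_mono)

section \<open>Realizations of finite complexes\<close>

definition supp :: "('a \<Rightarrow> real) \<Rightarrow> 'a set" where
  "supp x = {v. x v \<noteq> 0}"

definition carrier :: "'a set set \<Rightarrow> ('a \<Rightarrow> real) set" where
  "carrier K = {x. (\<forall>v. 0 \<le> x v) \<and> supp x \<in> K \<and> sum x (supp x) = 1}"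

definition complex :: "'a set set \<Rightarrow> bool" where
  "complex K \<longleftrightarrow> finite (\<Union>K) \<and> (\<forall>\<sigma>\<in>K. \<forall>\<tau>. \<tau> \<subseteq> \<sigma> \<longrightarrow> \<tau> \<in> K)"

abbreviation gr :: "'a set set \<Rightarrow> ('a \<Rightarrow> real) topology" where
  "gr K \<equiv> top_of_set (carrier K)"

definition pt :: "'a \<Rightarrow> 'a \<Rightarrow> real" where
  "pt v = (\<lambda>u. if u = v then 1 else 0)"

lemma geometric_realization_eq: "geometric_realization K = gr K"
  unfolding geometric_realization_def carrier_def supp_def euclidean_product_topology ..

lemma supp_pt [simp]: "supp (pt v) = {v}"
  by (auto simp: supp_def pt_def)

lemma pt_in_carrier [simp]: "pt v \<in> carrier K \<longleftrightarrow> {v} \<in> K"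
  by (auto simp: carrier_def) (auto simp: pt_def)

lemma complex_mono: "complex K \<Longrightarrow> \<sigma> \<in> K \<Longrightarrow> \<tau> \<subseteq> \<sigma> \<Longrightarrow> \<tau> \<in> K"
  by (auto simp: complex_def)

lemma carrierD:
  assumes "x \<in> carrier K"
  shows "0 \<le> x v" "supp x \<in> K" "sum x (supp x) = 1" "finite (supp x)" "supp x \<noteq> {}"
proof -
  show "0 \<le> x v" "supp x \<in> K" and *: "sum x (supp x) = 1"
    using assms by (auto simp: carrier_def)
  \<comment> \<open>A sum over an infinite set is 0 by convention, so total weight 1 forces finite
    support.\<close>
  show "finite (supp x)"
    using * by (metis sum.infinite zero_neq_one)
  show "supp x \<noteq> {}"
    using * by auto
qed

lemma sum_supp:
  assumes "finite V" "supp x \<subseteq> V"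
  shows "sum x (supp x) = sum x V"
  by (rule sum.mono_neutral_left) (use assms in \<open>auto simp: supp_def\<close>)

lemma carrierI:
  assumes "finite V" "\<And>v. 0 \<le> x v" "supp x \<in> K" "supp x \<subseteq> V" "sum x V = 1"
  shows "x \<in> carrier K"
  using assms by (auto simp: carrier_def sum_supp)

lemma carrier_sum:
  assumes "x \<in> carrier K" "finite V" "supp x \<subseteq> V"
  shows "sum x V = 1"
  using assms carrierD(3)[OF assms(1)] by (simp add: sum_supp)

lemma carrier_le_1:
  assumes "x \<in> carrier K" shows "x v \<le> 1"
proof (cases "v \<in> supp x")
  case True
  have "x v \<le> sum x (supp x)"
    by (rule member_le_sum) (use assms True carrierD in \<open>auto\<close>)
  then show ?thesis using carrierD(3)[OF assms] by simp
qed (auto simp: supp_def)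

lemma carrier_eq_1:
  assumes x: "x \<in> carrier K" and "x v = 1"
  shows "x = pt v"
proof
  fix u
  have "finite (insert u (insert v (supp x)))" using carrierD(4)[OF x] by simp
  then have "sum x (insert u (insert v (supp x))) = 1"
    using carrier_sum[OF x] by blast
  moreover have "sum x {u,v} \<le> sum x (insert u (insert v (supp x)))"
    by (rule sum_mono2) (use carrierD[OF x] in auto)
  ultimately show "x u = pt v u"
    using assms carrierD(1)[OF x, of u] by (auto simp: pt_def split: if_splits)
qed

lemma carrier_other:
  assumes x: "x \<in> carrier K" and "x v < 1"
  obtains u where "u \<noteq> v" "x u > 0"
proof -
  have "supp x \<noteq> {v}"
    using carrierD(3)[OF x] assms(2) by auto
  then obtain u where "u \<in> supp x" "u \<noteq> v" using carrierD(5)[OF x] by auto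
  then show ?thesis using that carrierD(1)[OF x, of u] by (auto simp: supp_def less_le)
qed

text \<open>The segment from \<open>f x\<close> to \<open>g x\<close> lies in the simplex spanned by
  both supports, so the straight-line homotopy never leaves the realization; it rests wherever
  \<open>f\<close> and \<open>g\<close> agree, in particular at the base point.\<close>

lemma contiguous_homotopic:
  fixes f g :: "'b::topological_space \<Rightarrow> 'a \<Rightarrow> real"
  assumes K: "complex K" and "continuous_on S f" "continuous_on S g"
    and f: "\<And>x. x \<in> S \<Longrightarrow> f x \<in> carrier K" and g: "\<And>x. x \<in> S \<Longrightarrow> g x \<in> carrier K"
    and fg: "\<And>x. x \<in> S \<Longrightarrow> supp (f x) \<union> supp (g x) \<in> K"
    and p: "f p = q" "g p = q"
  shows "homotopic_with (\<lambda>h. h p = q) (top_of_set S) (gr K) f g"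
  unfolding homotopic_with_def
proof (intro exI conjI allI ballI)
  let ?h = "\<lambda>(t::real, x). \<lambda>v. (1 - t) * f x v + t * g x v"
  have cf: "continuous_on ({0..1} \<times> S) (\<lambda>z. f (snd z) v)" for v
    using continuous_on_product_then_coordinatewise[OF assms(2)]
    by (rule continuous_on_compose2) (auto intro: continuous_intros)
  have cg: "continuous_on ({0..1} \<times> S) (\<lambda>z. g (snd z) v)" for v
    using continuous_on_product_then_coordinatewise[OF assms(3)]
    by (rule continuous_on_compose2) (auto intro: continuous_intros)
  have "continuous_on ({0..1} \<times> S) ?h"
    unfolding split_beta by (intro continuous_on_coordinatewise_then_product continuous_intros cf cg)
  moreover have "?h (t, x) \<in> carrier K" if "t \<in> {0..1}" "x \<in> S" for t x
  proof -
    have sub: "supp (?h (t, x)) \<subseteq> supp (f x) \<union> supp (g x)"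
      by (auto simp: supp_def)
    have fin: "finite (supp (f x) \<union> supp (g x))"
      using carrierD(4) f g that by blast
    show ?thesis
    proof (rule carrierI[OF fin])
      show "0 \<le> ?h (t, x) v" for v
        using that carrierD(1)[OF f[OF that(2)]] carrierD(1)[OF g[OF that(2)]] by simp
      show "supp (?h (t, x)) \<in> K" using K fg[OF that(2)] sub by (rule complex_mono)
      show "sum (?h (t, x)) (supp (f x) \<union> supp (g x)) = 1"
        using carrier_sum[OF f[OF that(2)] fin] carrier_sum[OF g[OF that(2)] fin]
        by (simp add: sum.distrib flip: sum_distrib_left)
    qed (rule sub)
  qed
  ultimately show "continuous_map (prod_topology (top_of_set {0..1}) (top_of_set S)) (gr K) ?h"
    by (auto simp: prod_topology_subtopology_eu continuous_map_subtopology_eu)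
qed (auto simp: p algebra_simps)

text \<open>Barycentric coordinates up to scale: the piecewise formulas below prescribe nonnegative
  weights only, and dividing by the total keeps their supports. What has to be checked for a map is
  thus in which faces its supports lie and that its weights never vanish all at once.\<close>

definition normalize :: "'a set \<Rightarrow> ('a \<Rightarrow> real) \<Rightarrow> 'a \<Rightarrow> real" where
  "normalize V F = (\<lambda>v. F v / sum F V)"

lemma sum_pos_of_supp:
  assumes "finite V" "\<And>v. 0 \<le> F v" "supp F \<subseteq> V" "supp F \<noteq> {}"
  shows "0 < sum F V"
proof -
  obtain u where "u \<in> supp F" using assms by auto
  then show ?thesis
    using assms by (intro sum_pos2[where i = u]) (auto simp: supp_def less_le)
qed

lemma supp_normalize:
  assumes "finite V" "\<And>v. 0 \<le> F v" "supp F \<subseteq> V" "supp F \<noteq> {}"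
  shows "supp (normalize V F) = supp F"
  using sum_pos_of_supp[OF assms] by (auto simp: normalize_def supp_def)

lemma normalize_in_carrier:
  assumes "finite V" "\<And>v. 0 \<le> F v" "supp F \<subseteq> V" "supp F \<noteq> {}" "supp F \<in> K"
  shows "normalize V F \<in> carrier K"
proof (rule carrierI[OF assms(1)])
  note pos = sum_pos_of_supp[OF assms(1-4)]
  show "0 \<le> normalize V F v" for v
    using pos assms(2)[of v] by (simp add: normalize_def)
  show "sum (normalize V F) V = 1"
    using pos by (simp add: normalize_def flip: sum_divide_distrib)
qed (use assms in \<open>auto simp: supp_normalize\<close>)

lemma continuous_on_normalize:
  fixes F :: "'b::topological_space \<Rightarrow> 'a \<Rightarrow> real"
  assumes "finite V" and "\<And>v. continuous_on S (\<lambda>x. F x v)"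
    and "\<And>x v. x \<in> S \<Longrightarrow> 0 \<le> F x v" "\<And>x. x \<in> S \<Longrightarrow> supp (F x) \<subseteq> V"
    and "\<And>x. x \<in> S \<Longrightarrow> supp (F x) \<noteq> {}"
  shows "continuous_on S (\<lambda>x. normalize V (F x))"
proof -
  have "sum (F x) V \<noteq> 0" if "x \<in> S" for x
    using sum_pos_of_supp[OF assms(1), of "F x"] assms(3-5)[OF that] by force
  then show ?thesis
    unfolding normalize_def
    by (intro continuous_on_coordinatewise_then_product continuous_intros assms) auto
qed

lemma normalize_pt:
  assumes "finite V" "v \<in> V" "c > 0" "\<And>u. F u = (if u = v then c else 0)"
  shows "normalize V F = pt v"
proof -
  have "sum F V = c" using assms by (simp add: sum.delta)
  then show ?thesis using assms by (auto simp: normalize_def pt_def)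
qed

lemma cont_coord: "continuous_on S (\<lambda>x. x v)" for S :: "('a \<Rightarrow> real) set"
  by (rule continuous_on_subset[OF continuous_on_product_coordinates]) simp

section \<open>Collapses, relabellings, cones and changes of base point\<close>

lemma continuous_on_if_const:
  "continuous_on S f \<Longrightarrow> continuous_on S g \<Longrightarrow> continuous_on S (\<lambda>x. if P then f x else g x)"
  by (cases P) simp_all

text \<open>Both operations on graphs used below are instances: deleting a dominated vertex (\<open>a = b\<close>) and
  inserting or deleting an edge \<open>a b\<close>.\<close>

lemma pointed_heq_collapse:
  fixes K :: "'a set set"
  assumes K: "complex K" and u: "u \<noteq> a" "u \<noteq> b"
    and apex: "\<And>\<tau>. \<tau> \<in> K \<Longrightarrow> a \<in> \<tau> \<Longrightarrow> b \<in> \<tau> \<Longrightarrow> insert u \<tau> \<in> K"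
    and p: "{p} \<in> K" "\<not> {a, b} \<subseteq> {p}"
  shows "pointed_heq (gr {\<tau> \<in> K. \<not> {a, b} \<subseteq> \<tau>}) (pt p) (gr K) (pt p)"
proof -
  let ?K' = "{\<tau> \<in> K. \<not> {a, b} \<subseteq> \<tau>}"
  \<comment> \<open>The map \<open>g\<close> moves the amount \<open>m x\<close> from each of
    \<open>a\<close> and \<open>b\<close> to \<open>u\<close>, after which at least one of the two
    coordinates is 0. The factor \<open>card {a, b}\<close> counts the donors, 1 if
    \<open>a = b\<close> and 2 otherwise, and keeps the total at 1.\<close>
  define m where "m x = min (x a) (x b)" for x :: "'a \<Rightarrow> real"
  define g where "g x = (\<lambda>v. x v - (if v \<in> {a, b} then m x else 0) + (if v = u then real (card {a, b}) * m x else 0))"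
    for x :: "'a \<Rightarrow> real"
  have m0: "m x = 0" if "x \<in> carrier ?K'" for x
    using carrierD(1)[OF that, of a] carrierD(1)[OF that, of b] carrierD(2)[OF that]
    by (auto simp: m_def supp_def min_def)
  have gid: "g x = x" if "m x = 0" for x
    using that by (auto simp: g_def)
  have sub: "carrier ?K' \<subseteq> carrier K"
    by (auto simp: carrier_def)
  have supp_g: "supp (g x) \<union> supp x \<in> K" "\<not> {a, b} \<subseteq> supp (g x)" if x: "x \<in> carrier K" for x
  proof -
    show "supp (g x) \<union> supp x \<in> K"
    proof (cases "m x = 0")
      case True
      then show ?thesis using gid carrierD(2)[OF x] by simp
    next
      case False
      then have "a \<in> supp x" "b \<in> supp x"
        using carrierD(1)[OF x, of a] carrierD(1)[OF x, of b] by (auto simp: m_def supp_def min_def split: if_splits)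
      then have "insert u (supp x) \<in> K" and "supp (g x) \<union> supp x \<subseteq> insert u (supp x)"
        using apex[OF carrierD(2)[OF x]] by (auto simp: g_def supp_def)
      then show ?thesis using complex_mono[OF K] by simp
    qed
    have "g x a = 0 \<or> g x b = 0"
      using u by (auto simp: g_def m_def min_def)
    then show "\<not> {a, b} \<subseteq> supp (g x)"
      by (auto simp: supp_def)
  qed
  have g_in: "g x \<in> carrier ?K'" if x: "x \<in> carrier K" for x
  proof -
    let ?V = "insert u (insert a (insert b (supp x)))"
    have fin: "finite ?V" using carrierD(4)[OF x] by simp
    show ?thesis
    proof (rule carrierI[OF fin])
      show "0 \<le> g x v" for v
        using carrierD(1)[OF x] by (auto simp: g_def m_def min_def)
      show "supp (g x) \<in> ?K'"
        using supp_g(2)[OF x] complex_mono[OF K supp_g(1)[OF x] Un_upper1] by simp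
      show "supp (g x) \<subseteq> ?V"
        by (auto simp: g_def supp_def)
      have "sum (\<lambda>v. if v \<in> {a, b} then m x else 0) ?V = sum (\<lambda>v. m x) {a, b}"
        by (rule sum.mono_neutral_cong_right) (use fin in auto)
      moreover have "sum (\<lambda>v. if v = u then real (card {a, b}) * m x else 0) ?V = real (card {a, b}) * m x"
        using fin by (subst sum.delta) auto
      moreover have "sum x ?V = 1"
        by (rule carrier_sum[OF x fin]) auto
      ultimately show "sum (g x) ?V = 1"
        unfolding g_def by (simp add: sum.distrib sum_subtractf)
    qed
  qed
  have cont: "continuous_on S g" for S
    unfolding g_def m_def
    by (intro continuous_on_coordinatewise_then_product)
      (intro continuous_on_if_const continuous_intros cont_coord)
  have pp: "pt p \<in> carrier ?K'" using p by simp
  have gp: "g (pt p) = pt p" using gid m0 pp by blast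
  show ?thesis
    unfolding pointed_heq_def
  proof (intro conjI exI)
    show "continuous_map (gr ?K') (gr K) id"
      using sub by (auto simp: continuous_map_subtopology_eu)
    show "continuous_map (gr K) (gr ?K') g"
      using cont g_in by (auto simp: continuous_map_subtopology_eu)
    show "homotopic_with (\<lambda>h. h (pt p) = pt p) (gr ?K') (gr ?K') (g \<circ> id) id"
      by (rule homotopic_with_equal)
        (use cont g_in gid m0 gp sub in \<open>auto simp: continuous_map_subtopology_eu\<close>)
    show "homotopic_with (\<lambda>h. h (pt p) = pt p) (gr K) (gr K) (id \<circ> g) id"
      by (simp, rule contiguous_homotopic[OF K cont])
        (use g_in sub gp supp_g in \<open>auto intro: continuous_intros\<close>)
  qed (use p gp in auto)
qed

lemma pointed_heq_relabel:
  fixes K :: "'a set set" and h :: "'a \<Rightarrow> 'b"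
  assumes K: "complex K" and inj: "inj_on h (\<Union>K)" and p: "{p} \<in> K"
  shows "pointed_heq (gr K) (pt p) (gr ((`) h ` K)) (pt (h p))"
proof -
  let ?V = "\<Union>K"
  define f where "f x = (\<lambda>w. if w \<in> h ` ?V then x (inv_into ?V h w) else 0)" for x :: "'a \<Rightarrow> real"
  define g where "g z = (\<lambda>v. if v \<in> ?V then z (h v) else 0)" for z :: "'b \<Rightarrow> real"
  have V: "finite ?V" using K by (simp add: complex_def)
  have fh: "f x (h v) = x v" if "v \<in> ?V" for x v
    using inj that by (simp add: f_def)
  have supp_f: "supp (f x) = h ` supp x" if "x \<in> carrier K" for x
  proof -
    note sub = carrierD(2)[OF that]
    show ?thesis
    proof (intro set_eqI iffI)
      fix w assume w: "w \<in> supp (f x)"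
      then obtain v where v: "v \<in> ?V" "w = h v" by (auto simp: f_def supp_def split: if_splits)
      then show "w \<in> h ` supp x" using w fh[OF v(1), of x] by (simp add: supp_def)
    next
      fix w assume "w \<in> h ` supp x"
      then obtain v where v: "v \<in> supp x" "w = h v" by blast
      then have "v \<in> ?V" using sub by blast
      then show "w \<in> supp (f x)" using v fh[of v x] by (simp add: supp_def)
    qed
  qed
  have f_in: "f x \<in> carrier ((`) h ` K)" if x: "x \<in> carrier K" for x
  proof (rule carrierI[of "h ` ?V"])
    show "supp (f x) \<in> (`) h ` K" using supp_f[OF x] carrierD(2)[OF x] by auto
    show "supp (f x) \<subseteq> h ` ?V" by (auto simp: f_def supp_def)
    have "sum (f x) (h ` ?V) = sum (\<lambda>v. f x (h v)) ?V"
      by (simp add: sum.reindex[OF inj])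
    also have "\<dots> = sum x ?V"
      by (rule sum.cong) (use inj in \<open>auto simp: f_def\<close>)
    also have "\<dots> = 1"
      by (rule carrier_sum[OF x V]) (use carrierD(2)[OF x] in auto)
    finally show "sum (f x) (h ` ?V) = 1" .
  qed (use V carrierD(1)[OF x] in \<open>auto simp: f_def\<close>)
  have g_in: "g z \<in> carrier K" if z: "z \<in> carrier ((`) h ` K)" for z
  proof (rule carrierI[of ?V])
    obtain \<sigma> where \<sigma>: "\<sigma> \<in> K" "supp z = h ` \<sigma>" using carrierD(2)[OF z] by auto
    have "supp (g z) = \<sigma>"
    proof (intro set_eqI iffI)
      fix v assume "v \<in> supp (g z)"
      then have v: "v \<in> ?V" "h v \<in> h ` \<sigma>" using \<sigma>(2) by (auto simp: g_def supp_def split: if_splits)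
      moreover have "\<sigma> \<subseteq> ?V" using \<sigma>(1) by blast
      ultimately show "v \<in> \<sigma>" using inj_on_image_mem_iff[OF inj] by blast
    next
      fix v assume v: "v \<in> \<sigma>"
      then have "h v \<in> supp z" "v \<in> ?V" using \<sigma> by auto
      then show "v \<in> supp (g z)" by (simp add: g_def supp_def)
    qed
    then show "supp (g z) \<in> K" using \<sigma> by simp
    show "supp (g z) \<subseteq> ?V" by (auto simp: g_def supp_def)
    have "sum (g z) ?V = sum z (h ` ?V)"
      by (simp add: sum.reindex[OF inj] g_def)
    also have "\<dots> = 1"
      by (rule carrier_sum[OF z]) (use V \<sigma> in auto)
    finally show "sum (g z) ?V = 1" .
  qed (use V carrierD(1)[OF z] in \<open>auto simp: g_def\<close>)
  have gf: "g (f x) = x" if x: "x \<in> carrier K" for x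
  proof
    fix v
    have "x v = 0" if "v \<notin> ?V" using that carrierD(2)[OF x] by (auto simp: supp_def)
    then show "g (f x) v = x v" by (simp add: g_def fh)
  qed
  have fg: "f (g z) = z" if z: "z \<in> carrier ((`) h ` K)" for z
  proof
    fix w
    show "f (g z) w = z w"
    proof (cases "w \<in> h ` ?V")
      case True
      then obtain v where v: "v \<in> ?V" "w = h v" by blast
      then show ?thesis by (simp add: fh g_def)
    next
      case False
      then have "w \<notin> supp z" using carrierD(2)[OF z] by blast
      then show ?thesis using False by (simp add: f_def supp_def)
    qed
  qed
  have fp: "f (pt p) = pt (h p)"
  proof
    fix w
    have "p \<in> ?V" using p by auto
    show "f (pt p) w = pt (h p) w"
    proof (cases "w \<in> h ` ?V")
      case True
      then obtain v where v: "v \<in> ?V" "w = h v" by blast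
      then show ?thesis using \<open>p \<in> ?V\<close> inj_on_eq_iff[OF inj] by (simp add: fh pt_def)
    next
      case False
      then show ?thesis using \<open>p \<in> ?V\<close> by (auto simp: f_def pt_def)
    qed
  qed
  have "continuous_on (carrier K) f"
  proof (rule continuous_on_coordinatewise_then_product)
    show "continuous_on (carrier K) (\<lambda>x. f x i)" for i
      by (cases "i \<in> h ` ?V") (auto simp: f_def intro!: cont_coord continuous_intros)
  qed
  moreover have "continuous_on (carrier ((`) h ` K)) g"
  proof (rule continuous_on_coordinatewise_then_product)
    show "continuous_on (carrier ((`) h ` K)) (\<lambda>x. g x i)" for i
      by (cases "i \<in> ?V") (auto simp: g_def intro!: cont_coord continuous_intros)
  qed
  ultimately have "homeomorphic_maps (gr K) (gr ((`) h ` K)) f g"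
    using f_in g_in fg gf by (auto simp: homeomorphic_maps_def continuous_map_subtopology_eu)
  then show ?thesis
    by (rule homeomorphic_maps_imp_pointed_heq) (use p fp in auto)
qed

text \<open>The constant map at the apex is contiguous to the identity.\<close>

lemma pointed_heq_cone:
  assumes K: "complex K" and apex: "\<And>\<tau>. \<tau> \<in> K \<Longrightarrow> insert p \<tau> \<in> K" and "K \<noteq> {}"
    and Y: "topspace Y = {q}"
  shows "pointed_heq (gr K) (pt p) Y q"
proof -
  have p: "{p} \<in> K" using apex \<open>K \<noteq> {}\<close> complex_mono[OF K] by blast
  show ?thesis
    unfolding pointed_heq_def
  proof (intro conjI exI)
    show "homotopic_with (\<lambda>h. h (pt p) = pt p) (gr K) (gr K) ((\<lambda>_. pt p) \<circ> (\<lambda>_. q)) id"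
      unfolding o_def
      by (rule contiguous_homotopic[OF K])
        (use apex carrierD(2) p in \<open>auto intro: continuous_intros\<close>)
    show "homotopic_with (\<lambda>h. h q = q) Y Y ((\<lambda>_. q) \<circ> (\<lambda>_. pt p)) id"
      by (rule homotopic_with_equal) (use Y in auto)
  qed (use p Y in auto)
qed

text \<open>The free end of a whisker is a base point outside \<open>K\<close>; once the base point
  sits there, the foot of the whisker can be moved while the base point rests. The inclusion of
  \<open>K\<close> does not carry \<open>p\<close> to the free end, so the inverse of the collapse
  \<open>\<phi>\<close> has to stretch a neighbourhood of \<open>p\<close> along the
  whisker.\<close>

lemma pointed_heq_whisker:
  fixes K :: "'a set set"
  assumes K: "complex K" and p: "{p} \<in> K"
  defines "W \<equiv> (`) Some ` K \<union> {{None}, {None, Some p}}"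
  shows "pointed_heq (gr K) (pt p) (gr W) (pt None)"
proof -
  let ?V = "\<Union>K"
  have V: "finite ?V" using K by (simp add: complex_def)
  have pV: "p \<in> ?V" using p by auto
  have emp: "{} \<in> K" using complex_mono[OF K p] by auto
  have W: "complex W"
    unfolding complex_def
  proof (intro conjI ballI allI impI)
    show "finite (\<Union>W)" using V unfolding W_def by (simp flip: image_Union)
    fix \<sigma> \<tau> assume "\<sigma> \<in> W" "\<tau> \<subseteq> \<sigma>"
    consider \<rho> where "\<rho> \<in> K" "\<sigma> = Some ` \<rho>" | "\<sigma> \<subseteq> {None, Some p}"
      using \<open>\<sigma> \<in> W\<close> by (auto simp: W_def)
    then show "\<tau> \<in> W"
    proof cases
      case 1
      then obtain \<rho>' where "\<rho>' \<subseteq> \<rho>" "\<tau> = Some ` \<rho>'" using \<open>\<tau> \<subseteq> \<sigma>\<close> by (auto simp: subset_image_iff)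
      then show ?thesis using complex_mono[OF K 1(1)] by (auto simp: W_def)
    next
      case 2
      then have "\<tau> \<in> {{}, {None}, {Some p}, {None, Some p}}" using \<open>\<tau> \<subseteq> \<sigma>\<close> by auto
      moreover have "{} \<in> W" "{Some p} \<in> W" using emp p by (force simp: W_def)+
      ultimately show ?thesis by (auto simp: W_def)
    qed
  qed
  let ?U = "insert None (Some ` ?V)"
  have U: "finite ?U" using V by simp
  have SomeW: "\<tau> \<in> W" if "\<tau> \<subseteq> Some ` \<sigma>" "\<sigma> \<in> K" for \<tau> \<sigma>
    using that complex_mono[OF W, of "Some ` \<sigma>" \<tau>] by (auto simp: W_def)
  have NoneW: "\<tau> \<in> W" if "\<tau> \<subseteq> {None, Some p}" for \<tau>
    using that complex_mono[OF W, of "{None, Some p}" \<tau>] by (auto simp: W_def)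
  have W_cases: "\<sigma> \<subseteq> {None, Some p} \<or> (\<exists>\<rho>\<in>K. \<sigma> = Some ` \<rho>)" if "\<sigma> \<in> W" for \<sigma>
    using that by (auto simp: W_def)
  define \<phi> where "\<phi> z = (\<lambda>v. z (Some v) + (if v = p then z None else 0))" for z :: "'a option \<Rightarrow> real"
  \<comment> \<open>Radial flow out of the vertex \<open>p\<close>: the outer half of its star covers the star, the inner half
    runs along the whisker.\<close>
  define \<Psi> where "\<Psi> x = (\<lambda>i. case i of None \<Rightarrow> max 0 (2 * x p - 1)
     | Some v \<Rightarrow> if v = p then x p * (1 - x p) else x v * max 0 (1 - 2 * x p))" for x :: "'a \<Rightarrow> real"
  define \<psi> where "\<psi> x = normalize ?U (\<Psi> x)" for x
  \<comment> \<open>Intermediate map: near \<open>p\<close> the point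
    \<open>\<psi> (\<phi> z)\<close> lies on the whisker while \<open>z\<close> may have further
    vertices in its support, so the two need not share a face. \<open>C\<close> fades these vertices
    out, completely once \<open>Some p\<close> and \<open>None\<close> together have weight 1/2, the
    threshold at which \<open>\<Psi>\<close> enters the whisker.\<close>
  define C where "C z = (\<lambda>i. z i * (if i = None \<or> i = Some p then 1 else max 0 (1 - 2 * (z (Some p) + z None))))"
    for z :: "'a option \<Rightarrow> real"
  define c where "c z = normalize ?U (C z)" for z
  have xV: "supp x \<subseteq> ?V" if "x \<in> carrier K" for x using carrierD(2)[OF that] by auto
  have zU: "supp z \<subseteq> ?U" if "z \<in> carrier W" for z
    using W_cases[OF carrierD(2)[OF that]] pV by blast
  have \<Psi>: "0 \<le> \<Psi> x i" "supp (\<Psi> x) \<subseteq> ?U" "supp (\<Psi> x) \<noteq> {}" "supp (\<Psi> x) \<in> W"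
      "x p < 1/2 \<Longrightarrow> supp (\<Psi> x) \<subseteq> Some ` supp x" "x p \<ge> 1/2 \<Longrightarrow> supp (\<Psi> x) \<subseteq> {None, Some p}"
    if x: "x \<in> carrier K" for x i
  proof -
    note x0 = carrierD(1)[OF x] and x1 = carrier_le_1[OF x]
    show "0 \<le> \<Psi> x i" using x0 x1 by (auto simp: \<Psi>_def split: option.split)
    show "supp (\<Psi> x) \<subseteq> ?U"
    proof
      fix i assume i: "i \<in> supp (\<Psi> x)"
      show "i \<in> ?U"
      proof (cases i)
        case (Some v)
        then have "v = p \<or> v \<in> supp x" using i by (auto simp: \<Psi>_def supp_def split: if_splits)
        then show ?thesis using Some xV[OF x] pV by blast
      qed simp
    qed
    show 1: "supp (\<Psi> x) \<subseteq> Some ` supp x" if "x p < 1/2"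
      using that by (auto simp: \<Psi>_def supp_def split: option.splits if_splits)
    show 2: "supp (\<Psi> x) \<subseteq> {None, Some p}" if "x p \<ge> 1/2"
      using that by (auto simp: \<Psi>_def supp_def split: option.splits if_splits)
    show "supp (\<Psi> x) \<in> W"
      using 1 2 SomeW[OF _ carrierD(2)[OF x]] NoneW by (cases "x p < 1/2") auto
    show "supp (\<Psi> x) \<noteq> {}"
    proof (cases "x p < 1/2")
      case True
      then obtain u where "u \<noteq> p" "x u > 0" using carrier_other[OF x, of p] by auto
      then have "\<Psi> x (Some u) \<noteq> 0" using True by (auto simp: \<Psi>_def)
      then show ?thesis by (auto simp: supp_def)
    next
      case False
      then have "\<Psi> x None \<noteq> 0 \<or> \<Psi> x (Some p) \<noteq> 0" by (auto simp: \<Psi>_def)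
      then show ?thesis by (auto simp: supp_def)
    qed
  qed
  have \<psi>_in: "\<psi> x \<in> carrier W" and supp_\<psi>: "supp (\<psi> x) = supp (\<Psi> x)" if x: "x \<in> carrier K" for x
    unfolding \<psi>_def
    by (rule normalize_in_carrier[OF U \<Psi>(1,2,3,4)[OF x]], rule supp_normalize[OF U \<Psi>(1,2,3)[OF x]])
  have cont_\<psi>: "continuous_on (carrier K) \<psi>"
    unfolding \<psi>_def
  proof (rule continuous_on_normalize[OF U])
    show "continuous_on (carrier K) (\<lambda>x. \<Psi> x v)" for v
      by (cases v) (auto simp: \<Psi>_def intro!: continuous_on_if_const continuous_intros cont_coord)
  qed (use \<Psi> in auto)
  have \<psi>p: "\<psi> (pt p) = pt None"
    unfolding \<psi>_def by (rule normalize_pt[OF U, where c = 1]) (auto simp: \<Psi>_def pt_def split: option.split)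
  have supp_\<phi>: "supp (\<phi> z) \<in> K" "\<And>\<sigma>. supp z = Some ` \<sigma> \<Longrightarrow> supp (\<phi> z) \<subseteq> \<sigma>"
    "supp z \<subseteq> {None, Some p} \<Longrightarrow> supp (\<phi> z) \<subseteq> {p}" if z: "z \<in> carrier W" for z
  proof -
    show 1: "supp (\<phi> z) \<subseteq> \<sigma>" if "supp z = Some ` \<sigma>" for \<sigma>
    proof
      fix v assume "v \<in> supp (\<phi> z)"
      moreover have "None \<notin> supp z" using that by auto
      ultimately have "Some v \<in> supp z" by (auto simp: \<phi>_def supp_def split: if_splits)
      then show "v \<in> \<sigma>" using that by auto
    qed
    show 2: "supp (\<phi> z) \<subseteq> {p}" if "supp z \<subseteq> {None, Some p}"
    proof
      fix v assume "v \<in> supp (\<phi> z)"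
      then have "v = p \<or> Some v \<in> supp z" by (auto simp: \<phi>_def supp_def split: if_splits)
      then show "v \<in> {p}" using that by auto
    qed
    show "supp (\<phi> z) \<in> K"
      using W_cases[OF carrierD(2)[OF z]]
    proof
      assume "supp z \<subseteq> {None, Some p}"
      then show ?thesis using complex_mono[OF K p 2] by simp
    next
      assume "\<exists>\<rho>\<in>K. supp z = Some ` \<rho>"
      then obtain \<rho> where "\<rho> \<in> K" "supp z = Some ` \<rho>" by blast
      then show ?thesis using complex_mono[OF K _ 1] by simp
    qed
  qed
  have \<phi>_in: "\<phi> z \<in> carrier K" if z: "z \<in> carrier W" for z
  proof (rule carrierI[OF V])
    have "sum (\<phi> z) ?V = sum (\<lambda>v. z (Some v)) ?V + sum (\<lambda>v. if v = p then z None else 0) ?V"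
      unfolding \<phi>_def by (simp add: sum.distrib)
    also have "\<dots> = sum z (Some ` ?V) + z None"
      using V pV by (simp add: sum.reindex)
    also have "\<dots> = sum z ?U"
      using V by (subst sum.insert) auto
    also have "\<dots> = 1" by (rule carrier_sum[OF z U zU[OF z]])
    finally show "sum (\<phi> z) ?V = 1" .
  qed (use carrierD(1)[OF z] supp_\<phi>(1)[OF z] in \<open>auto simp: \<phi>_def\<close>)
  have cont_\<phi>: "continuous_on S \<phi>" for S
    unfolding \<phi>_def
  proof (rule continuous_on_coordinatewise_then_product)
    show "continuous_on S (\<lambda>z. z (Some i) + (if i = p then z None else 0))" for i
      by (cases "i = p") (auto intro!: continuous_intros cont_coord)
  qed
  have C: "0 \<le> C z i" "supp (C z) \<subseteq> supp z" "supp (C z) \<noteq> {}"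
    "z (Some p) + z None \<ge> 1/2 \<Longrightarrow> supp (C z) \<subseteq> {None, Some p}"
    if z: "z \<in> carrier W" for z i
  proof -
    note z0 = carrierD(1)[OF z]
    show "0 \<le> C z i" using z0 by (simp add: C_def)
    show "supp (C z) \<subseteq> supp z" by (rule subsetI) (simp add: C_def supp_def)
    show "supp (C z) \<subseteq> {None, Some p}" if "z (Some p) + z None \<ge> 1/2"
      using that by (intro subsetI) (simp add: C_def supp_def split: if_splits)
    have "\<exists>i. C z i \<noteq> 0"
    proof (cases "z (Some p) + z None = 0")
      case True
      obtain i where "z i \<noteq> 0" using carrierD(5)[OF z] by (auto simp: supp_def)
      then have "C z i \<noteq> 0" using True by (simp add: C_def)
      then show ?thesis by blast
    next
      case False
      then have "C z None \<noteq> 0 \<or> C z (Some p) \<noteq> 0" by (simp add: C_def)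
      then show ?thesis by blast
    qed
    then show "supp (C z) \<noteq> {}" by (simp add: supp_def)
  qed
  have c_in: "c z \<in> carrier W" and supp_c: "supp (c z) = supp (C z)" if z: "z \<in> carrier W" for z
    unfolding c_def
    by (rule normalize_in_carrier[OF U C(1)[OF z] subset_trans[OF C(2)[OF z] zU[OF z]] C(3)[OF z]
          complex_mono[OF W carrierD(2)[OF z] C(2)[OF z]]],
        rule supp_normalize[OF U C(1)[OF z] subset_trans[OF C(2)[OF z] zU[OF z]] C(3)[OF z]])
  have cont_c: "continuous_on (carrier W) c"
    unfolding c_def
  proof (rule continuous_on_normalize[OF U])
    show "continuous_on (carrier W) (\<lambda>x. C x v)" for v
      unfolding C_def by (intro continuous_on_if_const continuous_intros cont_coord)
  qed (use C(1,3) subset_trans[OF C(2) zU] in simp_all)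
  have cp: "c (pt None) = pt None"
    unfolding c_def by (rule normalize_pt[OF U, where c = 1]) (auto simp: C_def pt_def split: option.split)
  have \<phi>p: "\<phi> (pt None) = pt p"
    by (auto simp: \<phi>_def pt_def)
  have 1: "homotopic_with (\<lambda>h. h (pt p) = pt p) (gr K) (gr K) (\<phi> \<circ> \<psi>) id"
  proof (rule contiguous_homotopic[OF K])
    show "continuous_on (carrier K) (\<phi> \<circ> \<psi>)" using cont_\<psi> cont_\<phi> by (rule continuous_on_compose)
    fix x assume x: "x \<in> carrier K"
    show "(\<phi> \<circ> \<psi>) x \<in> carrier K" using \<phi>_in \<psi>_in x by simp
    have "supp (\<phi> (\<psi> x)) \<subseteq> supp x"
    proof (cases "x p < 1/2")
      case True
      then have *: "supp (\<psi> x) \<subseteq> Some ` supp x" using \<Psi>(5) supp_\<psi> x by auto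
      then obtain \<sigma> where "\<sigma> \<subseteq> supp x" "supp (\<psi> x) = Some ` \<sigma>" by (auto simp: subset_image_iff)
      then show ?thesis using supp_\<phi>(2) \<psi>_in x by blast
    next
      case False
      then have "supp (\<psi> x) \<subseteq> {None, Some p}" using \<Psi>(6) supp_\<psi> x by auto
      moreover have "p \<in> supp x" using False by (auto simp: supp_def)
      ultimately show ?thesis using supp_\<phi>(3) \<psi>_in x by blast
    qed
    then show "supp ((\<phi> \<circ> \<psi>) x) \<union> supp (id x) \<in> K"
      using carrierD(2)[OF x] by (simp add: Un_absorb1)
  qed (use \<psi>p \<phi>p in \<open>auto intro: continuous_intros\<close>)
  have 2: "homotopic_with (\<lambda>h. h (pt None) = pt None) (gr W) (gr W) c id"
    by (rule contiguous_homotopic[OF W cont_c])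
      (use c_in C(2) supp_c carrierD(2) cp in \<open>auto intro: continuous_intros simp: Un_absorb1\<close>)
  have 3: "homotopic_with (\<lambda>h. h (pt None) = pt None) (gr W) (gr W) (\<psi> \<circ> \<phi>) c"
  proof (rule contiguous_homotopic[OF W _ cont_c])
    show "continuous_on (carrier W) (\<psi> \<circ> \<phi>)"
      by (rule continuous_on_compose[OF cont_\<phi>]) (rule continuous_on_subset[OF cont_\<psi>], use \<phi>_in in auto)
    fix z assume z: "z \<in> carrier W"
    show "(\<psi> \<circ> \<phi>) z \<in> carrier W" using \<phi>_in \<psi>_in z by simp
    have \<phi>zp: "\<phi> z p = z (Some p) + z None" by (simp add: \<phi>_def)
    show "supp ((\<psi> \<circ> \<phi>) z) \<union> supp (c z) \<in> W"
    proof (cases "\<phi> z p < 1/2")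
      case True
      have a: "supp (\<psi> (\<phi> z)) \<subseteq> Some ` supp (\<phi> z)"
        using \<Psi>(5)[OF \<phi>_in[OF z]] supp_\<psi>[OF \<phi>_in[OF z]] True by simp
      have "\<not> supp z \<subseteq> {None, Some p}"
      proof
        assume "supp z \<subseteq> {None, Some p}"
        then have "sum z {None, Some p} = 1" by (intro carrier_sum[OF z]) auto
        then show False using True \<phi>zp by simp
      qed
      then obtain \<rho> where \<rho>: "\<rho> \<in> K" "supp z = Some ` \<rho>" using W_cases[OF carrierD(2)[OF z]] by blast
      have "supp (\<psi> (\<phi> z)) \<subseteq> Some ` \<rho>" using a supp_\<phi>(2)[OF z \<rho>(2)] by blast
      moreover have "supp (c z) \<subseteq> Some ` \<rho>" using supp_c[OF z] C(2)[OF z] \<rho> by simp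
      ultimately show ?thesis using SomeW[OF _ \<rho>(1)] by simp
    next
      case False
      then show ?thesis
        using \<Psi>(6)[OF \<phi>_in[OF z]] supp_\<psi>[OF \<phi>_in[OF z]] C(4)[OF z] supp_c[OF z] \<phi>zp
        by (intro NoneW) auto
    qed
  qed (use c_in \<psi>p \<phi>p cp in auto)
  show ?thesis
    unfolding pointed_heq_def
  proof (intro conjI exI)
    show "homotopic_with (\<lambda>h. h (pt None) = pt None) (gr W) (gr W) (\<psi> \<circ> \<phi>) id"
      using 3 2 by (rule homotopic_with_trans)
    show "pt None \<in> topspace (gr W)" by (simp add: W_def)
  qed (use p 1 \<psi>p \<phi>p cont_\<psi> cont_\<phi> \<psi>_in \<phi>_in in \<open>auto simp: continuous_map_subtopology_eu\<close>)
qed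

text \<open>Hang a whisker with free end \<open>r\<close> at \<open>p\<close>, fill in the triangle \<open>p q r\<close>, and collapse it onto a whisker
  at \<open>q\<close>; the base point \<open>r\<close> stays fixed.\<close>

lemma pointed_heq_base_change:
  fixes K :: "'a set set"
  assumes K: "complex K" and pq: "{p, q} \<in> K"
  shows "pointed_heq (gr K) (pt p) (gr K) (pt q)"
proof (cases "p = q")
  case True
  then show ?thesis
    by (intro homeomorphic_maps_imp_pointed_heq[where f = id and g = id])
      (use complex_mono[OF K pq] in \<open>auto simp: homeomorphic_maps_def\<close>)
next
  case False
  let ?W = "\<lambda>v. (`) Some ` K \<union> {{None}, {None, Some v}}"
  let ?T = "(`) Some ` K \<union> {{None}, {None, Some p}, {None, Some q}, {None, Some p, Some q}}"
  have p: "{p} \<in> K" "{q} \<in> K" and emp: "{} \<in> K" using complex_mono[OF K pq] by auto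
  have T: "complex ?T"
    unfolding complex_def
  proof (intro conjI ballI allI impI)
    have "finite (\<Union>K)" using K by (simp add: complex_def)
    then show "finite (\<Union>?T)" by (simp flip: image_Union)
    fix \<sigma> \<tau> assume "\<sigma> \<in> ?T" "\<tau> \<subseteq> \<sigma>"
    consider \<rho> where "\<rho> \<in> K" "\<sigma> = Some ` \<rho>" | "\<sigma> \<subseteq> {None, Some p, Some q}"
      using \<open>\<sigma> \<in> ?T\<close> by auto
    then show "\<tau> \<in> ?T"
    proof cases
      case 1
      then obtain \<rho>' where "\<rho>' \<subseteq> \<rho>" "\<tau> = Some ` \<rho>'" using \<open>\<tau> \<subseteq> \<sigma>\<close> by (auto simp: subset_image_iff)
      then show ?thesis using complex_mono[OF K 1(1)] by auto
    next
      case 2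
      show ?thesis
      proof (cases "None \<in> \<tau>")
        case True
        have "\<tau> - {None} \<in> Pow {Some p, Some q}" using 2 \<open>\<tau> \<subseteq> \<sigma>\<close> by auto
        then have "\<tau> - {None} \<in> {{}, {Some p}, {Some q}, {Some p, Some q}}"
          by (auto simp: Pow_insert)
        then have "insert None (\<tau> - {None}) \<in> ?T" by auto
        then show ?thesis using True by (simp add: insert_absorb)
      next
        case False
        then have "\<tau> \<subseteq> Some ` {p, q}" using 2 \<open>\<tau> \<subseteq> \<sigma>\<close> by auto
        then obtain \<rho> where "\<rho> \<subseteq> {p, q}" "\<tau> = Some ` \<rho>" by (rule subset_imageE)
        then show ?thesis using complex_mono[OF K pq] by auto
      qed
    qed
  qed
  \<comment> \<open>Apart from itself, the edge from the free end to \<open>q\<close> lies only in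
    the triangle, so \<open>p\<close> can be added to every face containing it. Removing it together
    with the triangle leaves the whisker at \<open>p\<close>; the other equation exchanges
    \<open>p\<close> and \<open>q\<close>.\<close>
  have eq: "{\<tau> \<in> ?T. \<not> {None, Some q} \<subseteq> \<tau>} = ?W p" "{\<tau> \<in> ?T. \<not> {None, Some p} \<subseteq> \<tau>} = ?W q"
    using False by auto
  have S: "{Some p, Some q} \<in> ?T" using imageI[OF pq, of "(`) Some"] by simp
  have "pointed_heq (gr (?W p)) (pt None) (gr ?T) (pt None)"
    using pointed_heq_collapse[OF T, where u = "Some p" and a = None and b = "Some q" and p = None] False
    unfolding eq by auto
  moreover have "pointed_heq (gr (?W q)) (pt None) (gr ?T) (pt None)"
    using pointed_heq_collapse[OF T, where u = "Some q" and a = None and b = "Some p" and p = None] False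
    unfolding eq by (auto simp: insert_commute)
  ultimately show ?thesis
    by (meson pointed_heq_whisker[OF K] p pointed_heq_trans pointed_heq_sym)
qed

section \<open>Splitting off the suspension of a link\<close>

lemma normalized_map:
  fixes F :: "'b::topological_space \<Rightarrow> 'a \<Rightarrow> real"
  assumes K: "complex K" and cont: "\<And>i. continuous_on S (\<lambda>x. F x i)"
    and nonneg: "\<And>x i. x \<in> S \<Longrightarrow> 0 \<le> F x i"
    and mem: "\<And>x. x \<in> S \<Longrightarrow> supp (F x) \<in> K" and ne: "\<And>x. x \<in> S \<Longrightarrow> \<exists>i. F x i \<noteq> 0"
  shows "continuous_on S (\<lambda>x. normalize (\<Union>K) (F x))"
    and "\<And>x. x \<in> S \<Longrightarrow> normalize (\<Union>K) (F x) \<in> carrier K"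
    and "\<And>x. x \<in> S \<Longrightarrow> supp (normalize (\<Union>K) (F x)) = supp (F x)"
proof -
  have fin: "finite (\<Union>K)" using K by (simp add: complex_def)
  have sub: "supp (F x) \<subseteq> \<Union>K" and ne': "supp (F x) \<noteq> {}" if "x \<in> S" for x
    using mem[OF that] ne[OF that] by (auto simp: supp_def)
  show "continuous_on S (\<lambda>x. normalize (\<Union>K) (F x))"
    by (rule continuous_on_normalize[OF fin cont nonneg sub ne'])
  show "normalize (\<Union>K) (F x) \<in> carrier K" if "x \<in> S" for x
    by (rule normalize_in_carrier[OF fin nonneg[OF that] sub[OF that] ne'[OF that] mem[OF that]])
  show "supp (normalize (\<Union>K) (F x)) = supp (F x)" if "x \<in> S" for x
    by (rule supp_normalize[OF fin nonneg[OF that] sub[OF that] ne'[OF that]])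
qed

definition link :: "'a set set \<Rightarrow> 'a \<Rightarrow> 'a set set" where
  "link K v = {\<rho>. v \<notin> \<rho> \<and> insert v \<rho> \<in> K}"

text \<open>The poles are parameters because one of them has to be an existing vertex: in
  \<open>detach\<close> it is the point at which the suspension touches the deletion.\<close>

definition susp :: "'a \<Rightarrow> 'a \<Rightarrow> 'a set set \<Rightarrow> 'a set set" where
  "susp v w L = {\<tau>. \<exists>\<rho>\<in>L. \<tau> \<subseteq> insert w \<rho> \<or> \<tau> \<subseteq> insert v \<rho>}"

text \<open>The one-point union of the deletion of \<open>v\<close> and of the suspension of a disjoint copy of its link,
  glued at \<open>w\<close>.\<close>

definition detach :: "'a set set \<Rightarrow> 'a \<Rightarrow> 'a \<Rightarrow> ('a + 'a) set set" where
  "detach K v w = (`) Inl ` {\<tau> \<in> K. v \<notin> \<tau>} \<union> susp (Inr v) (Inl w) ((`) Inr ` link K v)"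

lemma detachE:
  assumes "\<tau> \<in> detach K v w"
  obtains \<rho> where "\<rho> \<in> K" "v \<notin> \<rho>" "\<tau> = Inl ` \<rho>"
    | \<rho> where "\<rho> \<in> link K v" "\<tau> \<subseteq> insert (Inl w) (Inr ` \<rho>)"
    | \<rho> where "\<rho> \<in> link K v" "\<tau> \<subseteq> insert (Inr v) (Inr ` \<rho>)"
proof -
  consider "\<tau> \<in> (`) Inl ` {\<tau> \<in> K. v \<notin> \<tau>}" | "\<tau> \<in> susp (Inr v) (Inl w) ((`) Inr ` link K v)"
    using assms unfolding detach_def by (elim UnE)
  then show thesis
  proof cases
    case 1
    then obtain \<rho> where "\<rho> \<in> {\<tau> \<in> K. v \<notin> \<tau>}" "\<tau> = Inl ` \<rho>" by (rule imageE)
    then show thesis by (intro that(1)[of \<rho>]) simp_all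
  next
    case 2
    then obtain \<rho> where "\<rho> \<in> link K v" "\<tau> \<subseteq> insert (Inl w) (Inr ` \<rho>) \<or> \<tau> \<subseteq> insert (Inr v) (Inr ` \<rho>)"
      by (simp add: susp_def bex_simps) metis
    then show thesis using that(2,3) by metis
  qed
qed

lemma detachI:
  shows "\<rho> \<in> K \<Longrightarrow> v \<notin> \<rho> \<Longrightarrow> Inl ` \<rho> \<in> detach K v w"
    and "\<rho> \<in> link K v \<Longrightarrow> \<tau> \<subseteq> insert (Inl w) (Inr ` \<rho>) \<Longrightarrow> \<tau> \<in> detach K v w"
    and "\<rho> \<in> link K v \<Longrightarrow> \<tau> \<subseteq> insert (Inr v) (Inr ` \<rho>) \<Longrightarrow> \<tau> \<in> detach K v w"
  by (simp_all add: detach_def susp_def bex_simps) metis+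

lemma complex_detach:
  assumes K: "complex K"
  shows "complex (detach K v w)"
  unfolding complex_def
proof (intro conjI ballI allI impI)
  have fin: "finite (\<Union>K)" using K by (simp add: complex_def)
  have "\<Union>(detach K v w) \<subseteq> insert (Inl w) (insert (Inr v) (Inl ` \<Union>K \<union> Inr ` \<Union>K))"
  proof (rule Union_least)
    fix \<tau> assume "\<tau> \<in> detach K v w"
    then show "\<tau> \<subseteq> insert (Inl w) (insert (Inr v) (Inl ` \<Union>K \<union> Inr ` \<Union>K))"
    proof (cases rule: detachE)
      case (1 \<rho>)
      then show ?thesis using Union_upper[OF 1(1)] by blast
    next
      case (2 \<rho>)
      then have "insert v \<rho> \<subseteq> \<Union>K" by (intro Union_upper) (simp add: link_def)
      then have "Inr ` \<rho> \<subseteq> Inr ` \<Union>K" by (intro image_mono) simp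
      then show ?thesis by (intro order_trans[OF 2(2)] insert_mono subset_insertI2 le_supI2)
    next
      case (3 \<rho>)
      then have "insert v \<rho> \<subseteq> \<Union>K" by (intro Union_upper) (simp add: link_def)
      then have "Inr ` \<rho> \<subseteq> Inr ` \<Union>K" by (intro image_mono) simp
      then have "insert (Inr v) (Inr ` \<rho>) \<subseteq> insert (Inr v) (Inl ` \<Union>K \<union> Inr ` \<Union>K)"
        by (intro insert_mono le_supI2)
      then show ?thesis using 3(2) by (meson order_trans subset_insertI)
    qed
  qed
  then show "finite (\<Union>(detach K v w))"
    by (rule finite_subset) (use fin in simp)
  fix \<sigma> \<tau> assume \<sigma>: "\<sigma> \<in> detach K v w" and "\<tau> \<subseteq> \<sigma>"
  from \<sigma> show "\<tau> \<in> detach K v w"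
  proof (cases rule: detachE)
    case (1 \<rho>)
    obtain \<rho>' where \<rho>': "\<rho>' \<subseteq> \<rho>" "\<tau> = Inl ` \<rho>'"
      using \<open>\<tau> \<subseteq> \<sigma>\<close> unfolding 1(3) by (rule subset_imageE)
    have "v \<notin> \<rho>'" using \<rho>'(1) 1(2) by blast
    then show ?thesis using detachI(1)[OF complex_mono[OF K 1(1) \<rho>'(1)]] \<rho>'(2) by simp
  next
    case (2 \<rho>)
    show ?thesis by (rule detachI(2)[OF 2(1) subset_trans[OF \<open>\<tau> \<subseteq> \<sigma>\<close> 2(2)]])
  next
    case (3 \<rho>)
    show ?thesis by (rule detachI(3)[OF 3(1) subset_trans[OF \<open>\<tau> \<subseteq> \<sigma>\<close> 3(2)]])
  qed
qed

text \<open>\<open>K\<close> is the deletion of \<open>v\<close> with a cone glued on along the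
  link. The cone with apex \<open>w\<close> contracts the link inside the deletion, and a cone
  attached along a null-homotopic inclusion is, up to homotopy, a suspension hung on at a point. The
  equivalence is written out in coordinates so that \<open>w\<close> stays fixed.\<close>

lemma pointed_heq_detach:
  fixes K :: "'a set set"
  assumes K: "complex K" and w: "{w} \<in> K" and vw: "{v, w} \<notin> K" and vK: "{v} \<in> K"
    and cone: "\<And>\<rho>. \<rho> \<in> link K v \<Longrightarrow> insert w \<rho> \<in> K"
  shows "pointed_heq (gr K) (pt w) (gr (detach K v w)) (pt (Inl w))"
proof -
  let ?D = "detach K v w"
  have D: "complex ?D" using complex_detach[OF K] .
  have vnw: "v \<noteq> w" using vw vK by auto
  have V: "finite (\<Union>K)" using K by (simp add: complex_def)
  have lk_v: "v \<notin> \<rho>" and lk_K: "\<rho> \<in> K" and lk_w: "w \<notin> \<rho>" if "\<rho> \<in> link K v" for \<rho>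
  proof -
    show "v \<notin> \<rho>" using that by (simp add: link_def)
    have *: "insert v \<rho> \<in> K" using that by (simp add: link_def)
    show "\<rho> \<in> K" by (rule complex_mono[OF K *]) blast
    show "w \<notin> \<rho>"
    proof
      assume "w \<in> \<rho>"
      then have "{v, w} \<subseteq> insert v \<rho>" by blast
      then show False using complex_mono[OF K *] vw by blast
    qed
  qed
  have lk_mono: "\<rho>' \<in> link K v" if "\<rho> \<in> link K v" "\<rho>' \<subseteq> \<rho>" for \<rho> \<rho>'
    using that complex_mono[OF K, of "insert v \<rho>" "insert v \<rho>'"] unfolding link_def by blast
  have lkI: "supp x - {v} \<in> link K v" if "x \<in> carrier K" "x v \<noteq> 0" for x
    using that carrierD(2)[OF that(1)] by (simp add: link_def supp_def insert_absorb)
  have DA: "\<tau> \<in> ?D" if "\<rho> \<in> K" "v \<notin> \<rho>" "\<tau> \<subseteq> Inl ` \<rho>" for \<rho> \<tau>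
    by (rule complex_mono[OF D detachI(1)[OF that(1,2)] that(3)])
  have DB: "\<tau> \<in> ?D" if "\<rho> \<in> link K v" "\<tau> \<subseteq> insert (Inl w) (Inr ` \<rho>)" for \<rho> \<tau>
    using that by (rule detachI(2))
  have DC: "\<tau> \<in> ?D" if "\<rho> \<in> link K v" "\<tau> \<subseteq> Inr ` insert v \<rho>" for \<rho> \<tau>
    using that by (simp add: detachI(3))
  have DA': "\<tau> \<in> ?D" if "\<rho> \<in> link K v" "\<tau> \<subseteq> Inl ` insert w \<rho>" for \<rho> \<tau>
    using DA[OF cone[OF that(1)] _ that(2)] lk_v[OF that(1)] vnw by simp
  have D_cases: thesis
    if "\<tau> \<in> ?D" "\<And>\<rho>. \<rho> \<in> K \<Longrightarrow> v \<notin> \<rho> \<Longrightarrow> \<tau> \<subseteq> Inl ` \<rho> \<Longrightarrow> thesis"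
      "\<And>\<rho>. \<rho> \<in> link K v \<Longrightarrow> Inr v \<notin> \<tau> \<Longrightarrow> \<tau> \<subseteq> insert (Inl w) (Inr ` \<rho>) \<Longrightarrow> thesis"
      "\<And>\<rho>. \<rho> \<in> link K v \<Longrightarrow> Inr v \<in> \<tau> \<Longrightarrow> \<tau> \<subseteq> Inr ` insert v \<rho> \<Longrightarrow> thesis" for \<tau> thesis
  proof -
    from that(1) show thesis
    proof (cases rule: detachE)
      case (1 \<rho>) then show thesis using that(2)[OF 1(1,2)] by simp
    next
      case (2 \<rho>) then show thesis using that(3)[OF 2(1)] lk_v[OF 2(1)] by blast
    next
      case (3 \<rho>)
      show thesis
      proof (cases "Inr v \<in> \<tau>")
        case True then show thesis using that(4)[OF 3(1)] 3(2) by simp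
      next
        case False then show thesis using that(3)[OF 3(1)] 3(2) by blast
      qed
    qed
  qed
  \<comment> \<open>A point at height \<open>s = x v\<close> over \<open>y\<close> in the link runs, as \<open>s\<close> decreases from 1 to 0, from \<open>v\<close>
    to the copy of \<open>y\<close>, on to \<open>w\<close>, and back to \<open>y\<close> itself.\<close>
  define F where "F x = (\<lambda>i. case i of
      Inl a \<Rightarrow> if a = w then x w + max 0 (x v * (2 - 3 * x v)) else if a = v then 0 else x a * max 0 (1 - 3 * x v)
    | Inr a \<Rightarrow> if a = v then max 0 (3 * x v - 2) else x a * max 0 (3 * x v - 1))" for x :: "'a \<Rightarrow> real"
  \<comment> \<open>Merges the two copies of each vertex: the suspension is folded back into
    \<open>K\<close>, its cone over \<open>v\<close> onto the star of \<open>v\<close> and its cone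
    over \<open>w\<close> into the deletion.\<close>
  define g where "g z = (\<lambda>i. z (Inl i) + z (Inr i))" for z :: "'a + 'a \<Rightarrow> real"
  \<comment> \<open>In general neither composite is contiguous to the identity: at heights strictly
    between 0 and 2/3 the image no longer involves \<open>v\<close> but may involve
    \<open>w\<close>, and \<open>v\<close> and \<open>w\<close> share no face. \<open>k\<close> and
    \<open>k1\<close> take \<open>v\<close> out of the support up to height 2/3; they are contiguous
    to the identity because they only shrink supports.\<close>
  define k where "k x = (\<lambda>i. if i = v then max 0 (3 * x v - 2) else x i)" for x :: "'a \<Rightarrow> real"
  define k1 where "k1 z = (\<lambda>i. if i = Inr v then max 0 (3 * z (Inr v) - 2) else z i)" for z :: "'a + 'a \<Rightarrow> real"
  \<comment> \<open>On the suspension, below height 1/3, \<open>F (g z)\<close> lies over the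
    original link and \<open>k1 z\<close> over its copy, and these meet only in \<open>w\<close>.
    \<open>k2\<close> is contiguous to both and sends this part to \<open>w\<close>. The sum over
    the copied link vertices keeps the weight at \<open>w\<close> positive even at height 0, when
    \<open>z\<close> itself may have no weight there.\<close>
  define k2 where "k2 z = (\<lambda>i. case i of
      Inl a \<Rightarrow> z (Inl a) + (if a = w then max 0 (z (Inr v) * (2 - 3 * z (Inr v)))
         + (\<Sum>b\<in>\<Union>K - {v}. z (Inr b)) * max 0 (1 - 3 * z (Inr v)) else 0)
    | Inr a \<Rightarrow> if a = v then max 0 (3 * z (Inr v) - 2) else z (Inr a) * max 0 (3 * z (Inr v) - 1))"
    for z :: "'a + 'a \<Rightarrow> real"
  have F0: "supp (F x) \<subseteq> Inl ` supp x" if "x v = 0" for x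
  proof
    fix i assume "i \<in> supp (F x)"
    then show "i \<in> Inl ` supp x" using that by (cases i) (auto simp: F_def supp_def split: if_splits)
  qed
  have F1: "supp (F x) \<subseteq> Inl ` insert w (supp x - {v})" if "x v < 1/3" for x
  proof
    fix i assume "i \<in> supp (F x)"
    then show "i \<in> Inl ` insert w (supp x - {v})" using that
      by (cases i) (auto simp: F_def supp_def split: if_splits)
  qed
  have F2: "supp (F x) \<subseteq> insert (Inl w) (Inr ` (supp x - {v}))" if "1/3 \<le> x v" "x v < 2/3" for x
  proof
    fix i assume "i \<in> supp (F x)"
    then show "i \<in> insert (Inl w) (Inr ` (supp x - {v}))" using that
      by (cases i) (auto simp: F_def supp_def split: if_splits)
  qed
  have F3: "supp (F x) \<subseteq> Inr ` insert v (supp x - {v})" if "2/3 \<le> x v" "x w = 0" for x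
  proof
    fix i assume "i \<in> supp (F x)"
    moreover have "x v * (2 - 3 * x v) \<le> 0" using that by (intro mult_nonneg_nonpos) auto
    ultimately show "i \<in> Inr ` insert v (supp x - {v})" using that
      by (cases i) (auto simp: F_def supp_def max_def split: if_splits)
  qed
  have xw: "x w = 0" if "x \<in> carrier K" "x v \<noteq> 0" for x
    using lk_w[OF lkI[OF that]] vnw by (auto simp: supp_def)
  have F_mem: "supp (F x) \<in> ?D" if x: "x \<in> carrier K" for x
  proof (cases "x v = 0")
    case True
    then show ?thesis using DA[OF carrierD(2)[OF x] _ F0] by (simp add: supp_def)
  next
    case False
    note lk = lkI[OF x False]
    consider "x v < 1/3" | "1/3 \<le> x v" "x v < 2/3" | "2/3 \<le> x v" by linarith
    then show ?thesis
      using DA'[OF lk F1] DB[OF lk F2] DC[OF lk F3] xw[OF x False] by cases simp_all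
  qed
  have F_ne: "\<exists>i. F x i \<noteq> 0" if x: "x \<in> carrier K" for x
  proof -
    note x0 = carrierD(1)[OF x]
    consider "x v < 1/3" | "1/3 \<le> x v" "x v < 2/3" | "x v = 2/3" | "2/3 < x v" by linarith
    then show ?thesis
    proof cases
      case 1
      then obtain u where u: "u \<noteq> v" "x u > 0" using carrier_other[OF x, of v] by auto
      then have "F x (Inl u) > 0" using 1 by (cases "u = w") (auto simp: F_def intro: add_pos_nonneg)
      then show ?thesis by (metis less_irrefl)
    next
      case 2
      then have "x v * (2 - 3 * x v) > 0" by simp
      then have "F x (Inl w) \<noteq> 0" using x0[of w] by (simp add: F_def max_def)
      then show ?thesis by blast
    next
      case 3
      then obtain u where u: "u \<noteq> v" "x u > 0" using carrier_other[OF x, of v] by auto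
      then have "F x (Inr u) \<noteq> 0" using 3 by (simp add: F_def)
      then show ?thesis by blast
    next
      case 4
      then have "F x (Inr v) \<noteq> 0" by (simp add: F_def)
      then show ?thesis by blast
    qed
  qed
  have F_nonneg: "0 \<le> F x i" if "x \<in> carrier K" for x i
    using carrierD(1)[OF that] by (cases i) (auto simp: F_def)
  have F_cont: "continuous_on S (\<lambda>x. F x i)" for S i
    by (cases i) (simp_all only: F_def sum.case, (intro continuous_on_if_const continuous_intros cont_coord)+)
  define f where "f = (\<lambda>x. normalize (\<Union>?D) (F x))"
  have fN: "continuous_on (carrier K) f" "\<And>x. x \<in> carrier K \<Longrightarrow> f x \<in> carrier ?D"
    "\<And>x. x \<in> carrier K \<Longrightarrow> supp (f x) = supp (F x)"
    using normalized_map[where S = "carrier K" and F = F, OF D F_cont F_nonneg F_mem F_ne]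
    unfolding f_def by simp_all
  have g_supp: "supp (g z) \<subseteq> \<rho>" if "supp z \<subseteq> Inl ` \<rho> \<union> Inr ` \<rho>" for z \<rho>
  proof
    fix i assume "i \<in> supp (g z)"
    then have "Inl i \<in> supp z \<or> Inr i \<in> supp z" by (auto simp: g_def supp_def)
    then show "i \<in> \<rho>" using that by blast
  qed
  have g_mem: "supp (g z) \<in> K" if z: "z \<in> carrier ?D" for z
    using carrierD(2)[OF z]
  proof (rule D_cases)
    fix \<rho> assume "\<rho> \<in> K" "supp z \<subseteq> Inl ` \<rho>"
    then show ?thesis using complex_mono[OF K] g_supp[of z \<rho>] by blast
  next
    fix \<rho> assume \<rho>: "\<rho> \<in> link K v" "supp z \<subseteq> insert (Inl w) (Inr ` \<rho>)"
    then have "supp (g z) \<subseteq> insert w \<rho>" by (intro g_supp) blast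
    then show ?thesis using complex_mono[OF K cone[OF \<rho>(1)]] by blast
  next
    fix \<rho> assume \<rho>: "\<rho> \<in> link K v" "supp z \<subseteq> Inr ` insert v \<rho>"
    then have "supp (g z) \<subseteq> insert v \<rho>" by (intro g_supp) blast
    then show ?thesis using complex_mono[OF K, of "insert v \<rho>"] \<rho>(1) by (simp add: link_def)
  qed
  have D_sub: "\<tau> \<subseteq> Inl ` \<Union>K \<union> Inr ` \<Union>K" if "\<tau> \<in> ?D" for \<tau>
    using that
  proof (rule D_cases)
    fix \<rho> assume "\<rho> \<in> K" "\<tau> \<subseteq> Inl ` \<rho>" then show ?thesis by blast
  next
    fix \<rho> assume \<rho>: "\<rho> \<in> link K v" "\<tau> \<subseteq> insert (Inl w) (Inr ` \<rho>)"
    then show ?thesis using lk_K[OF \<rho>(1)] w by blast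
  next
    fix \<rho> assume \<rho>: "\<rho> \<in> link K v" "\<tau> \<subseteq> Inr ` insert v \<rho>"
    then have "insert v \<rho> \<in> K" by (simp add: link_def)
    then show ?thesis using \<rho>(2) by blast
  qed
  have g_in: "g z \<in> carrier K" if z: "z \<in> carrier ?D" for z
  proof (rule carrierI[OF V])
    have "sum (g z) (\<Union>K) = sum z (Inl ` \<Union>K) + sum z (Inr ` \<Union>K)"
      by (simp add: g_def sum.distrib sum.reindex)
    also have "\<dots> = sum z (Inl ` \<Union>K \<union> Inr ` \<Union>K)"
      by (rule sum.union_disjoint[symmetric]) (use V in auto)
    also have "\<dots> = 1"
      by (rule carrier_sum[OF z _ D_sub[OF carrierD(2)[OF z]]]) (use V in simp)
    finally show "sum (g z) (\<Union>K) = 1" .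
    show "0 \<le> g z i" for i using carrierD(1)[OF z] by (simp add: g_def)
    show "supp (g z) \<in> K" by (rule g_mem[OF z])
    then show "supp (g z) \<subseteq> \<Union>K" by blast
  qed
  have g_cont: "continuous_on S g" for S
    unfolding g_def by (intro continuous_on_coordinatewise_then_product continuous_intros cont_coord)
  have k_sub: "supp (k x) \<subseteq> supp x" for x
    by (rule subsetI) (auto simp: k_def supp_def split: if_splits)
  have k_sub': "supp (k x) \<subseteq> supp x - {v}" if "x v \<le> 2/3" for x
    using that by (intro subsetI) (auto simp: k_def supp_def split: if_splits)
  have k_ne: "\<exists>i. k x i \<noteq> 0" if x: "x \<in> carrier K" for x
  proof (cases "x v < 1")
    case True
    then obtain u where "u \<noteq> v" "x u > 0" using carrier_other[OF x] by blast
    then have "k x u \<noteq> 0" by (simp add: k_def)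
    then show ?thesis by blast
  next
    case False
    then have "k x v \<noteq> 0" by (simp add: k_def)
    then show ?thesis by blast
  qed
  have k_nonneg: "0 \<le> k x i" if "x \<in> carrier K" for x i
    using carrierD(1)[OF that] by (simp add: k_def)
  have k_cont: "continuous_on S (\<lambda>x. k x i)" for S i
    unfolding k_def by (intro continuous_on_if_const continuous_intros cont_coord)
  define kn where "kn = (\<lambda>x. normalize (\<Union>K) (k x))"
  have kN: "continuous_on (carrier K) kn" "\<And>x. x \<in> carrier K \<Longrightarrow> kn x \<in> carrier K"
    "\<And>x. x \<in> carrier K \<Longrightarrow> supp (kn x) = supp (k x)"
    using normalized_map[where S = "carrier K" and F = k, OF K k_cont k_nonneg complex_mono[OF K carrierD(2) k_sub] k_ne]
    unfolding kn_def by simp_all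
  have k1_sub: "supp (k1 z) \<subseteq> supp z" for z
    by (rule subsetI) (auto simp: k1_def supp_def split: if_splits)
  have k1_sub': "supp (k1 z) \<subseteq> supp z - {Inr v}" if "z (Inr v) \<le> 2/3" for z
    using that by (intro subsetI) (auto simp: k1_def supp_def split: if_splits)
  have k1_ne: "\<exists>i. k1 z i \<noteq> 0" if z: "z \<in> carrier ?D" for z
  proof (cases "z (Inr v) < 1")
    case True
    then obtain u where "u \<noteq> Inr v" "z u > 0" using carrier_other[OF z] by blast
    then have "k1 z u \<noteq> 0" by (simp add: k1_def)
    then show ?thesis by blast
  next
    case False
    then have "k1 z (Inr v) \<noteq> 0" by (simp add: k1_def)
    then show ?thesis by blast
  qed
  have k1_nonneg: "0 \<le> k1 z i" if "z \<in> carrier ?D" for z i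
    using carrierD(1)[OF that] by (simp add: k1_def)
  have k1_cont: "continuous_on S (\<lambda>x. k1 x i)" for S i
    unfolding k1_def by (intro continuous_on_if_const continuous_intros cont_coord)
  define k1n where "k1n = (\<lambda>x. normalize (\<Union>?D) (k1 x))"
  have k1N: "continuous_on (carrier ?D) k1n" "\<And>x. x \<in> carrier ?D \<Longrightarrow> k1n x \<in> carrier ?D"
    "\<And>x. x \<in> carrier ?D \<Longrightarrow> supp (k1n x) = supp (k1 x)"
    using normalized_map[where S = "carrier ?D" and F = k1, OF D k1_cont k1_nonneg complex_mono[OF D carrierD(2) k1_sub] k1_ne]
    unfolding k1n_def by simp_all
  have sumR: "(\<Sum>b\<in>\<Union>K - {v}. z (Inr b)) \<ge> 0" if "z \<in> carrier ?D" for z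
    using carrierD(1)[OF that] by (simp add: sum_nonneg)
  have k2_A: "supp (k2 z) \<subseteq> Inl ` \<rho>" if "supp z \<subseteq> Inl ` \<rho>" for z \<rho>
  proof
    have 0: "z (Inr b) = 0" for b using that by (auto simp: supp_def)
    fix i assume "i \<in> supp (k2 z)"
    then have "i \<in> supp z" using 0 by (cases i) (auto simp: k2_def supp_def split: if_splits)
    then show "i \<in> Inl ` \<rho>" using that by blast
  qed
  have k2_1: "supp (k2 z) \<subseteq> {Inl w}" if "supp z \<subseteq> insert (Inl w) (range Inr)" "z (Inr v) < 1/3" for z
  proof
    have 0: "z (Inl b) = 0" if "b \<noteq> w" for b using that \<open>supp z \<subseteq> _\<close> by (auto simp: supp_def)
    fix i assume "i \<in> supp (k2 z)"
    then show "i \<in> {Inl w}" using 0 that(2) by (cases i) (auto simp: k2_def supp_def split: if_splits)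
  qed
  have k2_2: "supp (k2 z) \<subseteq> insert (Inl w) (supp z - {Inr v})"
    if "supp z \<subseteq> insert (Inl w) (range Inr)" "z (Inr v) < 2/3" for z
  proof
    have 0: "z (Inl b) = 0" if "b \<noteq> w" for b using that \<open>supp z \<subseteq> _\<close> by (auto simp: supp_def)
    fix i assume "i \<in> supp (k2 z)"
    then show "i \<in> insert (Inl w) (supp z - {Inr v})"
      using 0 that(2) by (cases i) (auto simp: k2_def supp_def split: if_splits)
  qed
  have k2_3: "supp (k2 z) \<subseteq> supp z"
    if "2/3 \<le> z (Inr v)" for z
  proof
    fix i assume "i \<in> supp (k2 z)"
    moreover have "z (Inr v) * (2 - 3 * z (Inr v)) \<le> 0" using that by (intro mult_nonneg_nonpos) auto
    ultimately show "i \<in> supp z"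
      using that by (cases i) (auto simp: k2_def supp_def max_def split: if_splits)
  qed
  have sum_v: "z (Inl v) = 0" if z: "z \<in> carrier ?D" for z
    using carrierD(2)[OF z] by (rule D_cases) (use vnw in \<open>auto simp: supp_def\<close>)
  have gv: "g z v = z (Inr v)" if z: "z \<in> carrier ?D" for z
    using sum_v[OF z] by (simp add: g_def)
  have k2_mem: "supp (k2 z) \<union> supp (F (g z)) \<in> ?D" "supp (k2 z) \<union> supp (k1 z) \<in> ?D"
    if z: "z \<in> carrier ?D" for z
  proof -
    have "supp (k2 z) \<union> supp (F (g z)) \<in> ?D \<and> supp (k2 z) \<union> supp (k1 z) \<in> ?D"
      using carrierD(2)[OF z]
    proof (rule D_cases)
      fix \<rho> assume \<rho>: "\<rho> \<in> K" "v \<notin> \<rho>" "supp z \<subseteq> Inl ` \<rho>"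
      have "z (Inr v) = 0" using \<rho>(3) by (auto simp: supp_def)
      moreover have "supp (g z) \<subseteq> \<rho>" by (rule g_supp) (use \<rho>(3) in blast)
      ultimately have "supp (F (g z)) \<subseteq> Inl ` \<rho>"
        using gv[OF z] by (intro subset_trans[OF F0 image_mono]) simp_all
      then show ?thesis using k2_A[OF \<rho>(3)] k1_sub[of z] \<rho>(3) by (intro conjI DA[OF \<rho>(1,2)]) blast+
    next
      fix \<rho> assume \<rho>: "\<rho> \<in> link K v" "Inr v \<notin> supp z" "supp z \<subseteq> insert (Inl w) (Inr ` \<rho>)"
      have s: "z (Inr v) = 0" using \<rho>(2) by (simp add: supp_def)
      have "supp (g z) \<subseteq> insert w \<rho>" by (rule g_supp) (use \<rho>(3) in blast)
      then have "supp (F (g z)) \<subseteq> Inl ` insert w \<rho>"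
        using gv[OF z] s by (intro subset_trans[OF F0 image_mono]) simp_all
      moreover have k2: "supp (k2 z) \<subseteq> {Inl w}" by (rule k2_1) (use \<rho>(3) s in auto)
      ultimately have "supp (k2 z) \<union> supp (F (g z)) \<in> ?D" by (intro DA'[OF \<rho>(1)]) blast
      moreover have "supp (k2 z) \<union> supp (k1 z) \<in> ?D" using k2 k1_sub[of z] \<rho>(3) by (intro DB[OF \<rho>(1)]) blast
      ultimately show ?thesis ..
    next
      fix \<rho> assume \<rho>: "\<rho> \<in> link K v" "Inr v \<in> supp z" "supp z \<subseteq> Inr ` insert v \<rho>"
      have sub: "supp z \<subseteq> insert (Inl w) (range Inr)" using \<rho>(3) by blast
      have gs: "supp (g z) - {v} \<subseteq> \<rho>" using g_supp[of z "insert v \<rho>"] \<rho>(3) by blast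
      have zi: "supp z - {Inr v} \<subseteq> Inr ` \<rho>" using \<rho>(3) by blast
      have s: "g z v \<noteq> 0" using \<rho>(2) gv[OF z] by (simp add: supp_def)
      consider "g z v < 1/3" | "1/3 \<le> g z v" "g z v < 2/3" | "2/3 \<le> g z v" by linarith
      then show ?thesis
      proof cases
        case 1
        have k2: "supp (k2 z) \<subseteq> {Inl w}" by (rule k2_1[OF sub]) (use 1 gv[OF z] in simp)
        have "supp (k1 z) \<subseteq> Inr ` \<rho>" using k1_sub'[of z] zi 1 gv[OF z] by auto
        then have "supp (k2 z) \<union> supp (k1 z) \<in> ?D" using k2 by (intro DB[OF \<rho>(1)]) blast
        moreover have "supp (k2 z) \<union> supp (F (g z)) \<in> ?D"
          using F1[of "g z"] 1 gs k2 by (intro DA'[OF \<rho>(1)]) blast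
        ultimately show ?thesis by blast
      next
        case 2
        have k2: "supp (k2 z) \<subseteq> insert (Inl w) (Inr ` \<rho>)"
          using k2_2[OF sub] 2 gv[OF z] zi by auto
        have "supp (k1 z) \<subseteq> Inr ` \<rho>" using k1_sub'[of z] zi 2 gv[OF z] by auto
        then have "supp (k2 z) \<union> supp (k1 z) \<in> ?D" using k2 by (intro DB[OF \<rho>(1)]) blast
        moreover have "supp (k2 z) \<union> supp (F (g z)) \<in> ?D"
          using F2[of "g z"] 2 gs k2 by (intro DB[OF \<rho>(1)]) blast
        ultimately show ?thesis by blast
      next
        case 3
        have k2: "supp (k2 z) \<subseteq> Inr ` insert v \<rho>"
          using k2_3[of z] 3 gv[OF z] \<rho>(3) by auto
        then have "supp (k2 z) \<union> supp (k1 z) \<in> ?D" using k1_sub[of z] \<rho>(3) by (intro DC[OF \<rho>(1)]) blast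
        moreover have "supp (k2 z) \<union> supp (F (g z)) \<in> ?D"
          using F3[of "g z"] 3 xw[OF g_in[OF z] s] gs k2 by (intro DC[OF \<rho>(1)]) blast
        ultimately show ?thesis by blast
      qed
    qed
    then show "supp (k2 z) \<union> supp (F (g z)) \<in> ?D" "supp (k2 z) \<union> supp (k1 z) \<in> ?D" by auto
  qed
  have k2_nonneg: "0 \<le> k2 z i" if "z \<in> carrier ?D" for z i
    using carrierD(1)[OF that] sumR[OF that] by (cases i) (auto simp: k2_def)
  have k2_ne: "\<exists>i. k2 z i \<noteq> 0" if z: "z \<in> carrier ?D" for z
  proof -
    note z0 = carrierD(1)[OF z]
    have L: "k2 z (Inl a) \<ge> z (Inl a)" for a
      using z0 sumR[OF z] by (simp add: k2_def)
    consider "z (Inr v) = 0" | "0 < z (Inr v)" "z (Inr v) < 2/3" | "z (Inr v) = 2/3" | "2/3 < z (Inr v)"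
      using z0[of "Inr v"] by linarith
    then show ?thesis
    proof cases
      case 1
      obtain i where i: "i \<noteq> Inr v" "z i > 0" using carrier_other[OF z, of "Inr v"] 1 by auto
      show ?thesis
      proof (cases i)
        case (Inl a)
        then show ?thesis using L[of a] i(2) by (intro exI[of _ "Inl a"]) auto
      next
        case (Inr a)
        then have "Inr a \<in> supp z" using i by (simp add: supp_def)
        then have "Inr a \<in> Inl ` \<Union>K \<union> Inr ` \<Union>K" using D_sub[OF carrierD(2)[OF z]] by (rule rev_subsetD)
        then have "a \<in> \<Union>K - {v}" using i(1) Inr by (auto simp del: Union_iff)
        then have "(\<Sum>b\<in>\<Union>K - {v}. z (Inr b)) > 0"
          using i Inr V z0 by (intro sum_pos2[where i = a]) auto
        then have "k2 z (Inl w) \<noteq> 0" using 1 z0[of "Inl w"] by (simp add: k2_def)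
        then show ?thesis by blast
      qed
    next
      case 2
      then have "z (Inr v) * (2 - 3 * z (Inr v)) > 0" by simp
      moreover have "(\<Sum>b\<in>\<Union>K - {v}. z (Inr b)) * max 0 (1 - 3 * z (Inr v)) \<ge> 0"
        using sumR[OF z] by simp
      ultimately have "k2 z (Inl w) > 0" using z0[of "Inl w"] by (simp add: k2_def)
      then show ?thesis by (metis less_irrefl)
    next
      case 3
      obtain i where i: "i \<noteq> Inr v" "z i > 0" using carrier_other[OF z, of "Inr v"] 3 by auto
      show ?thesis
      proof (cases i)
        case (Inl a)
        then show ?thesis using L[of a] i(2) by (intro exI[of _ "Inl a"]) auto
      next
        case (Inr a)
        then have "k2 z (Inr a) \<noteq> 0" using i 3 by (simp add: k2_def)
        then show ?thesis by blast
      qed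
    next
      case 4
      then have "k2 z (Inr v) \<noteq> 0" by (simp add: k2_def)
      then show ?thesis by blast
    qed
  qed
  have k2_cont: "continuous_on S (\<lambda>x. k2 x i)" for S i
    by (cases i) (simp_all only: k2_def sum.case, (intro continuous_on_if_const continuous_intros cont_coord)+)
  define k2n where "k2n = (\<lambda>x. normalize (\<Union>?D) (k2 x))"
  have k2N: "continuous_on (carrier ?D) k2n" "\<And>x. x \<in> carrier ?D \<Longrightarrow> k2n x \<in> carrier ?D"
    "\<And>x. x \<in> carrier ?D \<Longrightarrow> supp (k2n x) = supp (k2 x)"
    using normalized_map[where S = "carrier ?D" and F = k2, OF D k2_cont k2_nonneg complex_mono[OF D k2_mem(1) Un_upper1] k2_ne]
    unfolding k2n_def by simp_all
  have finD: "finite (\<Union>?D)" using D by (simp add: complex_def)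
  have wD: "{Inl w} \<in> ?D" by (rule DA[OF w]) (use vnw in auto)
  then have wD': "Inl w \<in> \<Union>?D" and wK': "w \<in> \<Union>K" using w by blast+
  have fw: "f (pt w) = pt (Inl w)"
    unfolding f_def
    by (rule normalize_pt[OF finD wD', where c = 1]) (use vnw in \<open>auto simp: F_def pt_def split: sum.split\<close>)
  have gw: "g (pt (Inl w)) = pt w"
    by (auto simp: g_def pt_def)
  have kw: "kn (pt w) = pt w"
    unfolding kn_def
    by (rule normalize_pt[OF V wK', where c = 1]) (use vnw in \<open>auto simp: k_def pt_def\<close>)
  have k1w: "k1n (pt (Inl w)) = pt (Inl w)"
    unfolding k1n_def
    by (rule normalize_pt[OF finD wD', where c = 1]) (auto simp: k1_def pt_def)
  have k2w: "k2n (pt (Inl w)) = pt (Inl w)"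
    unfolding k2n_def
    by (rule normalize_pt[OF finD wD', where c = 1]) (auto simp: k2_def pt_def split: sum.split)
  have gf_cont: "continuous_on (carrier K) (g \<circ> f)"
    by (rule continuous_on_compose[OF fN(1) g_cont])
  have fg_cont: "continuous_on (carrier ?D) (f \<circ> g)"
    by (rule continuous_on_compose[OF g_cont continuous_on_subset[OF fN(1)]]) (use g_in in auto)
  have h1: "homotopic_with (\<lambda>h. h (pt w) = pt w) (gr K) (gr K) (g \<circ> f) kn"
  proof (rule contiguous_homotopic[OF K gf_cont kN(1)])
    fix x assume x: "x \<in> carrier K"
    show "(g \<circ> f) x \<in> carrier K" using g_in fN(2)[OF x] by simp
    note sf = fN(3)[OF x]
    show "supp ((g \<circ> f) x) \<union> supp (kn x) \<in> K"
    proof (cases "x v = 0")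
      case True
      have "supp (g (f x)) \<subseteq> supp x"
        by (rule g_supp) (use F0[of x] True sf in auto)
      then show ?thesis using k_sub[of x] kN(3)[OF x] complex_mono[OF K carrierD(2)[OF x]] by simp
    next
      case False
      note lk = lkI[OF x False]
      show ?thesis
      proof (cases "x v < 2/3")
        case True
        have "supp (g (f x)) \<subseteq> insert w (supp x - {v})"
        proof (rule g_supp)
          show "supp (f x) \<subseteq> Inl ` insert w (supp x - {v}) \<union> Inr ` insert w (supp x - {v})"
            using F1[of x] F2[of x] True sf by (cases "x v < 1/3") auto
        qed
        moreover have "supp (kn x) \<subseteq> supp x - {v}" using k_sub'[of x] True kN(3)[OF x] by simp
        ultimately have "supp (g (f x)) \<union> supp (kn x) \<subseteq> insert w (supp x - {v})" by blast
        then show ?thesis using complex_mono[OF K cone[OF lk]] by simp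
      next
        case False
        have "supp (g (f x)) \<subseteq> insert v (supp x - {v})"
        proof (rule g_supp)
          show "supp (f x) \<subseteq> Inl ` insert v (supp x - {v}) \<union> Inr ` insert v (supp x - {v})"
            using F3[of x] False sf xw[OF x \<open>x v \<noteq> 0\<close>] by auto
        qed
        moreover have "insert v (supp x - {v}) = supp x" using \<open>x v \<noteq> 0\<close> by (auto simp: supp_def)
        ultimately show ?thesis
          using k_sub[of x] kN(3)[OF x] complex_mono[OF K carrierD(2)[OF x]] by simp
      qed
    qed
  qed (use kN(2) fw gw kw in auto)
  have h2: "homotopic_with (\<lambda>h. h (pt w) = pt w) (gr K) (gr K) kn id"
    by (rule contiguous_homotopic[OF K kN(1)])
      (use kN(2,3) k_sub kw carrierD(2) in \<open>auto intro: continuous_intros simp: Un_absorb1\<close>)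
  have h3: "homotopic_with (\<lambda>h. h (pt (Inl w)) = pt (Inl w)) (gr ?D) (gr ?D) (f \<circ> g) k2n"
    by (rule contiguous_homotopic[OF D fg_cont k2N(1)])
      (use k2N(2,3) fN(2,3) g_in k2_mem(1) fw gw k2w in \<open>auto simp: Un_commute\<close>)
  have h4: "homotopic_with (\<lambda>h. h (pt (Inl w)) = pt (Inl w)) (gr ?D) (gr ?D) k2n k1n"
    by (rule contiguous_homotopic[OF D k2N(1) k1N(1)])
      (use k2N(2,3) k1N(2,3) k2_mem(2) k1w k2w in auto)
  have h5: "homotopic_with (\<lambda>h. h (pt (Inl w)) = pt (Inl w)) (gr ?D) (gr ?D) k1n id"
    by (rule contiguous_homotopic[OF D k1N(1)])
      (use k1N(2,3) k1_sub k1w carrierD(2) in \<open>auto intro: continuous_intros simp: Un_absorb1\<close>)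
  show ?thesis
    unfolding pointed_heq_def
  proof (intro conjI exI)
    show "homotopic_with (\<lambda>h. h (pt w) = pt w) (gr K) (gr K) (g \<circ> f) id"
      using h1 h2 by (rule homotopic_with_trans)
    show "homotopic_with (\<lambda>h. h (pt (Inl w)) = pt (Inl w)) (gr ?D) (gr ?D) (f \<circ> g) id"
      using h3 h4 h5 by (blast intro: homotopic_with_trans)
    show "continuous_map (gr K) (gr ?D) f" "continuous_map (gr ?D) (gr K) g"
      using fN(1,2) g_cont g_in by (auto simp: continuous_map_subtopology_eu)
  qed (use w wD fw gw in auto)
qed

section \<open>Wedges of spheres\<close>

lemma continuous_map_glue:
  assumes "closedin X S1" "closedin X S2" "S1 \<union> S2 = topspace X"
    and f: "continuous_map (subtopology X S1) Y f1" "continuous_map (subtopology X S2) Y f2"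
    and eq: "\<And>x. x \<in> S1 \<Longrightarrow> x \<in> S2 \<Longrightarrow> f1 x = f2 x"
  shows "continuous_map X Y (\<lambda>x. if x \<in> S1 then f1 x else f2 x)"
proof (rule pasting_lemma_closed[where I = "{True, False}" and T = "\<lambda>b. if b then S1 else S2"
      and f = "\<lambda>b. if b then f1 else f2"])
  fix x assume "x \<in> topspace X"
  then show "\<exists>j. j \<in> {True, False} \<and> x \<in> (if j then S1 else S2) \<and>
      (if x \<in> S1 then f1 x else f2 x) = (if j then f1 else f2) x"
    using assms(3) by (cases "x \<in> S1") auto
qed (use assms in \<open>auto split: if_splits\<close>)

text \<open>The cylinder over \<open>X\<close> is covered by the closed cylinders over the two
  pieces, which meet in the segment over \<open>p\<close>. Both homotopies rest at \<open>p\<close>,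
  so they agree there.\<close>

lemma homotopic_with_glue:
  assumes cl: "closedin X S1" "closedin X S2" "S1 \<union> S2 = topspace X" "S1 \<inter> S2 = {p}"
    and h1: "homotopic_with (\<lambda>h. h p = p) (subtopology X S1) (subtopology X S1) k1 id"
    and h2: "homotopic_with (\<lambda>h. h p = p) (subtopology X S2) (subtopology X S2) k2 id"
    and k: "\<And>x. x \<in> S1 \<Longrightarrow> k x = k1 x" "\<And>x. x \<in> S2 \<Longrightarrow> k x = k2 x"
  shows "homotopic_with (\<lambda>h. h p = p) X X k id"
proof -
  let ?I = "top_of_set {0..1::real}"
  obtain h1 where h1: "continuous_map (prod_topology ?I (subtopology X S1)) (subtopology X S1) h1"
    "\<And>x. h1 (0, x) = k1 x" "\<And>x. h1 (1, x) = x" "\<And>t. t \<in> {0..1} \<Longrightarrow> h1 (t, p) = p"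
    using h1 unfolding homotopic_with_def by auto
  obtain h2 where h2: "continuous_map (prod_topology ?I (subtopology X S2)) (subtopology X S2) h2"
    "\<And>x. h2 (0, x) = k2 x" "\<And>x. h2 (1, x) = x" "\<And>t. t \<in> {0..1} \<Longrightarrow> h2 (t, p) = p"
    using h2 unfolding homotopic_with_def by auto
  have pX: "p \<in> S1" "p \<in> S2" using cl by auto
  have cont: "continuous_map (prod_topology ?I X) X
      (\<lambda>z. if z \<in> {0..1} \<times> S1 then h1 z else h2 z)"
  proof (rule continuous_map_glue[where ?S2.0 = "{0..1} \<times> S2"])
    show "closedin (prod_topology ?I X) ({0..1} \<times> S1)" "closedin (prod_topology ?I X) ({0..1} \<times> S2)"
      using cl by (auto simp: closedin_prod_Times_iff)
    show "{0..1} \<times> S1 \<union> {0..1} \<times> S2 = topspace (prod_topology ?I X)"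
      using cl(3) by auto
    have *: "subtopology (prod_topology ?I X) ({0..1} \<times> S) = prod_topology ?I (subtopology X S)" for S
      by (simp add: subtopology_Times subtopology_subtopology)
    show "continuous_map (subtopology (prod_topology ?I X) ({0..1} \<times> S1)) X h1"
      "continuous_map (subtopology (prod_topology ?I X) ({0..1} \<times> S2)) X h2"
      using h1(1) h2(1) unfolding * by (simp_all add: continuous_map_in_subtopology)
    show "h1 z = h2 z" if z: "z \<in> {0..1} \<times> S1" "z \<in> {0..1} \<times> S2" for z
    proof -
      obtain t x where tx: "z = (t, x)" "t \<in> {0..1}" "x \<in> S1 \<inter> S2" using z by auto
      then have "x = p" unfolding cl(4) by simp
      then show ?thesis using h1(4)[OF tx(2)] h2(4)[OF tx(2)] tx(1) by simp
    qed
  qed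
  show ?thesis
  proof (subst homotopic_with)
    show "(h p = p) = (k p = p)" if "\<And>x. x \<in> topspace X \<Longrightarrow> h x = k x" for h k :: "'a \<Rightarrow> 'a"
    proof -
      have "p \<in> topspace X" using pX cl(3) by blast
      then show ?thesis using that by simp
    qed
    show "\<exists>h. continuous_map (prod_topology ?I X) X h \<and> (\<forall>x\<in>topspace X. h (0, x) = k x) \<and>
        (\<forall>x\<in>topspace X. h (1, x) = id x) \<and> (\<forall>t\<in>{0..1}. h (t, p) = p)"
      by (intro exI conjI, rule cont) (use h1 h2 k pX cl(3) in auto)
  qed
qed

lemma pointed_heq_union:
  assumes X: "closedin X S1" "closedin X S2" "S1 \<union> S2 = topspace X" "S1 \<inter> S2 = {p}"
    and Y: "closedin Y T1" "closedin Y T2" "T1 \<union> T2 = topspace Y" "T1 \<inter> T2 = {q}"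
    and 1: "pointed_heq (subtopology X S1) p (subtopology Y T1) q"
    and 2: "pointed_heq (subtopology X S2) p (subtopology Y T2) q"
  shows "pointed_heq X p Y q"
proof -
  obtain f1 g1 where 1: "continuous_map (subtopology X S1) (subtopology Y T1) f1"
    "continuous_map (subtopology Y T1) (subtopology X S1) g1" "f1 p = q" "g1 q = p"
    "homotopic_with (\<lambda>h. h p = p) (subtopology X S1) (subtopology X S1) (g1 \<circ> f1) id"
    "homotopic_with (\<lambda>h. h q = q) (subtopology Y T1) (subtopology Y T1) (f1 \<circ> g1) id"
    using 1 unfolding pointed_heq_def by blast
  obtain f2 g2 where 2: "continuous_map (subtopology X S2) (subtopology Y T2) f2"
    "continuous_map (subtopology Y T2) (subtopology X S2) g2" "f2 p = q" "g2 q = p"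
    "homotopic_with (\<lambda>h. h p = p) (subtopology X S2) (subtopology X S2) (g2 \<circ> f2) id"
    "homotopic_with (\<lambda>h. h q = q) (subtopology Y T2) (subtopology Y T2) (f2 \<circ> g2) id"
    using 2 unfolding pointed_heq_def by blast
  define f where "f x = (if x \<in> S1 then f1 x else f2 x)" for x
  define g where "g y = (if y \<in> T1 then g1 y else g2 y)" for y
  have S: "S1 \<subseteq> topspace X" "S2 \<subseteq> topspace X" "T1 \<subseteq> topspace Y" "T2 \<subseteq> topspace Y"
    using X Y by (auto dest: closedin_subset)
  have p_eq: "x = p" if "x \<in> S1" "x \<in> S2" for x using that X(4) by blast
  have q_eq: "y = q" if "y \<in> T1" "y \<in> T2" for y using that Y(4) by blast
  have e: "f1 x = f2 x" if "x \<in> S1" "x \<in> S2" for x using p_eq[OF that] 1(3) 2(3) by simp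
  have e': "g1 y = g2 y" if "y \<in> T1" "y \<in> T2" for y using q_eq[OF that] 1(4) 2(4) by simp
  have f2': "f x = f2 x" if "x \<in> S2" for x using that p_eq[OF _ that] 1(3) 2(3) by (auto simp: f_def)
  have g2': "g y = g2 y" if "y \<in> T2" for y using that q_eq[OF _ that] 1(4) 2(4) by (auto simp: g_def)
  have f1': "f x = f1 x" if "x \<in> S1" for x using that by (simp add: f_def)
  have g1': "g y = g1 y" if "y \<in> T1" for y using that by (simp add: g_def)
  have im: "f1 x \<in> T1" if "x \<in> S1" for x
    using 1(1) that S by (auto simp: continuous_map_def)
  have im2: "f2 x \<in> T2" if "x \<in> S2" for x
    using 2(1) that S by (auto simp: continuous_map_def)
  have img: "g1 y \<in> S1" if "y \<in> T1" for y
    using 1(2) that S by (auto simp: continuous_map_def)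
  have img2: "g2 y \<in> S2" if "y \<in> T2" for y
    using 2(2) that S by (auto simp: continuous_map_def)
  have cf: "continuous_map X Y f"
    unfolding f_def
    by (rule continuous_map_glue[OF X(1-3)])
      (use 1(1) 2(1) e in \<open>simp_all add: continuous_map_in_subtopology\<close>)
  have cg: "continuous_map Y X g"
    unfolding g_def
    by (rule continuous_map_glue[OF Y(1-3)])
      (use 1(2) 2(2) e' in \<open>simp_all add: continuous_map_in_subtopology\<close>)
  have "homotopic_with (\<lambda>h. h p = p) X X (g \<circ> f) id"
    by (rule homotopic_with_glue[OF X 1(5) 2(5)])
      (use f1' f2' g1' g2' im im2 in auto)
  moreover have "homotopic_with (\<lambda>h. h q = q) Y Y (f \<circ> g) id"
    by (rule homotopic_with_glue[OF Y 1(6) 2(6)])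
      (use f1' f2' g1' g2' img img2 in auto)
  moreover have "p \<in> S1" "q \<in> T1" using X(4) Y(4) by blast+
  then have "f p = q" "g q = p" "p \<in> topspace X" "q \<in> topspace Y"
    using S f1' g1' 1(3,4) by auto
  ultimately show ?thesis
    unfolding pointed_heq_def using cf cg by blast
qed

section \<open>Subspaces and reindexing of wedges\<close>

lemma wedge_cong:
  assumes "\<And>i. i \<in> I \<Longrightarrow> X i = X' i"
  shows "wedge I X p = wedge I X' p"
proof -
  have "wedge_carrier I X p = wedge_carrier I X' p"
    using assms by (auto simp: wedge_carrier_def)
  then show ?thesis
    by (simp add: wedge_def assms cong: ball_cong)
qed

lemma wedge_carrier_iff:
  "z \<in> wedge_carrier I X p \<longleftrightarrow>
     z = None \<or> (\<exists>i x. z = Some (i, x) \<and> i \<in> I \<and> x \<in> topspace (X i) \<and> x \<noteq> p i)"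
  by (auto simp: wedge_carrier_def wedge_glue_def)

lemma wedge_carrier_Un: "wedge_carrier I X p \<union> wedge_carrier J X p = wedge_carrier (I \<union> J) X p"
  by (simp add: wedge_carrier_def Sigma_Un_distrib1 image_Un)

lemma wedge_carrier_Int:
  assumes "I \<inter> J = {}"
  shows "wedge_carrier I X p \<inter> wedge_carrier J X p = {None}"
  using assms unfolding set_eq_iff by (auto simp: wedge_carrier_iff)

lemma wedge_carrier_mono: "J \<subseteq> I \<Longrightarrow> wedge_carrier J X p \<subseteq> wedge_carrier I X p"
  unfolding wedge_carrier_def by (intro insert_mono image_mono Sigma_mono) auto

lemma wedge_glue_in_carrier:
  "i \<in> I \<Longrightarrow> x \<in> topspace (X i) \<Longrightarrow> wedge_glue p (i, x) \<in> wedge_carrier I X p"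
  by (auto simp: wedge_carrier_def)

lemma wedge_glue_in_iff:
  "wedge_glue p (i, x) \<in> U \<longleftrightarrow> (if x = p i then None \<in> U else Some (i, x) \<in> U)"
  by (simp add: wedge_glue_def)

lemma subtopology_wedge:
  assumes "J \<subseteq> I"
  shows "subtopology (wedge I X p) (wedge_carrier J X p) = wedge J X p"
  unfolding topology_eq
proof (intro allI iffI)
  fix U assume "openin (subtopology (wedge I X p) (wedge_carrier J X p)) U"
  then obtain V where V: "openin (wedge I X p) V" "U = V \<inter> wedge_carrier J X p"
    by (auto simp: openin_subtopology)
  have "{x \<in> topspace (X i). wedge_glue p (i, x) \<in> U} = {x \<in> topspace (X i). wedge_glue p (i, x) \<in> V}"
    if "i \<in> J" for i
    using wedge_glue_in_carrier[OF that, of _ X p] by (auto simp: V(2))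
  then show "openin (wedge J X p) U"
    using V assms by (auto simp: openin_wedge)
next
  fix U assume U: "openin (wedge J X p) U"
  \<comment> \<open>An open neighbourhood of the common point has to be open in every summand;
    outside \<open>J\<close> the whole summands are added.\<close>
  let ?V = "if None \<in> U then U \<union> wedge_carrier (I - J) X p else U"
  have sub: "U \<subseteq> wedge_carrier J X p" using U by (simp add: openin_wedge)
  have "openin (wedge I X p) ?V"
    unfolding openin_wedge
  proof (intro conjI ballI)
    show "?V \<subseteq> wedge_carrier I X p"
      using sub wedge_carrier_mono[OF assms, of X p] wedge_carrier_mono[OF Diff_subset, of I J X p] by auto
    fix i assume "i \<in> I"
    show "openin (X i) {x \<in> topspace (X i). wedge_glue p (i, x) \<in> ?V}"
    proof (cases "i \<in> J")
      case True
      then have "{x \<in> topspace (X i). wedge_glue p (i, x) \<in> ?V} = {x \<in> topspace (X i). wedge_glue p (i, x) \<in> U}"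
        by (auto simp: wedge_glue_in_iff wedge_carrier_iff)
      then show ?thesis using U True by (simp add: openin_wedge)
    next
      case False
      have "{x \<in> topspace (X i). wedge_glue p (i, x) \<in> ?V} = (if None \<in> U then topspace (X i) else {})"
        using False sub \<open>i \<in> I\<close> by (auto simp: wedge_glue_in_iff wedge_carrier_iff)
      then show ?thesis by simp
    qed
  qed
  moreover have "U = ?V \<inter> wedge_carrier J X p"
    using sub by (auto simp: wedge_carrier_iff)
  ultimately show "openin (subtopology (wedge I X p) (wedge_carrier J X p)) U"
    unfolding openin_subtopology by blast
qed

text \<open>The complement of the subwedge consists of the omitted summands without their base
  points, and it is open as soon as these points are closed.\<close>

lemma closedin_wedge_carrier:
  assumes "J \<subseteq> I" and "\<And>i. i \<in> I - J \<Longrightarrow> closedin (X i) {p i}"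
  shows "closedin (wedge I X p) (wedge_carrier J X p)"
  unfolding closedin_def
proof
  show "wedge_carrier J X p \<subseteq> topspace (wedge I X p)"
    using subsetD[OF assms(1)] by (auto simp: wedge_carrier_iff)
  show "openin (wedge I X p) (topspace (wedge I X p) - wedge_carrier J X p)"
    unfolding openin_wedge
  proof (intro conjI ballI)
    fix i assume "i \<in> I"
    have "{x \<in> topspace (X i). wedge_glue p (i, x) \<in> topspace (wedge I X p) - wedge_carrier J X p} =
      (if i \<in> J then {} else topspace (X i) - {p i})"
      using \<open>i \<in> I\<close> by (auto simp: wedge_glue_def wedge_carrier_iff split: if_splits)
    then show "openin (X i) {x \<in> topspace (X i). wedge_glue p (i, x) \<in> topspace (wedge I X p) - wedge_carrier J X p}"
      using assms(2)[of i] \<open>i \<in> I\<close> by (auto simp: closedin_def)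
  qed simp
qed

lemma continuous_map_wedge_reindex:
  assumes "\<And>i. i \<in> I \<Longrightarrow> \<phi> i \<in> J \<and> X' (\<phi> i) = X i \<and> p' (\<phi> i) = p i"
  shows "continuous_map (wedge I X p) (wedge J X' p') (map_option (map_prod \<phi> id))"
  unfolding continuous_map_def
proof (intro conjI allI impI)
  show "map_option (map_prod \<phi> id) \<in> topspace (wedge I X p) \<rightarrow> topspace (wedge J X' p')"
    using assms by (auto simp: wedge_carrier_iff)
  fix U assume U: "openin (wedge J X' p') U"
  have "{x \<in> topspace (X i). wedge_glue p (i, x) \<in> {z \<in> topspace (wedge I X p). map_option (map_prod \<phi> id) z \<in> U}} =
      {x \<in> topspace (X' (\<phi> i)). wedge_glue p' (\<phi> i, x) \<in> U}" if "i \<in> I" for i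
  proof -
    have "map_option (map_prod \<phi> id) (wedge_glue p (i, x)) = wedge_glue p' (\<phi> i, x)" for x
      using assms[OF that] by (simp add: wedge_glue_def)
    then show ?thesis
      using assms[OF that] wedge_glue_in_carrier[OF that, of _ X p] by auto
  qed
  note eq = this
  show "openin (wedge I X p) {z \<in> topspace (wedge I X p). map_option (map_prod \<phi> id) z \<in> U}"
    unfolding openin_wedge
  proof (intro conjI ballI)
    fix i assume i: "i \<in> I"
    have "openin (X' (\<phi> i)) {x \<in> topspace (X' (\<phi> i)). wedge_glue p' (\<phi> i, x) \<in> U}"
      using U assms[OF i] unfolding openin_wedge by blast
    then show "openin (X i) {x \<in> topspace (X i).
        wedge_glue p (i, x) \<in> {z \<in> topspace (wedge I X p). map_option (map_prod \<phi> id) z \<in> U}}"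
      unfolding eq[OF i] using assms[OF i] by simp
  qed auto
qed

lemma closedin_sphere_base: "closedin (nsphere d) {sphere_base}"
proof -
  have "Hausdorff_space (nsphere d)"
    unfolding nsphere euclidean_product_topology by (simp add: Hausdorff_space_subtopology)
  then show ?thesis
    by (simp add: closedin_Hausdorff_singleton sphere_base_in_nsphere)
qed

text \<open>The items match the hypotheses of \<open>pointed_heq_union\<close>, with the two blocks
  of summands as closed pieces. The second block is indexed from \<open>length ds\<close> on, hence
  it is only homeomorphic to \<open>wedge_of_spheres es\<close>.\<close>

lemma wedge_of_spheres_append:
  defines "W \<equiv> \<lambda>ds es. wedge_of_spheres (ds @ es)"
  defines "C \<equiv> \<lambda>ds es J. wedge_carrier J (\<lambda>k. nsphere ((ds @ es) ! k)) (\<lambda>_. sphere_base)"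
  shows "closedin (W ds es) (C ds es {..<length ds})"
    and "closedin (W ds es) (C ds es {length ds..<length (ds @ es)})"
    and "C ds es {..<length ds} \<union> C ds es {length ds..<length (ds @ es)} = topspace (W ds es)"
    and "C ds es {..<length ds} \<inter> C ds es {length ds..<length (ds @ es)} = {None}"
    and "subtopology (W ds es) (C ds es {..<length ds}) = wedge_of_spheres ds"
    and "pointed_heq (wedge_of_spheres es) None (subtopology (W ds es) (C ds es {length ds..<length (ds @ es)})) None"
proof -
  let ?X = "\<lambda>k. nsphere ((ds @ es) ! k)" and ?b = "\<lambda>_::nat. sphere_base"
  let ?J = "{length ds..<length (ds @ es)}"
  show "closedin (W ds es) (C ds es {..<length ds})"
    unfolding W_def C_def wedge_of_spheres_def
    by (rule closedin_wedge_carrier) (auto simp: closedin_sphere_base)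
  show "closedin (W ds es) (C ds es ?J)"
    unfolding W_def C_def wedge_of_spheres_def
    by (rule closedin_wedge_carrier) (auto simp: closedin_sphere_base)
  show "C ds es {..<length ds} \<union> C ds es ?J = topspace (W ds es)"
    unfolding W_def C_def wedge_of_spheres_def topspace_wedge wedge_carrier_Un
    by (rule arg_cong[where f = "\<lambda>I. wedge_carrier I _ _"]) auto
  show "C ds es {..<length ds} \<inter> C ds es ?J = {None}"
    unfolding C_def by (rule wedge_carrier_Int) auto
  have "subtopology (W ds es) (C ds es {..<length ds}) = wedge {..<length ds} ?X ?b"
    unfolding W_def C_def wedge_of_spheres_def by (rule subtopology_wedge) simp
  also have "\<dots> = wedge_of_spheres ds"
    unfolding wedge_of_spheres_def by (rule wedge_cong) (simp add: nth_append)
  finally show "subtopology (W ds es) (C ds es {..<length ds}) = wedge_of_spheres ds" .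
  have eq: "subtopology (W ds es) (C ds es ?J) = wedge ?J ?X ?b"
    unfolding W_def C_def wedge_of_spheres_def by (rule subtopology_wedge) auto
  let ?f = "map_option (map_prod (\<lambda>k. k + length ds) id) :: (nat \<times> (nat \<Rightarrow> real)) option \<Rightarrow> _"
  let ?g = "map_option (map_prod (\<lambda>k. k - length ds) id) :: (nat \<times> (nat \<Rightarrow> real)) option \<Rightarrow> _"
  have "homeomorphic_maps (wedge_of_spheres es) (wedge ?J ?X ?b) ?f ?g"
    unfolding homeomorphic_maps_def
  proof (intro conjI ballI)
    show "continuous_map (wedge_of_spheres es) (wedge ?J ?X ?b) ?f"
      unfolding wedge_of_spheres_def by (rule continuous_map_wedge_reindex) (auto simp: nth_append)
    show "continuous_map (wedge ?J ?X ?b) (wedge_of_spheres es) ?g"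
      unfolding wedge_of_spheres_def by (rule continuous_map_wedge_reindex) (auto simp: nth_append)
  qed (auto simp: wedge_of_spheres_def wedge_carrier_iff)
  then show "pointed_heq (wedge_of_spheres es) None (subtopology (W ds es) (C ds es ?J)) None"
    unfolding eq
    by (rule homeomorphic_maps_imp_pointed_heq) (auto simp: wedge_of_spheres_def wedge_carrier_iff)
qed

section \<open>Complexes equivalent to a wedge of spheres\<close>

lemma closedin_carrier:
  assumes K: "complex K" and L: "L \<subseteq> K" "\<And>\<sigma> \<tau>. \<sigma> \<in> L \<Longrightarrow> \<tau> \<subseteq> \<sigma> \<Longrightarrow> \<tau> \<in> L"
  shows "closedin (gr K) (carrier L)"
proof -
  have fin: "finite L"
    by (rule finite_subset[of _ "Pow (\<Union>K)"]) (use K L(1) in \<open>auto simp: complex_def\<close>)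
  have "carrier L = carrier K \<inter> (\<Union>\<sigma>\<in>L. {x. supp x \<subseteq> \<sigma>})"
    using L by (auto simp: carrier_def)
  moreover have "closed {x :: 'a \<Rightarrow> real. supp x \<subseteq> \<sigma>}" for \<sigma>
  proof -
    have "{x. supp x \<subseteq> \<sigma>} = (\<Inter>v\<in>-\<sigma>. {x :: 'a \<Rightarrow> real. x v = 0})"
      by (auto simp: supp_def)
    then show ?thesis
      by (auto intro!: closed_INT closed_Collect_eq continuous_on_product_coordinates)
  qed
  ultimately show ?thesis
    using fin by (simp add: closedin_closed_Int closed_UN)
qed

text \<open>For \<open>ds = []\<close> the wedge is a single point; contractible pieces enter in
  this form and disappear from the concatenated lists.\<close>

definition wedge_like :: "'a set set \<Rightarrow> 'a \<Rightarrow> nat list \<Rightarrow> bool" where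
  "wedge_like K p ds \<longleftrightarrow> complex K \<and> {p} \<in> K \<and> pointed_heq (gr K) (pt p) (wedge_of_spheres ds) None"

lemma wedge_like_detach:
  assumes K: "complex K" and vw: "{v, w} \<notin> K" and vK: "{v} \<in> K"
    and cone: "\<And>\<rho>. \<rho> \<in> link K v \<Longrightarrow> insert w \<rho> \<in> K"
    and 1: "wedge_like {\<tau> \<in> K. v \<notin> \<tau>} w ds"
    and 2: "wedge_like (susp v w (link K v)) w es"
  shows "wedge_like K w (ds @ es)"
proof -
  let ?D = "detach K v w"
  let ?K1 = "(`) Inl ` {\<tau> \<in> K. v \<notin> \<tau>} :: ('a + 'a) set set"
  let ?K2 = "susp (Inr v) (Inl w) ((`) Inr ` link K v) :: ('a + 'a) set set"
  have D: "complex ?D" by (rule complex_detach[OF K])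
  have C1: "complex {\<tau> \<in> K. v \<notin> \<tau>}" and C2: "complex (susp v w (link K v))"
    and w: "{w} \<in> K" and wS: "{w} \<in> susp v w (link K v)"
    using 1 2 by (auto simp: wedge_like_def)
  have wlk: "w \<notin> \<rho>" if "\<rho> \<in> link K v" for \<rho>
  proof
    assume "w \<in> \<rho>"
    moreover have "insert v \<rho> \<in> K" using that by (simp add: link_def)
    ultimately show False using complex_mono[OF K, of "insert v \<rho>" "{v, w}"] vw by blast
  qed
  have vnw: "v \<noteq> w" using vw vK by auto
  have S1: "?K1 \<subseteq> ?D" and S2: "?K2 \<subseteq> ?D" by (auto simp: detach_def)
  have m1: "\<tau> \<in> ?K1" if \<sigma>: "\<sigma> \<in> ?K1" and \<tau>: "\<tau> \<subseteq> \<sigma>" for \<sigma> \<tau>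
  proof -
    obtain \<rho> where \<rho>: "\<rho> \<in> {\<tau> \<in> K. v \<notin> \<tau>}" "\<sigma> = Inl ` \<rho>" using \<sigma> by (rule imageE)
    obtain \<rho>' where \<rho>': "\<rho>' \<subseteq> \<rho>" "\<tau> = Inl ` \<rho>'"
      using \<tau> unfolding \<rho>(2) by (rule subset_imageE)
    then show ?thesis using complex_mono[OF C1 \<rho>(1) \<rho>'(1)] by simp
  qed
  have m2: "\<tau> \<in> ?K2" if "\<sigma> \<in> ?K2" "\<tau> \<subseteq> \<sigma>" for \<sigma> \<tau>
    using that unfolding susp_def by (simp add: bex_simps) (meson subset_trans)
  have cl: "closedin (gr ?D) (carrier ?K1)" "closedin (gr ?D) (carrier ?K2)"
    using closedin_carrier[OF D S1 m1] closedin_carrier[OF D S2 m2] by simp_all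
  have sub: "carrier ?K1 \<subseteq> carrier ?D" "carrier ?K2 \<subseteq> carrier ?D"
    using S1 S2 by (auto simp: carrier_def)
  have un: "carrier ?K1 \<union> carrier ?K2 = topspace (gr ?D)"
    by (auto simp: carrier_def detach_def)
  have int: "carrier ?K1 \<inter> carrier ?K2 = {pt (Inl w)}"
  proof
    show "carrier ?K1 \<inter> carrier ?K2 \<subseteq> {pt (Inl w)}"
    proof
      fix x assume x: "x \<in> carrier ?K1 \<inter> carrier ?K2"
      then have x1: "x \<in> carrier ?K1" by simp
      have "supp x \<subseteq> range Inl" using carrierD(2)[OF x1] by blast
      moreover obtain \<rho> where "supp x \<subseteq> insert (Inl w) (Inr ` \<rho>) \<or> supp x \<subseteq> insert (Inr v) (Inr ` \<rho>)"
        using x carrierD(2)[of x ?K2] by (auto simp: susp_def)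
      ultimately have "supp x \<subseteq> {Inl w}" by blast
      then have "supp x = {Inl w}" using carrierD(5)[OF x1] by blast
      then have "x (Inl w) = 1" using carrierD(3)[OF x1] by simp
      then show "x \<in> {pt (Inl w)}" using carrier_eq_1[OF x1] by simp
    qed
    have "{w} \<in> {\<tau> \<in> K. v \<notin> \<tau>}" using w vnw by simp
    then have a: "Inl ` {w} \<in> ?K1" by (rule imageI)
    have "{} \<in> link K v" using vK by (simp add: link_def)
    then have "{Inl w} \<in> ?K2" by (force simp: susp_def)
    with a show "{pt (Inl w)} \<subseteq> carrier ?K1 \<inter> carrier ?K2" by simp
  qed
  \<comment> \<open>The second hypothesis speaks of the suspension in terms of the vertices of
    \<open>K\<close>. Renaming everything but \<open>w\<close> turns it into the disjoint copy
    inside \<open>detach K v w\<close>; the pole \<open>w\<close> stays shared and is the gluing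
    point.\<close>
  let ?h = "\<lambda>i. if i = w then Inl w else Inr i"
  have inj: "inj_on ?h A" for A by (auto simp: inj_on_def split: if_splits)
  have K2: "(`) ?h ` susp v w (link K v) = ?K2"
  proof (rule set_eqI, rule iffI)
    fix \<tau> assume "\<tau> \<in> (`) ?h ` susp v w (link K v)"
    then obtain \<sigma> \<rho> where *: "\<tau> = ?h ` \<sigma>" "\<rho> \<in> link K v" "\<sigma> \<subseteq> insert w \<rho> \<or> \<sigma> \<subseteq> insert v \<rho>"
      by (auto simp: susp_def)
    have "?h ` insert w \<rho> = insert (Inl w) (Inr ` \<rho>)" "?h ` insert v \<rho> = insert (Inr v) (Inr ` \<rho>)"
      using wlk[OF *(2)] vnw by auto
    then have "\<tau> \<subseteq> insert (Inl w) (Inr ` \<rho>) \<or> \<tau> \<subseteq> insert (Inr v) (Inr ` \<rho>)"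
      using *(3) image_mono[of \<sigma> "insert w \<rho>" ?h] image_mono[of \<sigma> "insert v \<rho>" ?h]
      unfolding *(1) by argo
    then show "\<tau> \<in> ?K2" using *(2) by (auto simp: susp_def)
  next
    fix \<tau> assume "\<tau> \<in> ?K2"
    then obtain \<rho> where \<rho>: "\<rho> \<in> link K v" "\<tau> \<subseteq> insert (Inl w) (Inr ` \<rho>) \<or> \<tau> \<subseteq> insert (Inr v) (Inr ` \<rho>)"
      by (auto simp: susp_def)
    have "?h ` insert w \<rho> = insert (Inl w) (Inr ` \<rho>)" "?h ` insert v \<rho> = insert (Inr v) (Inr ` \<rho>)"
      using wlk[OF \<rho>(1)] vnw by auto
    then have "\<tau> \<subseteq> ?h ` insert w \<rho> \<or> \<tau> \<subseteq> ?h ` insert v \<rho>"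
      using \<rho>(2) by argo
    then have "\<exists>\<sigma>. (\<sigma> \<subseteq> insert w \<rho> \<or> \<sigma> \<subseteq> insert v \<rho>) \<and> \<tau> = ?h ` \<sigma>"
      unfolding subset_image_iff by blast
    then obtain \<sigma> where "\<sigma> \<subseteq> insert w \<rho> \<or> \<sigma> \<subseteq> insert v \<rho>" "\<tau> = ?h ` \<sigma>" by blast
    then show "\<tau> \<in> (`) ?h ` susp v w (link K v)" using \<rho>(1) by (auto simp: susp_def)
  qed
  have "pointed_heq (gr {\<tau> \<in> K. v \<notin> \<tau>}) (pt w) (gr ?K1) (pt (Inl w))"
    by (rule pointed_heq_relabel[OF C1]) (use w vnw in auto)
  then have e1: "pointed_heq (gr ?K1) (pt (Inl w)) (wedge_of_spheres ds) None"
    using 1 unfolding wedge_like_def by (meson pointed_heq_trans pointed_heq_sym)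
  have "pointed_heq (gr (susp v w (link K v))) (pt w) (gr ?K2) (pt (Inl w))"
    using pointed_heq_relabel[OF C2 inj wS] unfolding K2 by simp
  then have e2: "pointed_heq (gr ?K2) (pt (Inl w)) (wedge_of_spheres es) None"
    using 2 unfolding wedge_like_def by (meson pointed_heq_trans pointed_heq_sym)
  have st: "subtopology (gr ?D) (carrier ?K1) = gr ?K1" "subtopology (gr ?D) (carrier ?K2) = gr ?K2"
    using sub by (simp_all add: subtopology_subtopology Int_absorb1)
  note W = wedge_of_spheres_append[where ds = ds and es = es]
  have "pointed_heq (gr ?D) (pt (Inl w)) (wedge_of_spheres (ds @ es)) None"
  proof (rule pointed_heq_union[OF cl un int W(1-4)])
    show "pointed_heq (subtopology (gr ?D) (carrier ?K1)) (pt (Inl w))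
       (subtopology (wedge_of_spheres (ds @ es))
         (wedge_carrier {..<length ds} (\<lambda>k. nsphere ((ds @ es) ! k)) (\<lambda>_. sphere_base))) None"
      unfolding st W(5) by (rule e1)
    show "pointed_heq (subtopology (gr ?D) (carrier ?K2)) (pt (Inl w))
       (subtopology (wedge_of_spheres (ds @ es))
         (wedge_carrier {length ds..<length (ds @ es)} (\<lambda>k. nsphere ((ds @ es) ! k)) (\<lambda>_. sphere_base))) None"
      unfolding st by (rule pointed_heq_trans[OF e2 W(6)])
  qed
  moreover have "pointed_heq (gr K) (pt w) (gr ?D) (pt (Inl w))"
    by (rule pointed_heq_detach[OF K w vw vK cone])
  ultimately show ?thesis
    unfolding wedge_like_def using K w by (metis pointed_heq_trans)
qed

lemma wedge_like_cone:
  assumes "complex K" and "\<And>\<tau>. \<tau> \<in> K \<Longrightarrow> insert p \<tau> \<in> K" and "K \<noteq> {}"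
  shows "wedge_like K p []"
proof -
  have "topspace (wedge_of_spheres []) = {None}"
    by (auto simp: wedge_of_spheres_def wedge_carrier_iff)
  note pointed_heq_cone[OF assms this]
  moreover have "{p} \<in> K" using assms complex_mono[OF assms(1)] by blast
  ultimately show ?thesis using assms(1) by (simp add: wedge_like_def)
qed

section \<open>Spheres as boundaries of cross-polytopes\<close>

lemma nsphere_heq_wedge: "pointed_heq (nsphere d) sphere_base (wedge_of_spheres [d]) None"
proof (rule homeomorphic_maps_imp_pointed_heq)
  let ?f = "\<lambda>x. wedge_glue (\<lambda>_::nat. sphere_base) (0::nat, x)"
  let ?g = "\<lambda>z. case z of None \<Rightarrow> sphere_base | Some (k::nat, x) \<Rightarrow> x"
  let ?W = "wedge {..<Suc 0} (\<lambda>k. nsphere ([d] ! k)) (\<lambda>_. sphere_base)"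
  have W: "wedge_of_spheres [d] = ?W" by (simp add: wedge_of_spheres_def)
  have b: "sphere_base \<in> topspace (nsphere d)" by (rule sphere_base_in_nsphere)
  show "homeomorphic_maps (nsphere d) (wedge_of_spheres [d]) ?f ?g"
    unfolding homeomorphic_maps_def W
  proof (intro conjI ballI)
    show "continuous_map (nsphere d) ?W ?f"
      unfolding continuous_map_def
    proof (intro conjI allI impI)
      show "?f \<in> topspace (nsphere d) \<rightarrow> topspace ?W"
        by (auto simp: wedge_glue_def wedge_carrier_iff)
      show "openin (nsphere d) {x \<in> topspace (nsphere d). ?f x \<in> U}" if "openin ?W U" for U
        using that by (auto simp: openin_wedge)
    qed
    show "continuous_map ?W (nsphere d) ?g"
      unfolding continuous_map_def
    proof (intro conjI allI impI)
      show "?g \<in> topspace ?W \<rightarrow> topspace (nsphere d)"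
        using b by (auto simp: wedge_carrier_iff)
      fix U assume U: "openin (nsphere d) U"
      have "{x \<in> topspace (nsphere d). ?f x \<in> {z \<in> topspace ?W. ?g z \<in> U}} = U"
        using openin_subset[OF U] by (auto simp: wedge_glue_def wedge_carrier_iff)
      then show "openin ?W {z \<in> topspace ?W. ?g z \<in> U}"
        using U by (auto simp: openin_wedge)
    qed
  qed (auto simp: wedge_glue_def wedge_carrier_iff)
qed (auto simp: wedge_glue_def sphere_base_in_nsphere)

text \<open>Boundary complex of the cross-polytope: \<open>(i, True)\<close> and
  \<open>(i, False)\<close> are the opposite vertices on axis \<open>i\<close>. It is also the
  independence complex of \<open>m\<close> disjoint edges, the form in which \<open>ws_empty\<close>
  uses it.\<close>

definition cross_polytope :: "nat \<Rightarrow> (nat \<times> bool) set set" where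
  "cross_polytope m = {\<tau>. \<tau> \<subseteq> {..<m} \<times> UNIV \<and> (\<forall>i. \<not> {(i, True), (i, False)} \<subseteq> \<tau>)}"

lemma complex_cross_polytope: "complex (cross_polytope m)"
proof -
  have "finite (\<Union>(cross_polytope m))"
    by (rule finite_subset[of _ "{..<m} \<times> UNIV"]) (auto simp: cross_polytope_def)
  then show ?thesis by (auto simp: complex_def cross_polytope_def)
qed

text \<open>Barycentric coordinates identify the realization with the unit sphere of the 1-norm in
  \<open>Suc d\<close> real coordinates, and rescaling to Euclidean length 1 gives the standard
  \<open>d\<close>-sphere.\<close>

lemma wedge_like_cross_polytope: "wedge_like (cross_polytope (Suc d)) (0, True) [d]"
proof -
  let ?K = "cross_polytope (Suc d)"
  have base: "{(0, True)} \<in> ?K" by (auto simp: cross_polytope_def)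
  let ?S = "{z::nat \<Rightarrow> real. (\<Sum>i\<le>d. (z i)\<^sup>2) = 1 \<and> (\<forall>i>d. z i = 0)}"
  have N: "nsphere d = top_of_set ?S"
    unfolding nsphere euclidean_product_topology by simp
  let ?V = "{..<Suc d} \<times> (UNIV :: bool set)"
  have V: "finite ?V" by simp
  have sumV: "sum h ?V = (\<Sum>i\<le>d. h (i, True) + h (i, False))" for h :: "nat \<times> bool \<Rightarrow> real"
    by (simp add: sum.cartesian_product' UNIV_bool add.commute lessThan_Suc_atMost flip: sum.cartesian_product)
  \<comment> \<open>Signed coordinates: opposite vertices never occur together, so the two weights
    on axis \<open>i\<close> are recovered as the positive and the negative part of
    \<open>\<delta> x i\<close>.\<close>
  define \<delta> where "\<delta> x i = x (i, True) - x (i, False)" for x :: "nat \<times> bool \<Rightarrow> real" and i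
  define n2 where "n2 x = sqrt (\<Sum>i\<le>d. (\<delta> x i)\<^sup>2)" for x
  define f where "f x = (\<lambda>i. \<delta> x i / n2 x)" for x
  define n1 where "n1 z = (\<Sum>i\<le>d. \<bar>z i\<bar>)" for z :: "nat \<Rightarrow> real"
  define g where "g z = (\<lambda>(i, b). max 0 (if b then z i else - z i) / n1 z)" for z :: "nat \<Rightarrow> real"
  have x_out: "x (i, b) = 0" if "x \<in> carrier ?K" "i > d" for x i b
    using carrierD(2)[OF that(1)] that(2) by (auto simp: cross_polytope_def supp_def)
  have x_disj: "x (i, True) = 0 \<or> x (i, False) = 0" if "x \<in> carrier ?K" for x i
    using carrierD(2)[OF that] by (auto simp: cross_polytope_def supp_def)
  have abs_\<delta>: "\<bar>\<delta> x i\<bar> = x (i, True) + x (i, False)" if "x \<in> carrier ?K" for x i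
    using x_disj[OF that, of i] carrierD(1)[OF that, of "(i, True)"] carrierD(1)[OF that, of "(i, False)"]
    by (auto simp: \<delta>_def)
  have n1\<delta>: "n1 (\<delta> x) = 1" if "x \<in> carrier ?K" for x
  proof -
    have "supp x \<subseteq> ?V" using carrierD(2)[OF that] by (auto simp: cross_polytope_def)
    then have "sum x ?V = 1" by (rule carrier_sum[OF that V])
    then show ?thesis using abs_\<delta>[OF that] by (simp add: n1_def sumV)
  qed
  have n2_pos: "n2 x > 0" if x: "x \<in> carrier ?K" for x
  proof -
    obtain i where "i \<le> d" "\<delta> x i \<noteq> 0"
      using n1\<delta>[OF x] unfolding n1_def by (metis abs_zero atMost_iff sum.neutral zero_neq_one)
    then have "(\<Sum>i\<le>d. (\<delta> x i)\<^sup>2) > 0" by (intro sum_pos2[where i = i]) auto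
    then show ?thesis by (simp add: n2_def)
  qed
  have n1_pos: "n1 z > 0" if "z \<in> ?S" for z
  proof -
    have "\<exists>i\<le>d. z i \<noteq> 0"
    proof (rule ccontr)
      assume "\<not> (\<exists>i\<le>d. z i \<noteq> 0)"
      then have "(\<Sum>i\<le>d. (z i)\<^sup>2) = 0" by simp
      then show False using that by simp
    qed
    then obtain i where "i \<le> d" "z i \<noteq> 0" by blast
    then show ?thesis unfolding n1_def by (intro sum_pos2[where i = i]) auto
  qed
  have f_in: "f x \<in> ?S" if x: "x \<in> carrier ?K" for x
  proof -
    have "(\<Sum>i\<le>d. (f x i)\<^sup>2) = (\<Sum>i\<le>d. (\<delta> x i)\<^sup>2) / (n2 x)\<^sup>2"
      by (simp add: f_def power_divide sum_divide_distrib)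
    moreover have "(n2 x)\<^sup>2 = (\<Sum>i\<le>d. (\<delta> x i)\<^sup>2)" by (simp add: n2_def sum_nonneg)
    ultimately have "(\<Sum>i\<le>d. (f x i)\<^sup>2) = (n2 x)\<^sup>2 / (n2 x)\<^sup>2" by simp
    also have "\<dots> = 1" using n2_pos[OF x] by simp
    finally have "(\<Sum>i\<le>d. (f x i)\<^sup>2) = 1" .
    moreover have "f x i = 0" if "i > d" for i
      using x_out[OF x that] by (simp add: f_def \<delta>_def)
    ultimately show ?thesis by simp
  qed
  have g_in: "g z \<in> carrier ?K" if z: "z \<in> ?S" for z
  proof (rule carrierI[OF V])
    note n = n1_pos[OF z]
    show "0 \<le> g z v" for v using n by (cases v) (simp add: g_def)
    show sub: "supp (g z) \<subseteq> ?V"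
    proof
      fix v assume v: "v \<in> supp (g z)"
      obtain i b where ib: "v = (i, b)" by fastforce
      have "\<not> i > d"
      proof
        assume "i > d"
        then have "z i = 0" using z by simp
        then show False using v ib by (simp add: supp_def g_def)
      qed
      then show "v \<in> ?V" using ib by simp
    qed
    have "\<not> {(i, True), (i, False)} \<subseteq> supp (g z)" for i
      by (auto simp: supp_def g_def max_def split: if_splits)
    then show "supp (g z) \<in> ?K" using sub by (simp add: cross_polytope_def)
    have "sum (g z) ?V = (\<Sum>i\<le>d. \<bar>z i\<bar> / n1 z)"
      unfolding sumV by (rule sum.cong) (auto simp: g_def max_def)
    also have "\<dots> = 1" using n by (simp add: n1_def flip: sum_divide_distrib)
    finally show "sum (g z) ?V = 1" .
  qed
  have gf: "g (f x) = x" if x: "x \<in> carrier ?K" for x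
  proof
    fix v :: "nat \<times> bool"
    obtain i b where ib: "v = (i, b)" by fastforce
    note n = n2_pos[OF x]
    have "n1 (f x) = n1 (\<delta> x) / n2 x"
      using n by (simp add: n1_def f_def abs_divide sum_divide_distrib)
    then have n1: "n1 (f x) = 1 / n2 x" using n1\<delta>[OF x] by simp
    have "g (f x) v = max 0 ((if b then \<delta> x i else - \<delta> x i) / n2 x) * n2 x"
      unfolding g_def ib n1 by (simp add: f_def)
    also have "\<dots> = max 0 (if b then \<delta> x i else - \<delta> x i)"
      using n by (simp add: max_def divide_le_0_iff zero_le_divide_iff)
    also have "\<dots> = x v"
      using x_disj[OF x, of i] carrierD(1)[OF x, of "(i, True)"] carrierD(1)[OF x, of "(i, False)"]
      by (auto simp: \<delta>_def ib)
    finally show "g (f x) v = x v" .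
  qed
  have fg: "f (g z) = z" if z: "z \<in> ?S" for z
  proof
    fix i
    note n = n1_pos[OF z]
    have \<delta>g: "\<delta> (g z) j = z j / n1 z" for j
      by (auto simp: \<delta>_def g_def max_def)
    have "n2 (g z) = sqrt ((\<Sum>i\<le>d. (z i)\<^sup>2) / (n1 z)\<^sup>2)"
      by (simp add: n2_def \<delta>g power_divide sum_divide_distrib)
    also have "\<dots> = 1 / n1 z" using z n by (simp add: real_sqrt_divide)
    finally show "f (g z) i = z i" using n by (simp add: f_def \<delta>g)
  qed
  have f_cont: "continuous_on (carrier ?K) f"
    unfolding f_def n2_def \<delta>_def
  proof (intro continuous_on_coordinatewise_then_product continuous_intros cont_coord ballI)
    show "sqrt (\<Sum>i\<le>d. (x (i, True) - x (i, False))\<^sup>2) \<noteq> 0" if "x \<in> carrier ?K" for x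
      using n2_pos[OF that] by (simp add: n2_def \<delta>_def)
  qed
  have g_cont: "continuous_on ?S g"
  proof (rule continuous_on_coordinatewise_then_product)
    fix v :: "nat \<times> bool"
    obtain i b where ib: "v = (i, b)" by fastforce
    have "n1 z \<noteq> 0" if "z \<in> ?S" for z using n1_pos[OF that] by simp
    then show "continuous_on ?S (\<lambda>z. g z v)"
      unfolding g_def ib prod.case n1_def
      by (intro continuous_on_if_const continuous_intros cont_coord ballI)
  qed
  have f_base: "f (pt (0, True)) = sphere_base"
  proof -
    have \<delta>: "\<delta> (pt (0, True)) i = (if i = 0 then 1 else 0)" for i
      by (simp add: \<delta>_def pt_def)
    have "n2 (pt (0, True)) = 1"
      by (simp add: n2_def \<delta> if_distrib[where f = "\<lambda>t. t\<^sup>2"] cong: if_cong)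
    then show ?thesis by (auto simp: f_def \<delta> sphere_base_def)
  qed
  have "homeomorphic_maps (gr ?K) (nsphere d) f g"
    unfolding homeomorphic_maps_def N
    using f_cont g_cont f_in g_in fg gf by (auto simp: continuous_map_subtopology_eu)
  then have "pointed_heq (gr ?K) (pt (0, True)) (nsphere d) sphere_base"
    by (rule homeomorphic_maps_imp_pointed_heq) (use base f_base in auto)
  then show ?thesis
    unfolding wedge_like_def
    by (intro conjI complex_cross_polytope base pointed_heq_trans[OF _ nsphere_heq_wedge])
qed

section \<open>Transport along pointed equivalences\<close>

lemma wedge_like_heq:
  assumes "wedge_like K p ds" and "complex K'" and "{p'} \<in> K'"
    and "pointed_heq (gr K') (pt p') (gr K) (pt p)"
  shows "wedge_like K' p' ds"
  unfolding wedge_like_def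
proof (intro conjI)
  show "pointed_heq (gr K') (pt p') (wedge_of_spheres ds) None"
    by (rule pointed_heq_trans[OF assms(4)]) (use assms(1) in \<open>simp add: wedge_like_def\<close>)
qed (use assms in auto)

lemma wedge_like_base_change:
  assumes "wedge_like K p ds" and "{p, q} \<in> K"
  shows "wedge_like K q ds"
proof -
  have K: "complex K" using assms(1) by (simp add: wedge_like_def)
  have "pointed_heq (gr K) (pt q) (gr K) (pt p)"
    by (rule pointed_heq_sym[OF pointed_heq_base_change[OF K assms(2)]])
  moreover have "{q} \<in> K" by (rule complex_mono[OF K assms(2)]) simp
  ultimately show ?thesis
    by (intro wedge_like_heq[OF assms(1) K])
qed

lemma wedge_like_relabel:
  assumes "wedge_like K p ds" and inj: "inj_on h (\<Union>K)"
  shows "wedge_like ((`) h ` K) (h p) ds"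
proof -
  have K: "complex K" and p: "{p} \<in> K" using assms(1) by (auto simp: wedge_like_def)
  have "complex ((`) h ` K)"
    unfolding complex_def
  proof (intro conjI ballI allI impI)
    show "finite (\<Union>((`) h ` K))" using K by (simp add: complex_def flip: image_Union)
    fix \<sigma> \<tau> assume "\<sigma> \<in> (`) h ` K" "\<tau> \<subseteq> \<sigma>"
    then obtain \<rho> where \<rho>: "\<rho> \<in> K" "\<tau> \<subseteq> h ` \<rho>" by blast
    obtain \<rho>' where "\<rho>' \<subseteq> \<rho>" "\<tau> = h ` \<rho>'" using \<rho>(2) by (rule subset_imageE)
    then show "\<tau> \<in> (`) h ` K" using complex_mono[OF K \<rho>(1)] by blast
  qed
  moreover have "{h p} \<in> (`) h ` K" using imageI[OF p, of "(`) h"] by simp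
  moreover have "pointed_heq (gr ((`) h ` K)) (pt (h p)) (gr K) (pt p)"
    by (rule pointed_heq_sym[OF pointed_heq_relabel[OF K inj p]])
  ultimately show ?thesis
    by (intro wedge_like_heq[OF assms(1)])
qed

lemma wedge_like_collapse:
  assumes K: "complex K" and u: "u \<noteq> a" "u \<noteq> b"
    and apex: "\<And>\<tau>. \<tau> \<in> K \<Longrightarrow> a \<in> \<tau> \<Longrightarrow> b \<in> \<tau> \<Longrightarrow> insert u \<tau> \<in> K"
    and p: "{p} \<in> K" "\<not> {a, b} \<subseteq> {p}"
  shows "wedge_like {\<tau> \<in> K. \<not> {a, b} \<subseteq> \<tau>} p ds \<longleftrightarrow> wedge_like K p ds"
proof -
  have "complex {\<tau> \<in> K. \<not> {a, b} \<subseteq> \<tau>}"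
    unfolding complex_def
  proof (intro conjI ballI allI impI)
    show "finite (\<Union>{\<tau> \<in> K. \<not> {a, b} \<subseteq> \<tau>})"
      by (rule finite_subset[of _ "\<Union>K"]) (use K in \<open>auto simp: complex_def\<close>)
    fix \<sigma> \<tau> assume \<sigma>: "\<sigma> \<in> {\<tau> \<in> K. \<not> {a, b} \<subseteq> \<tau>}" "\<tau> \<subseteq> \<sigma>"
    then show "\<tau> \<in> {\<tau> \<in> K. \<not> {a, b} \<subseteq> \<tau>}" using complex_mono[OF K, of \<sigma> \<tau>] by blast
  qed
  moreover have eq: "pointed_heq (gr {\<tau> \<in> K. \<not> {a, b} \<subseteq> \<tau>}) (pt p) (gr K) (pt p)"
    by (rule pointed_heq_collapse[OF K u apex p])
  moreover have "{p} \<in> {\<tau> \<in> K. \<not> {a, b} \<subseteq> \<tau>}" using p by simp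
  ultimately show ?thesis
    using wedge_like_heq[OF _ _ _ eq] wedge_like_heq[OF _ K p(1) pointed_heq_sym[OF eq]] by blast
qed

section \<open>Independence complexes and their suspensions\<close>

text \<open>Edge relation and vertex set are kept apart, so that deleting vertices or passing to a
  link changes only \<open>S\<close>.\<close>

definition indc :: "('a \<Rightarrow> 'a \<Rightarrow> bool) \<Rightarrow> 'a set \<Rightarrow> 'a set set" where
  "indc E S = {\<tau>. \<tau> \<subseteq> S \<and> (\<forall>x\<in>\<tau>. \<forall>y\<in>\<tau>. \<not> E x y)}"

lemma complex_indc: "finite S \<Longrightarrow> complex (indc E S)"
  unfolding complex_def
proof (intro conjI ballI allI impI)
  assume "finite S"
  then show "finite (\<Union>(indc E S))" by (rule finite_subset[rotated]) (auto simp: indc_def)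
  fix \<sigma> \<tau> assume "\<sigma> \<in> indc E S" "\<tau> \<subseteq> \<sigma>"
  then show "\<tau> \<in> indc E S" unfolding indc_def by blast
qed

definition adjacency :: "('a \<Rightarrow> 'a \<Rightarrow> bool) \<Rightarrow> bool" where
  "adjacency E \<longleftrightarrow> (\<forall>x y. E x y \<longrightarrow> E y x) \<and> (\<forall>x. \<not> E x x)"

lemma adjacencyD: "adjacency E \<Longrightarrow> E x y \<Longrightarrow> E y x" "adjacency E \<Longrightarrow> \<not> E x x"
  by (auto simp: adjacency_def)

lemma edge_in_indc:
  "adjacency E \<Longrightarrow> {p, q} \<in> indc E S \<longleftrightarrow> p \<in> S \<and> q \<in> S \<and> \<not> E p q"
  by (auto simp: indc_def adjacency_def)

lemma vertex_in_indc: "adjacency E \<Longrightarrow> {p} \<in> indc E S \<longleftrightarrow> p \<in> S"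
  by (auto simp: indc_def adjacency_def)

lemma wedge_like_vertex: "adjacency E \<Longrightarrow> wedge_like (indc E S) p ds \<Longrightarrow> p \<in> S"
  by (simp add: wedge_like_def vertex_in_indc)

text \<open>\<open>E'\<close> has the edge \<open>a b\<close> in addition, so its complex loses
  exactly the faces containing both end points. Every such face can be enlarged by \<open>u\<close>,
  which makes this a case of \<open>wedge_like_collapse\<close>.\<close>

lemma wedge_like_edge_change:
  assumes E: "adjacency E" and E': "adjacency E'" and S: "finite S"
    and ab: "a \<in> S" "b \<in> S" "\<not> E a b" "E' a b" "a \<noteq> b"
    and agree: "\<And>x y. {x, y} \<noteq> {a, b} \<Longrightarrow> E' x y \<longleftrightarrow> E x y"
    and u: "u \<in> S" "u \<noteq> a" "u \<noteq> b" "\<not> E u a" "\<not> E u b" "\<And>y. y \<in> S \<Longrightarrow> E u y \<Longrightarrow> E a y \<or> E b y"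
  shows "wedge_like (indc E' S) p ds \<longleftrightarrow> wedge_like (indc E S) p ds"
proof (cases "p \<in> S")
  case True
  have E'iff: "E' x y \<longleftrightarrow> E x y \<or> {x, y} = {a, b}" for x y
  proof (cases "{x, y} = {a, b}")
    case True
    then have "E' x y" using ab(4) adjacencyD(1)[OF E'] by (auto simp: doubleton_eq_iff)
    then show ?thesis using True by simp
  qed (simp add: agree)
  have eq: "indc E' S = {\<tau> \<in> indc E S. \<not> {a, b} \<subseteq> \<tau>}"
  proof (intro set_eqI iffI)
    fix \<tau> assume "\<tau> \<in> indc E' S"
    then show "\<tau> \<in> {\<tau> \<in> indc E S. \<not> {a, b} \<subseteq> \<tau>}" using ab(4) by (auto simp: indc_def E'iff)
  next
    fix \<tau> assume "\<tau> \<in> {\<tau> \<in> indc E S. \<not> {a, b} \<subseteq> \<tau>}"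
    then show "\<tau> \<in> indc E' S" by (auto simp: indc_def E'iff doubleton_eq_iff)
  qed
  show ?thesis
    unfolding eq
  proof (rule wedge_like_collapse[OF complex_indc[OF S] u(2,3)])
    fix \<tau> assume \<tau>: "\<tau> \<in> indc E S" "a \<in> \<tau>" "b \<in> \<tau>"
    have "\<not> E u y" if "y \<in> \<tau>" for y
      using u(6)[of y] \<tau> that unfolding indc_def by blast
    then show "insert u \<tau> \<in> indc E S"
      using \<tau>(1) u(1) adjacencyD[OF E] unfolding indc_def by blast
  qed (use True ab E in \<open>auto simp: vertex_in_indc\<close>)
qed (use wedge_like_vertex[OF E] wedge_like_vertex[OF E'] in blast)

text \<open>The case \<open>a = b = x\<close> of the collapse: an independent set containing
  \<open>x\<close> contains no neighbour of \<open>x\<close>, hence none of \<open>u\<close>, and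
  can be enlarged by \<open>u\<close>.\<close>

lemma wedge_like_fold:
  assumes E: "adjacency E" and S: "finite S" and p: "p \<noteq> x"
    and u: "u \<in> S" "u \<noteq> x" "\<not> E u x" "\<And>y. y \<in> S \<Longrightarrow> E u y \<Longrightarrow> E x y"
  shows "wedge_like (indc E (S - {x})) p ds \<longleftrightarrow> wedge_like (indc E S) p ds"
proof (cases "p \<in> S")
  case True
  have eq: "indc E (S - {x}) = {\<tau> \<in> indc E S. \<not> {x, x} \<subseteq> \<tau>}"
    by (auto simp: indc_def)
  show ?thesis
    unfolding eq
  proof (rule wedge_like_collapse[OF complex_indc[OF S] u(2,2)])
    fix \<tau> assume \<tau>: "\<tau> \<in> indc E S" "x \<in> \<tau>"
    have "\<not> E u y" if "y \<in> \<tau>" for y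
      using u(4)[of y] \<tau> that unfolding indc_def by blast
    then show "insert u \<tau> \<in> indc E S"
      using \<tau>(1) u(1) adjacencyD[OF E] unfolding indc_def by blast
  qed (use True p E in \<open>auto simp: vertex_in_indc\<close>)
qed (use wedge_like_vertex[OF E] in blast)

text \<open>All neighbours of \<open>w\<close> lie in the closed neighbourhood of \<open>v\<close>,
  so \<open>w\<close> can be added to every face of the link. On \<open>v\<close>, \<open>w\<close>
  and the non-neighbours of \<open>v\<close> the edge \<open>v w\<close> is therefore isolated, and
  the independence complex of this graph is the suspension of the link with poles \<open>v\<close>
  and \<open>w\<close>.\<close>

lemma wedge_like_split:
  assumes E: "adjacency E" and S: "finite S" and v: "v \<in> S" and w: "w \<in> S" "E v w"
    and dom: "\<And>y. y \<in> S \<Longrightarrow> E w y \<Longrightarrow> y = v \<or> E v y"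
    and 1: "wedge_like (indc E (S - {v})) w ds"
    and 2: "wedge_like (indc E (insert v (insert w {y \<in> S. y \<noteq> v \<and> \<not> E v y}))) w es"
  shows "wedge_like (indc E S) w (ds @ es)"
proof -
  let ?K = "indc E S" and ?L = "{y \<in> S. y \<noteq> v \<and> \<not> E v y}"
  have vw: "v \<noteq> w" using w(2) adjacencyD(2)[OF E] by blast
  have lk: "\<rho> \<in> link ?K v \<longleftrightarrow> \<rho> \<in> indc E ?L" for \<rho>
    using v adjacencyD[OF E] unfolding link_def indc_def by blast
  have wL: "\<not> E w y" "\<not> E y w" if "y \<in> ?L" for y
    using dom[of y] that adjacencyD(1)[OF E] by blast+
  have eq1: "{\<tau> \<in> ?K. v \<notin> \<tau>} = indc E (S - {v})"
    unfolding indc_def by blast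
  have cone: "insert z \<rho> \<in> indc E (insert v (insert w ?L))" if "\<rho> \<in> indc E ?L" "z = v \<or> z = w" for \<rho> z
  proof -
    have sub: "\<rho> \<subseteq> ?L" and ind: "\<And>x y. x \<in> \<rho> \<Longrightarrow> y \<in> \<rho> \<Longrightarrow> \<not> E x y" using that(1) unfolding indc_def by blast+
    have "\<not> E z y" "\<not> E y z" if "y \<in> \<rho>" for y
      using \<open>z = v \<or> z = w\<close> sub that wL[of y] adjacencyD(1)[OF E, of y v] by blast+
    then show ?thesis
      using sub ind that(2) adjacencyD(2)[OF E] unfolding indc_def by blast
  qed
  have eq2: "susp v w (link ?K v) = indc E (insert v (insert w ?L))"
  proof (intro set_eqI iffI)
    fix \<tau> assume "\<tau> \<in> susp v w (link ?K v)"
    then obtain \<rho> where \<rho>: "\<rho> \<in> indc E ?L" "\<tau> \<subseteq> insert w \<rho> \<or> \<tau> \<subseteq> insert v \<rho>"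
      by (auto simp: susp_def lk)
    have fin: "finite (insert v (insert w ?L))" using S by simp
    from \<rho>(2) show "\<tau> \<in> indc E (insert v (insert w ?L))"
      using complex_mono[OF complex_indc[OF fin] cone[OF \<rho>(1)]] by blast
  next
    fix \<tau> assume \<tau>: "\<tau> \<in> indc E (insert v (insert w ?L))"
    then have "\<tau> - {v, w} \<in> link ?K v" unfolding lk unfolding indc_def by blast
    moreover have "\<tau> \<subseteq> insert w (\<tau> - {v, w}) \<or> \<tau> \<subseteq> insert v (\<tau> - {v, w})"
      using \<tau> w(2) unfolding indc_def by blast
    ultimately show "\<tau> \<in> susp v w (link ?K v)" unfolding susp_def by blast
  qed
  show ?thesis
  proof (rule wedge_like_detach[OF complex_indc[OF S]])
    show "{v, w} \<notin> ?K" "{v} \<in> ?K" using E v w by (auto simp: edge_in_indc vertex_in_indc)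
    show "insert w \<rho> \<in> ?K" if "\<rho> \<in> link ?K v" for \<rho>
    proof -
      have "insert w \<rho> \<in> indc E (insert v (insert w ?L))" using that lk cone by blast
      then show ?thesis using v w(1) unfolding indc_def by blast
    qed
  qed (use 1 2 in \<open>simp_all add: eq1 eq2\<close>)
qed

section \<open>Iterated suspension by disjoint edges\<close>

fun ext :: "('a \<Rightarrow> 'a \<Rightarrow> bool) \<Rightarrow> 'a + nat \<times> bool \<Rightarrow> 'a + nat \<times> bool \<Rightarrow> bool" where
  "ext E (Inl x) (Inl y) = E x y"
| "ext E (Inr (i, b)) (Inr (j, c)) = (i = j \<and> b \<noteq> c)"
| "ext E _ _ = False"

text \<open>\<open>ext E\<close> contains the additional edges for all \<open>i\<close> at once and
  \<open>extV m S\<close> admits the first \<open>m\<close> of them, so the number of suspensions is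
  a matter of the vertex set alone.\<close>

definition extV :: "nat \<Rightarrow> 'a set \<Rightarrow> ('a + nat \<times> bool) set" where
  "extV m S = Inl ` S \<union> Inr ` ({..<m} \<times> UNIV)"

text \<open>\<open>ws b m E S\<close>: the \<open>m\<close>-fold suspension of the independence complex, realised by adding \<open>m\<close> disjoint
  edges to the graph, is a wedge of spheres; with \<open>b\<close> at least one sphere occurs. Carrying \<open>m\<close> along
  avoids having to suspend a wedge.\<close>

definition ws :: "bool \<Rightarrow> nat \<Rightarrow> ('a \<Rightarrow> 'a \<Rightarrow> bool) \<Rightarrow> 'a set \<Rightarrow> bool" where
  "ws b m E S \<longleftrightarrow> (\<exists>p ds. (b \<longrightarrow> ds \<noteq> []) \<and> wedge_like (indc (ext E) (extV m S)) p ds)"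

lemma adjacency_ext: "adjacency E \<Longrightarrow> adjacency (ext E)"
  unfolding adjacency_def
proof (intro conjI allI impI)
  assume E: "(\<forall>x y. E x y \<longrightarrow> E y x) \<and> (\<forall>x. \<not> E x x)"
  show "ext E y x" if "ext E x y" for x y
    using that E by (cases "(E, x, y)" rule: ext.cases) auto
  show "\<not> ext E x x" for x
    using E by (cases "(E, x, x)" rule: ext.cases) auto
qed

lemma finite_extV: "finite S \<Longrightarrow> finite (extV m S)"
  by (simp add: extV_def)

lemma Inl_in_extV [simp]: "Inl x \<in> extV m S \<longleftrightarrow> x \<in> S"
  by (auto simp: extV_def)

lemma Inr_in_extV [simp]: "Inr (i, b) \<in> extV m S \<longleftrightarrow> i < m"
  by (auto simp: extV_def)

lemma extV_cases:
  assumes "z \<in> extV m S"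
  obtains x where "x \<in> S" "z = Inl x" | i b where "i < m" "z = Inr (i, b)"
  using assms by (auto simp: extV_def)

lemma ws_mono: "ws b m E S \<Longrightarrow> (c \<Longrightarrow> b) \<Longrightarrow> ws c m E S"
  unfolding ws_def by blast

lemma indc_relabel:
  assumes "inj_on h S" and "\<And>x y. x \<in> S \<Longrightarrow> y \<in> S \<Longrightarrow> E' (h x) (h y) \<longleftrightarrow> E x y"
  shows "(`) h ` indc E S = indc E' (h ` S)"
proof (intro set_eqI iffI)
  fix \<tau> assume "\<tau> \<in> (`) h ` indc E S"
  then obtain \<sigma> where \<sigma>: "\<sigma> \<subseteq> S" "\<forall>x\<in>\<sigma>. \<forall>y\<in>\<sigma>. \<not> E x y" "\<tau> = h ` \<sigma>" by (auto simp: indc_def)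
  then show "\<tau> \<in> indc E' (h ` S)" using assms(2) by (auto simp: indc_def subset_iff)
next
  fix \<tau> assume \<tau>: "\<tau> \<in> indc E' (h ` S)"
  then have "\<tau> \<subseteq> h ` S" by (simp add: indc_def)
  then obtain \<sigma> where \<sigma>: "\<sigma> \<subseteq> S" "\<tau> = h ` \<sigma>" by (rule subset_imageE)
  then have "\<sigma> \<in> indc E S" using \<tau> assms(2) by (auto simp: indc_def subset_iff)
  then show "\<tau> \<in> (`) h ` indc E S" using \<sigma>(2) by simp
qed

lemma wedge_like_indc_relabel:
  assumes "wedge_like (indc E S) p ds" and h: "inj_on h S"
    and "\<And>x y. x \<in> S \<Longrightarrow> y \<in> S \<Longrightarrow> E' (h x) (h y) \<longleftrightarrow> E x y"
  shows "wedge_like (indc E' (h ` S)) (h p) ds"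
proof -
  have "\<Union>(indc E S) \<subseteq> S" by (auto simp: indc_def)
  then have "inj_on h (\<Union>(indc E S))" by (rule inj_on_subset[OF h])
  then show ?thesis
    using wedge_like_relabel[OF assms(1)] indc_relabel[where E = E and E' = E', OF h assms(3)] by metis
qed

lemma ws_relabel:
  assumes "ws b m E S" and h: "inj_on h S"
    and E: "\<And>x y. x \<in> S \<Longrightarrow> y \<in> S \<Longrightarrow> E' (h x) (h y) \<longleftrightarrow> E x y"
  shows "ws b m E' (h ` S)"
proof -
  obtain p ds where ds: "b \<longrightarrow> ds \<noteq> []" "wedge_like (indc (ext E) (extV m S)) p ds"
    using assms(1) by (auto simp: ws_def)
  let ?h = "map_sum h id :: _ \<Rightarrow> _ + nat \<times> bool"
  have "wedge_like (indc (ext E') (?h ` extV m S)) (?h p) ds"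
  proof (rule wedge_like_indc_relabel[OF ds(2)])
    show "inj_on ?h (extV m S)"
    proof (rule inj_onI)
      fix x y assume "x \<in> extV m S" "y \<in> extV m S" "?h x = ?h y"
      then show "x = y" by (elim extV_cases) (auto dest: inj_onD[OF h])
    qed
    show "ext E' (?h x) (?h y) \<longleftrightarrow> ext E x y" if "x \<in> extV m S" "y \<in> extV m S" for x y
      using that E by (elim extV_cases) auto
  qed
  moreover have "?h ` extV m S = extV m (h ` S)"
    by (auto simp: extV_def image_Un image_image)
  ultimately show ?thesis using ds(1) unfolding ws_def by metis
qed

lemma ws_cong:
  assumes "ws b m E S" and "\<And>x y. x \<in> S \<Longrightarrow> y \<in> S \<Longrightarrow> E' x y \<longleftrightarrow> E x y"
  shows "ws b m E' S"
  using ws_relabel[OF assms(1), of id E'] assms(2) by simp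

lemma ws_edge_change:
  assumes E: "adjacency E" and E': "adjacency E'" and S: "finite S"
    and ab: "a \<in> S" "b \<in> S" "a \<noteq> b" "E' a b \<longleftrightarrow> \<not> E a b"
    and agree: "\<And>x y. {x, y} \<noteq> {a, b} \<Longrightarrow> E' x y \<longleftrightarrow> E x y"
    and u: "u \<in> S" "u \<noteq> a" "u \<noteq> b" "\<not> E u a" "\<not> E u b" "\<And>y. y \<in> S \<Longrightarrow> E u y \<Longrightarrow> E a y \<or> E b y"
    and ws: "ws c m E' S"
  shows "ws c m E S"
proof -
  have ext_agree: "ext E' x y \<longleftrightarrow> ext E x y" if "{x, y} \<noteq> {Inl a, Inl b}" for x y
  proof (cases "\<exists>x' y'. x = Inl x' \<and> y = Inl y'")
    case True
    then obtain x' y' where xy: "x = Inl x'" "y = Inl y'" by blast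
    then have "{x', y'} \<noteq> {a, b}" using that by (auto simp: doubleton_eq_iff)
    then show ?thesis using agree xy by simp
  next
    case False
    then show ?thesis by (cases x; cases y) auto
  qed
  have ne: "{u, y} \<noteq> {a, b}" for y using u(2,3) by (auto simp: doubleton_eq_iff)
  have agree_u: "E' u y \<longleftrightarrow> E u y" for y by (rule agree[OF ne])
  \<comment> \<open>A neighbour of \<open>u\<close> differs from \<open>a\<close> and
    \<open>b\<close>, so the toggled edge does not affect its adjacency to them. The domination thus
    passes from \<open>E\<close> to \<open>E'\<close>, and the two can exchange roles when the edge
    is present in \<open>E\<close>.\<close>
  have E'u: "E' a y \<or> E' b y" if y: "y \<in> S" "E u y" for y
  proof -
    have "y \<noteq> a" "y \<noteq> b" using y(2) u(4,5) by auto
    then have "E' a y \<longleftrightarrow> E a y" "E' b y \<longleftrightarrow> E b y"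
      by (auto intro!: agree simp: doubleton_eq_iff)
    then show ?thesis using u(6)[OF y] by simp
  qed
  have "wedge_like (indc (ext E') (extV m S)) p ds \<longleftrightarrow> wedge_like (indc (ext E) (extV m S)) p ds" for p ds
  proof (cases "E a b")
    case False
    show ?thesis
    proof (rule wedge_like_edge_change[OF adjacency_ext[OF E] adjacency_ext[OF E'] finite_extV[OF S],
          where a = "Inl a" and b = "Inl b" and u = "Inl u"])
      show "ext E (Inl a) y \<or> ext E (Inl b) y" if "y \<in> extV m S" "ext E (Inl u) y" for y
        using that u(6) by (elim extV_cases) auto
    qed (use ab u False ext_agree in auto)
  next
    case True
    have "wedge_like (indc (ext E) (extV m S)) p ds \<longleftrightarrow> wedge_like (indc (ext E') (extV m S)) p ds"
    proof (rule wedge_like_edge_change[OF adjacency_ext[OF E'] adjacency_ext[OF E] finite_extV[OF S],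
          where a = "Inl a" and b = "Inl b" and u = "Inl u"])
      show "ext E' (Inl a) y \<or> ext E' (Inl b) y" if "y \<in> extV m S" "ext E' (Inl u) y" for y
        using that E'u agree_u by (elim extV_cases) auto
    qed (use ab u True ext_agree agree_u in auto)
    then show ?thesis ..
  qed
  then show ?thesis using ws unfolding ws_def by simp
qed

lemma ws_fold:
  assumes E: "adjacency E" and S: "finite S"
    and u: "u \<in> S" "u \<noteq> x" "\<not> E u x" "\<And>y. y \<in> S \<Longrightarrow> E u y \<Longrightarrow> E x y"
  shows "ws b m E (S - {x}) \<longleftrightarrow> ws b m E S"
proof -
  have eq: "extV m (S - {x}) = extV m S - {Inl x}" by (auto simp: extV_def)
  have fold: "wedge_like (indc (ext E) (extV m (S - {x}))) p ds \<longleftrightarrow> wedge_like (indc (ext E) (extV m S)) p ds"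
    if "p \<noteq> Inl x" for p ds
    unfolding eq
  proof (rule wedge_like_fold[OF adjacency_ext[OF E] finite_extV[OF S] that, where u = "Inl u"])
    show "ext E (Inl x) y" if "y \<in> extV m S" "ext E (Inl u) y" for y
      using that u(4) by (elim extV_cases) auto
  qed (use u in auto)
  show ?thesis
  proof
    assume "ws b m E (S - {x})"
    then obtain p ds where *: "b \<longrightarrow> ds \<noteq> []" "wedge_like (indc (ext E) (extV m (S - {x}))) p ds"
      by (auto simp: ws_def)
    moreover have "p \<noteq> Inl x" using wedge_like_vertex[OF adjacency_ext[OF E] *(2)] by auto
    ultimately show "ws b m E S" using fold unfolding ws_def by blast
  next
    assume "ws b m E S"
    then obtain p ds where *: "b \<longrightarrow> ds \<noteq> []" "wedge_like (indc (ext E) (extV m S)) p ds"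
      by (auto simp: ws_def)
    show "ws b m E (S - {x})"
    \<comment> \<open>If the base point is the vertex to be deleted, it first moves to
      \<open>u\<close> along the face \<open>{x, u}\<close>.\<close>
    proof (cases "p = Inl x")
      case True
      have "x \<in> S" using wedge_like_vertex[OF adjacency_ext[OF E] *(2)] True by simp
      then have "{p, Inl u} \<in> indc (ext E) (extV m S)"
        using u(1,3) adjacencyD(1)[OF E, of x u] True by (auto simp: edge_in_indc[OF adjacency_ext[OF E]])
      then have "wedge_like (indc (ext E) (extV m S)) (Inl u) ds"
        by (rule wedge_like_base_change[OF *(2)])
      then have "wedge_like (indc (ext E) (extV m (S - {x}))) (Inl u) ds"
        using fold[of "Inl u"] u(2) by simp
      then show ?thesis using *(1) unfolding ws_def by blast
    next
      case False
      then show ?thesis using * fold unfolding ws_def by blast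
    qed
  qed
qed

lemma ws_isolated:
  assumes E: "adjacency E" and S: "finite S" and u: "u \<in> S" "\<And>y. y \<in> S \<Longrightarrow> \<not> E u y"
  shows "ws False m E S"
proof -
  have nE: "\<not> ext E (Inl u) z" if "z \<in> extV m S" for z
    using that u(2) by (elim extV_cases) auto
  have nE': "\<not> ext E z (Inl u)" if "z \<in> extV m S" for z
    using nE[OF that] adjacencyD(1)[OF adjacency_ext[OF E]] by blast
  have "wedge_like (indc (ext E) (extV m S)) (Inl u) []"
  proof (rule wedge_like_cone[OF complex_indc[OF finite_extV[OF S]]])
    fix \<tau> assume "\<tau> \<in> indc (ext E) (extV m S)"
    then show "insert (Inl u) \<tau> \<in> indc (ext E) (extV m S)"
      using nE nE' u(1) nE[of "Inl u"] unfolding indc_def by (auto simp: subset_iff simp del: ext.simps)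
  next
    show "indc (ext E) (extV m S) \<noteq> {}" unfolding indc_def by blast
  qed
  then show ?thesis unfolding ws_def by blast
qed

text \<open>\<open>Suc m\<close> disjoint edges give the \<open>m\<close>-sphere. With no edge at
  all the realization has no point, so the suspension count starts at 1.\<close>

lemma ws_empty: "ws True (Suc m) E {}"
proof -
  have 1: "wedge_like ((`) Inr ` cross_polytope (Suc m) :: ('a + nat \<times> bool) set set) (Inr (0, True)) [m]"
    by (rule wedge_like_relabel[OF wedge_like_cross_polytope]) (simp add: inj_on_def)
  have 2: "cross_polytope (Suc m) = indc (\<lambda>x y. fst x = fst y \<and> snd x \<noteq> snd y) ({..<Suc m} \<times> UNIV)"
  proof -
    have "(\<forall>i. \<not> {(i, True), (i, False)} \<subseteq> \<tau>) \<longleftrightarrow> (\<forall>x\<in>\<tau>. \<forall>y\<in>\<tau>. \<not> (fst x = fst y \<and> snd x \<noteq> snd y))"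
      for \<tau> :: "(nat \<times> bool) set"
    proof (intro iffI allI ballI notI)
      fix x y assume *: "\<forall>i. \<not> {(i, True), (i, False)} \<subseteq> \<tau>" "x \<in> \<tau>" "y \<in> \<tau>" "fst x = fst y \<and> snd x \<noteq> snd y"
      then show False by (cases x; cases y; cases "snd x") auto
    next
      fix i assume "\<forall>x\<in>\<tau>. \<forall>y\<in>\<tau>. \<not> (fst x = fst y \<and> snd x \<noteq> snd y)" "{(i, True), (i, False)} \<subseteq> \<tau>"
      then show False by force
    qed
    then show ?thesis by (simp only: cross_polytope_def indc_def)
  qed
  have 3: "(`) Inr ` indc (\<lambda>x y. fst x = fst y \<and> snd x \<noteq> snd y) ({..<Suc m} \<times> UNIV)
      = indc (ext E) (Inr ` ({..<Suc m} \<times> UNIV))"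
    by (rule indc_relabel) auto
  have "wedge_like (indc (ext E) (extV (Suc m) {})) (Inr (0, True)) [m]"
    using 1 unfolding 2 3 extV_def by simp
  then show ?thesis unfolding ws_def by blast
qed

text \<open>The splitting wants \<open>w\<close> as base point of both summands. For the deletion
  without suspension this is what \<open>conn\<close> provides: a base point \<open>x\<close>
  adjacent to \<open>w\<close> reaches \<open>w\<close> through a common non-neighbour, unless the
  deletion consists of \<open>x\<close> and \<open>w\<close> alone. If \<open>m > 0\<close>, an end
  point of an added edge is such a common non-neighbour.\<close>

lemma ws_split:
  assumes E: "adjacency E" and S: "finite S" and v: "v \<in> S" and w: "w \<in> S" "E v w"
    and dom: "\<And>y. y \<in> S \<Longrightarrow> E w y \<Longrightarrow> y = v \<or> E v y"
    and conn: "m = 0 \<Longrightarrow> (\<And>x. x \<in> S - {v} \<Longrightarrow> x \<noteq> w \<Longrightarrow> E x w \<Longrightarrow>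
       (\<exists>y\<in>S - {v}. \<not> E x y \<and> \<not> E y w) \<or> S - {v} = {x, w})"
    and 1: "ws b m E (S - {v})"
    and 2: "ws c (Suc m) E {y \<in> S. y \<noteq> v \<and> \<not> E v y}"
  shows "ws (b \<or> c) m E S"
proof -
  define L where "L = {y \<in> S. y \<noteq> v \<and> \<not> E v y}"
  note E' = adjacency_ext[OF E]
  have vw: "v \<noteq> w" using w(2) adjacencyD(2)[OF E] by blast
  obtain p ds where ds: "b \<longrightarrow> ds \<noteq> []" "wedge_like (indc (ext E) (extV m (S - {v}))) p ds"
    using 1 by (auto simp: ws_def)
  have p: "p \<in> extV m (S - {v})" by (rule wedge_like_vertex[OF E' ds(2)])
  have K1: "wedge_like (indc (ext E) (extV m (S - {v}))) (Inl w) ds"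
  proof (cases "p = Inl w \<or> \<not> ext E p (Inl w)")
    case True
    then have "{p, Inl w} \<in> indc (ext E) (extV m (S - {v}))"
      using p w(1) vw adjacencyD(2)[OF E'] by (auto simp: edge_in_indc[OF E'])
    then show ?thesis by (rule wedge_like_base_change[OF ds(2)])
  next
    case False
    then obtain x where x: "p = Inl x" "x \<in> S - {v}" "x \<noteq> w" "E x w"
      using p by (elim extV_cases) auto
    show ?thesis
    proof (cases "m = 0 \<and> S - {v} = {x, w}")
      case True
      then have V: "extV m (S - {v}) = {Inl x, Inl w}" by (auto simp: extV_def)
      \<comment> \<open>The complex is two points, with no path between them; an automorphism
        exchanges them instead.\<close>
      let ?s = "\<lambda>z. if z = Inl x then Inl w else if z = Inl w then Inl x else z"
      have sw: "wedge_like (indc (ext E) (?s ` {Inl x, Inl w})) (?s p) ds"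
        by (rule wedge_like_indc_relabel[OF ds(2)[unfolded V]])
          (use x adjacencyD[OF E] in \<open>auto simp: inj_on_def\<close>)
      have im: "?s ` {Inl x, Inl w} = {Inl x, Inl w}" using x(3) by auto
      show ?thesis using sw unfolding im V by (simp add: x(1))
    next
      case False
      obtain q where q: "q \<in> extV m (S - {v})" "\<not> ext E p q" "\<not> ext E q (Inl w)"
      proof (cases "m = 0")
        case True
        then obtain y where "y \<in> S - {v}" "\<not> E x y" "\<not> E y w" using conn x(2-4) False by blast
        then show thesis using that[of "Inl y"] x(1) by simp
      next
        case False
        then show thesis using that[of "Inr (0, True)"] x(1) by simp
      qed
      have "wedge_like (indc (ext E) (extV m (S - {v}))) q ds"
        by (rule wedge_like_base_change[OF ds(2)]) (use p q in \<open>simp add: edge_in_indc[OF E']\<close>)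
      then show ?thesis
        by (rule wedge_like_base_change) (use q w(1) vw in \<open>simp add: edge_in_indc[OF E']\<close>)
    qed
  qed
  obtain r es where es: "c \<longrightarrow> es \<noteq> []" "wedge_like (indc (ext E) (extV (Suc m) L)) r es"
    using 2 unfolding L_def[symmetric] by (auto simp: ws_def)
  \<comment> \<open>Renames the additional edge number \<open>m\<close> to \<open>v w\<close>, the
    form in which \<open>wedge_like_split\<close> expects the suspended link.\<close>
  define h where "h z = (if z = Inr (m, True) then Inl v else if z = Inr (m, False) then Inl w else z)"
    for z :: "'a + nat \<times> bool"
  let ?T = "insert (Inl v) (insert (Inl w) (extV m L))"
  have wL: "\<not> E w y" "\<not> E y w" "\<not> E v y" "\<not> E y v" "y \<noteq> v" "y \<noteq> w" if "y \<in> L" for y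
    using dom[of y] that adjacencyD(1)[OF E] w(2) unfolding L_def by blast+
  have vL: "v \<notin> L" "w \<notin> L" using wL(5,6) by blast+
  have hx: "h (Inl y) = Inl y" "i < m \<Longrightarrow> h (Inr (i, b)) = Inr (i, b)"
    "h (Inr (m, b)) = (if b then Inl v else Inl w)" for y i b
    by (auto simp: h_def)
  have V: "extV (Suc m) L = insert (Inr (m, True)) (insert (Inr (m, False)) (extV m L))"
  proof (intro set_eqI iffI)
    fix z assume "z \<in> extV (Suc m) L"
    then show "z \<in> insert (Inr (m, True)) (insert (Inr (m, False)) (extV m L))"
      by (elim extV_cases) (auto simp: less_Suc_eq)
  qed (auto elim!: extV_cases)
  have himg: "h ` extV m L = extV m L"
  proof -
    have "h z = z" if "z \<in> extV m L" for z
      using that by (elim extV_cases) (simp_all add: hx)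
    then show ?thesis by simp
  qed
  have "h ` extV (Suc m) L = ?T"
    unfolding V by (simp add: himg hx)
  moreover have "wedge_like (indc (ext E) (h ` extV (Suc m) L)) (h r) es"
  proof (rule wedge_like_indc_relabel[OF es(2)])
    have hz: "h z = z" "h z \<noteq> Inl v" "h z \<noteq> Inl w" if "z \<in> extV m L" for z
      using that wL vL by (auto elim!: extV_cases simp: hx)
    show "inj_on h (extV (Suc m) L)"
      unfolding V using hz vw vL by (auto simp: inj_on_def hx)
    have nz: "\<not> ext E (Inl v) z" "\<not> ext E z (Inl v)" "\<not> ext E (Inl w) z" "\<not> ext E z (Inl w)"
      "\<not> ext E (Inr (m, b)) z" "\<not> ext E z (Inr (m, b))" if "z \<in> extV m L" for z b
      using that wL vL by (auto elim!: extV_cases)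
    show "ext E (h x) (h y) \<longleftrightarrow> ext E x y" if "x \<in> extV (Suc m) L" "y \<in> extV (Suc m) L" for x y
      using that unfolding V
      by (elim insertE) (use nz hz w(2) adjacencyD[OF E] in \<open>auto simp: hx\<close>)
  qed
  ultimately have T: "wedge_like (indc (ext E) ?T) (h r) es" by simp
  have hr: "h r \<in> ?T" by (rule wedge_like_vertex[OF E' T])
  have nz: "\<not> ext E (Inl v) z" "\<not> ext E z (Inl v)" "\<not> ext E (Inl w) z" "\<not> ext E z (Inl w)"
    "z \<noteq> Inl v" "z \<noteq> Inl w" if "z \<in> extV m L" for z
    using that wL vL by (auto elim!: extV_cases)
  have "wedge_like (indc (ext E) ?T) (Inl w) es"
  proof (cases "h r = Inl v")
    case True
    \<comment> \<open>Base change may fail here (\<open>?T\<close> may be \<open>{v, w}\<close>), but \<open>v\<close> and \<open>w\<close> are interchangeable.\<close>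
    let ?s = "\<lambda>z. if z = Inl v then Inl w else if z = Inl w then Inl v else z"
    have "wedge_like (indc (ext E) (?s ` ?T)) (?s (h r)) es"
    proof (rule wedge_like_indc_relabel[OF T])
      show "inj_on ?s ?T" by (auto simp: inj_on_def)
      show "ext E (?s x) (?s y) \<longleftrightarrow> ext E x y" if "x \<in> ?T" "y \<in> ?T" for x y
        using that by (elim insertE) (use nz vw w(2) adjacencyD[OF E] in auto)
    qed
    moreover have "?s ` ?T = ?T"
    proof -
      have "?s ` extV m L = extV m L"
        using nz by (intro image_cong[where g = id, simplified]) auto
      then show ?thesis using vw by auto
    qed
    ultimately show ?thesis using True by simp
  next
    case False
    then have "{h r, Inl w} \<in> indc (ext E) ?T"
      using hr nz adjacencyD(2)[OF E] by (auto simp: edge_in_indc[OF E'])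
    then show ?thesis by (rule wedge_like_base_change[OF T])
  qed
  moreover have "{y \<in> extV m S. y \<noteq> Inl v \<and> \<not> ext E (Inl v) y} = extV m L"
    unfolding L_def by (auto elim!: extV_cases)
  ultimately have K2: "wedge_like (indc (ext E) (insert (Inl v) (insert (Inl w)
      {y \<in> extV m S. y \<noteq> Inl v \<and> \<not> ext E (Inl v) y}))) (Inl w) es" by simp
  have "extV m (S - {v}) = extV m S - {Inl v}" by (auto simp: extV_def)
  then have K1': "wedge_like (indc (ext E) (extV m S - {Inl v})) (Inl w) ds" using K1 by simp
  have "wedge_like (indc (ext E) (extV m S)) (Inl w) (ds @ es)"
  proof (rule wedge_like_split[OF E' finite_extV[OF S] _ _ _ _ K1' K2])
    show "y = Inl v \<or> ext E (Inl v) y" if "y \<in> extV m S" "ext E (Inl w) y" for y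
      using that dom by (elim extV_cases) auto
  qed (use v w in auto)
  then show ?thesis using ds(1) es(1) unfolding ws_def by blast
qed

lemma ws_0:
  assumes "ws b 0 E S"
  obtains ds where "b \<longrightarrow> ds \<noteq> []"
    "geometric_realization (indc E S) homotopy_equivalent_space wedge_of_spheres ds"
proof -
  obtain p ds where ds: "b \<longrightarrow> ds \<noteq> []" "wedge_like (indc (ext E) (extV 0 S)) p ds"
    using assms by (auto simp: ws_def)
  have V: "extV 0 S = Inl ` S" by (simp add: extV_def)
  have "wedge_like (indc E (projl ` extV 0 S)) (projl p) ds"
    by (rule wedge_like_indc_relabel[OF ds(2)]) (auto simp: V inj_on_def)
  moreover have "projl ` extV 0 S = S" by (simp add: V image_image)
  ultimately have "pointed_heq (gr (indc E S)) (pt (projl p)) (wedge_of_spheres ds) None"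
    by (simp add: wedge_like_def)
  then show thesis
    by (intro that[OF ds(1)]) (simp only: geometric_realization_eq pointed_heq_imp_homotopy_equivalent)
qed

section \<open>Reduction certificates\<close>

text \<open>Each edge of the unbounded grid is listed at one end point only; the strips are cut out
  by their vertex sets. The odd parity refers to the corner \<open>(i, j)\<close> of a square. An
  antidiagonal is listed at the corner one row further on, in the same column, where the parity is
  even. The guard \<open>i \<ge> 1\<close> avoids truncated subtraction.\<close>

fun fwd :: "vertex \<Rightarrow> vertex list" where
  "fwd (Vg i j) = [Vg (i + 1) j, Vg i (j + 1)]
     @ (if (i + j) mod 2 = 1 then [Vg (i + 1) (j + 1)] else [])
     @ (if i \<ge> 1 \<and> (i + j) mod 2 = 0 then [Vg (i - 1) (j + 1)] else [])"
| "fwd _ = []"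

definition grid :: "vertex \<Rightarrow> vertex \<Rightarrow> bool" where
  "grid x y \<longleftrightarrow> y \<in> set (fwd x) \<or> x \<in> set (fwd y)"

lemma not_fwd_self: "x \<notin> set (fwd x)"
  by (cases x) auto

lemma adjacency_grid: "adjacency grid"
  using not_fwd_self by (auto simp: adjacency_def grid_def)

fun shift :: "nat \<Rightarrow> vertex \<Rightarrow> vertex" where
  "shift s (Vg i j) = Vg i (j + s)"
| "shift s x = x"

lemma inj_shift: "inj (shift s)"
proof (rule injI)
  show "x = y" if "shift s x = shift s y" for x y
    using that by (cases x; cases y) auto
qed

lemma fwd_shift: "even s \<Longrightarrow> fwd (shift s (Vg i j)) = map (shift s) (fwd (Vg i j))"
proof -
  assume "even s"
  then have "(i + (j + s)) mod 2 = (i + j) mod 2" by presburger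
  then show ?thesis by simp
qed

text \<open>An even shift keeps the parity of \<open>i + j\<close>, and with it the
  diagonals.\<close>

lemma grid_shift:
  assumes "even s"
  shows "grid (shift s (Vg i j)) (shift s (Vg k l)) \<longleftrightarrow> grid (Vg i j) (Vg k l)"
  unfolding grid_def fwd_shift[OF assms] set_map inj_image_mem_iff[OF inj_shift] ..

section \<open>Strips and their tails\<close>

definition columns :: "nat \<Rightarrow> vertex list" where
  "columns n = concat (map (\<lambda>j. [Vg 1 j, Vg 2 j, Vg 3 j]) [1..<Suc n])"

definition strip :: "vertex list \<Rightarrow> nat \<Rightarrow> vertex set" where
  "strip rem n = {Vg i j | i j. i \<in> {1..3} \<and> j \<in> {1..n}} - set rem"

definition tail :: "nat \<Rightarrow> nat \<Rightarrow> vertex set" where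
  "tail r n = {Vg i j | i j. i \<in> {1..3} \<and> j \<in> {r<..n}}"

lemma set_columns: "set (columns n) = {Vg i j | i j. i \<in> {1..3} \<and> j \<in> {1..n}}"
proof -
  have "{1..3} = {1, 2, 3::nat}" by auto
  then show ?thesis by (auto simp: columns_def)
qed

text \<open>A certificate is a recipe that reduces a graph to known ones. \<open>Toggle a b u\<close> inserts or deletes the edge
  \<open>a b\<close>, \<open>Del x u\<close> deletes the vertex \<open>x\<close> and \<open>Add x N u\<close> adds a vertex \<open>x\<close> with neighbourhood \<open>N\<close>; in each case
  the neighbours of the witness \<open>u\<close> are dominated, so the homotopy type is unchanged.
  \<open>Split v w c d\<close>, for an edge \<open>v w\<close> such that every neighbour of \<open>w\<close> other than \<open>v\<close> is a neighbour of \<open>v\<close>, continues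
  with the deletion (\<open>c\<close>) and with the once more suspended link (\<open>d\<close>) of \<open>v\<close>.
  \<open>Leaf k s\<close> refers to the \<open>k\<close>-th key graph shifted by \<open>s\<close> columns.\<close>

datatype cert =
    Toggle vertex vertex vertex cert
  | Del vertex vertex cert
  | Add vertex "vertex list" vertex cert
  | Split vertex vertex cert cert
  | Iso vertex
  | Leaf nat nat
  | Empty

definition adj :: "(vertex \<times> vertex) list \<Rightarrow> vertex \<Rightarrow> vertex \<Rightarrow> bool" where
  "adj EL x y \<longleftrightarrow> x \<noteq> y \<and> list_ex (\<lambda>(p, q). p = x \<and> q = y \<or> p = y \<and> q = x) EL"

definition nbrs_ok :: "(vertex \<times> vertex) list \<Rightarrow> vertex list \<Rightarrow> vertex \<Rightarrow> (vertex \<Rightarrow> bool) \<Rightarrow> bool" where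
  "nbrs_ok EL A u P \<longleftrightarrow> list_all (\<lambda>(p, q). (p = u \<longrightarrow> q \<in> set A \<longrightarrow> P q) \<and> (q = u \<longrightarrow> p \<in> set A \<longrightarrow> P p)) EL"

definition without :: "vertex \<Rightarrow> (vertex \<times> vertex) list \<Rightarrow> (vertex \<times> vertex) list" where
  "without x EL = filter (\<lambda>(p, q). p \<noteq> x \<and> q \<noteq> x) EL"

definition gedges :: "vertex list \<Rightarrow> (vertex \<times> vertex) list" where
  "gedges A = concat (map (\<lambda>x. map (Pair x) (filter (\<lambda>y. y \<in> set A) (fwd x))) A)"

text \<open>The inequality is strict because column \<open>r\<close> is explicit but adjacent to the
  tail; \<open>local\<close> below only asks that a vertex not lie in the tail. Vertices outside the
  grid never touch the tail.\<close>

fun inner :: "nat \<Rightarrow> vertex \<Rightarrow> bool" where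
  "inner r (Vg i j) = (j < r)"
| "inner r _ = True"

fun local :: "nat \<Rightarrow> vertex \<Rightarrow> bool" where
  "local r (Vg i j) = (j \<le> r)"
| "local r _ = True"

definition same_graph :: "vertex list \<Rightarrow> (vertex \<times> vertex) list \<Rightarrow> (vertex \<times> vertex) list \<Rightarrow> bool" where
  "same_graph A EL EL' \<longleftrightarrow>
     list_all (\<lambda>(p, q). p \<in> set A \<longrightarrow> q \<in> set A \<longrightarrow> adj EL' p q) EL \<and>
     list_all (\<lambda>(p, q). p \<in> set A \<longrightarrow> q \<in> set A \<longrightarrow> adj EL p q) EL'"

definition same_set :: "vertex list \<Rightarrow> vertex list \<Rightarrow> bool" where
  "same_set A B \<longleftrightarrow> list_all (\<lambda>x. x \<in> set B) A \<and> list_all (\<lambda>x. x \<in> set A) B"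

text \<open>The graph under inspection lives on \<open>set A \<union> T\<close>: the part on \<open>A\<close> is explicit with edge list \<open>EL\<close>, while
  \<open>T\<close> is an unknown tail that only touches explicit vertices which are not \<^term>\<open>inner r\<close>; the flag
  \<open>cl\<close> says that there is no tail. With \<open>z\<close> the complex itself (and not a suspension) is meant.\<close>

fun chk :: "nat \<Rightarrow> bool \<Rightarrow> (nat \<Rightarrow> vertex list) \<Rightarrow> (nat \<Rightarrow> bool) \<Rightarrow> bool \<Rightarrow> vertex list \<Rightarrow> (vertex \<times> vertex) list \<Rightarrow>
    cert \<Rightarrow> (bool \<times> (nat \<times> nat) list) option" where
  "chk r cl ks fl z A EL (Toggle a b u c) =
    (if a \<in> set A \<and> b \<in> set A \<and> u \<in> set A \<and> a \<noteq> b \<and> u \<noteq> a \<and> u \<noteq> b \<and> (cl \<or> inner r u) \<and> \<not> adj EL u a \<and> \<not> adj EL u b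
        \<and> nbrs_ok EL A u (\<lambda>y. adj EL a y \<or> adj EL b y)
     then chk r cl ks fl z A
       (if adj EL a b then filter (\<lambda>(p, q). \<not> (p = a \<and> q = b \<or> p = b \<and> q = a)) EL else (a, b) # EL) c
     else None)"
| "chk r cl ks fl z A EL (Del x u c) =
    (if x \<in> set A \<and> u \<in> set A \<and> u \<noteq> x \<and> (cl \<or> inner r u) \<and> \<not> adj EL u x \<and> nbrs_ok EL A u (adj EL x)
     then chk r cl ks fl z (removeAll x A) (without x EL) c else None)"
| "chk r cl ks fl z A EL (Add x N u c) =
    (if x \<notin> set A \<and> u \<in> set A \<and> u \<notin> set N \<and> x \<notin> set N \<and> (cl \<or> inner r u \<and> inner r x)
        \<and> nbrs_ok EL A u (\<lambda>y. y \<in> set N)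
     then chk r cl ks fl z (x # A) (map (Pair x) N @ without x EL) c else None)"
| "chk r cl ks fl z A EL (Split v w c d) =
    (if v \<in> set A \<and> w \<in> set A \<and> (cl \<or> inner r v \<and> inner r w) \<and> adj EL v w \<and> nbrs_ok EL A w (\<lambda>y. y = v \<or> adj EL v y)
        \<and> (z \<longrightarrow> list_all (\<lambda>x. x = w \<or> \<not> adj EL x w \<or> list_ex (\<lambda>y. \<not> adj EL x y \<and> \<not> adj EL y w) (removeAll v A)
             \<or> cl \<and> list_all (\<lambda>y. y = x \<or> y = w) (removeAll v A)) (removeAll v A))
     then (case chk r cl ks fl z (removeAll v A) (without v EL) c of None \<Rightarrow> None
       | Some (b1, l1) \<Rightarrow>
          let B = filter (\<lambda>y. y \<noteq> v \<and> \<not> adj EL v y) A in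
          (case chk r cl ks fl False B (filter (\<lambda>(p, q). p \<in> set B \<and> q \<in> set B) EL) d of None \<Rightarrow> None
           | Some (b2, l2) \<Rightarrow> Some (b1 \<or> b2, l1 @ l2)))
     else None)"
| "chk r cl ks fl z A EL (Iso u) =
    (if u \<in> set A \<and> (cl \<or> inner r u) \<and> nbrs_ok EL A u (\<lambda>y. False) then Some (False, []) else None)"
| "chk r cl ks fl z A EL (Leaf k s) =
    (if \<not> z \<and> even s \<and> s \<le> r \<and> (cl \<or> list_all (local r) (map (shift s) (ks k))) \<and> same_set A (filter (\<lambda>x. x \<notin> set (columns s) \<and> x \<notin> set (map (shift s) (ks k))) (columns r))
        \<and> same_graph A EL (gedges A)
     then Some (fl k, [(k, s)]) else None)"
| "chk r cl ks fl z A EL Empty = (if cl \<and> \<not> z \<and> A = [] then Some (True, []) else None)"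

section \<open>Soundness of the certificate checker\<close>

lemma adj_iff: "adj EL x y \<longleftrightarrow> x \<noteq> y \<and> ((x, y) \<in> set EL \<or> (y, x) \<in> set EL)"
  by (auto simp: adj_def list_ex_iff)

lemma nbrs_okD: "nbrs_ok EL A u P \<Longrightarrow> adj EL u y \<Longrightarrow> y \<in> set A \<Longrightarrow> P y"
  by (auto simp: nbrs_ok_def adj_iff list_all_iff)

text \<open>A certificate step edits \<open>EL\<close> only, while pairs meeting the tail keep their
  grid adjacency throughout. This is what makes one certificate valid for all lengths.\<close>

definition rel :: "(vertex \<times> vertex) list \<Rightarrow> vertex set \<Rightarrow> vertex \<Rightarrow> vertex \<Rightarrow> bool" where
  "rel EL T x y \<longleftrightarrow> (if x \<in> T \<or> y \<in> T then grid x y else adj EL x y)"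

lemma adjacency_rel: "adjacency (rel EL T)"
  using adjacency_grid by (auto simp: adjacency_def rel_def adj_iff)

lemma grid_inner: "inner r x \<Longrightarrow> y \<in> tail r n \<Longrightarrow> \<not> grid x y"
  by (cases x) (auto simp: tail_def grid_def split: if_splits)

definition tail_ok :: "nat \<Rightarrow> bool \<Rightarrow> nat \<Rightarrow> vertex set \<Rightarrow> bool" where
  "tail_ok r cl n T \<longleftrightarrow> (if cl then T = {} \<and> n = r else T = tail r n \<and> r \<le> n)"

lemma finite_tail: "finite (tail r n)"
proof -
  have "tail r n \<subseteq> (\<lambda>(i, j). Vg i j) ` ({1..3} \<times> {r<..n})" by (auto simp: tail_def)
  then show ?thesis by (rule finite_subset) simp
qed

lemma inner_rel:
  assumes "tail_ok r cl n T" "cl \<or> inner r u" "u \<notin> T" "y \<in> T"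
  shows "\<not> rel EL T u y"
  using assms grid_inner[of r u y n] by (auto simp: tail_ok_def rel_def split: if_splits)

lemma inner_not_tail: "tail_ok r cl n T \<Longrightarrow> cl \<or> inner r x \<Longrightarrow> x \<notin> T"
  by (auto simp: tail_ok_def tail_def split: if_splits)

lemma ws_shift:
  assumes "ws b m grid (strip rem n)" "even s"
  shows "ws b m grid (strip (columns s @ map (shift s) rem) (n + s))"
proof -
  have "ws b m grid (shift s ` strip rem n)"
  proof (rule ws_relabel[OF assms(1)])
    show "inj_on (shift s) (strip rem n)" using inj_shift by (rule inj_on_subset) simp
    show "grid (shift s x) (shift s y) \<longleftrightarrow> grid x y" if "x \<in> strip rem n" "y \<in> strip rem n" for x y
      using that grid_shift[OF assms(2)] by (auto simp: strip_def)
  qed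
  moreover have "shift s ` strip rem n = strip (columns s @ map (shift s) rem) (n + s)"
  proof (intro set_eqI iffI)
    fix x assume "x \<in> shift s ` strip rem n"
    then obtain i j where *: "x = shift s (Vg i j)" "Vg i j \<in> strip rem n" by (auto simp: strip_def)
    have "x \<notin> shift s ` set rem"
      unfolding *(1) inj_image_mem_iff[OF inj_shift] using *(2) by (simp add: strip_def)
    then show "x \<in> strip (columns s @ map (shift s) rem) (n + s)"
      using * by (auto simp: strip_def set_columns)
  next
    fix x assume x: "x \<in> strip (columns s @ map (shift s) rem) (n + s)"
    then obtain i j where ij: "x = Vg i j" "i \<in> {1..3}" "j \<in> {1..n + s}" "x \<notin> set (columns s)"
      "x \<notin> shift s ` set rem"
      by (auto simp: strip_def)
    then have "j > s" by (auto simp: set_columns)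
    then have x: "x = shift s (Vg i (j - s))" using ij(1) by simp
    then have "Vg i (j - s) \<notin> set rem" using ij(5) by blast
    then have "Vg i (j - s) \<in> strip rem n" using ij \<open>j > s\<close> by (auto simp: strip_def)
    then show "x \<in> shift s ` strip rem n" using x by blast
  qed
  ultimately show ?thesis by simp
qed

lemma strip_eq:
  assumes T: "tail_ok r cl n T" and A: "set A = set (columns r) - set R" and R: "cl \<or> list_all (local r) R"
  shows "strip R n = set A \<union> T"
proof -
  have rem: "x \<notin> T" if "x \<in> set R" for x
  proof (cases cl)
    case False
    then have "local r x" using that R by (simp add: list_all_iff)
    then show ?thesis using T False by (auto simp: tail_ok_def tail_def)
  qed (use T in \<open>simp add: tail_ok_def\<close>)
  have "set (columns n) = set (columns r) \<union> T"
  proof (cases cl)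
    case False
    have "T = tail r n" "r \<le> n" using T False by (simp_all add: tail_ok_def)
    then show ?thesis unfolding set_columns tail_def by auto
  qed (use T in \<open>simp add: tail_ok_def\<close>)
  moreover have "strip R n = set (columns n) - set R"
    by (simp only: strip_def set_columns)
  ultimately show ?thesis using A rem by blast
qed

lemma adj_gedges:
  assumes "x \<in> set A" "y \<in> set A"
  shows "adj (gedges A) x y \<longleftrightarrow> grid x y"
proof -
  have "(x, y) \<in> set (gedges A) \<longleftrightarrow> x \<in> set A \<and> y \<in> set A \<and> y \<in> set (fwd x)" for x y
    by (auto simp: gedges_def)
  then show ?thesis using assms not_fwd_self by (auto simp: adj_iff grid_def)
qed

lemma columns_tail: "tail_ok r cl n T \<Longrightarrow> set (columns r) \<inter> T = {}"
  by (auto simp: tail_ok_def tail_def set_columns split: if_splits)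

lemma if_None_eq_Some: "(if P then X else None) = Some y \<longleftrightarrow> P \<and> X = Some y"
  by simp

text \<open>Each constructor is matched by one lemma on \<open>ws\<close>; with a tail present,
  witnesses have to be inner, so that all their neighbours are visible to the checker. The flag
  \<open>z\<close> says whether \<open>m\<close> is 0. The link of a split is checked with
  \<open>z\<close> false, and \<open>Leaf\<close> and \<open>Empty\<close> are accepted only there,
  where \<open>m > 0\<close>.\<close>

lemma chk_sound:
  assumes "chk r cl ks fl z A EL c = Some (b, ls)" and T: "tail_ok r cl n T" and "set A \<inter> T = {}"
    and "\<And>k s m. (k, s) \<in> set ls \<Longrightarrow> s \<le> n \<and> ws (fl k) (Suc m) grid (strip (ks k) (n - s))"
    and "if z then m = 0 else m > 0"
  shows "ws b m (rel EL T) (set A \<union> T)"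
  using assms(1,3-5)
proof (induction c arbitrary: z A EL b ls m)
  have finT: "finite T" using T finite_tail by (auto simp: tail_ok_def split: if_splits)
  note adjR = adjacency_rel
  have relA: "rel EL T x y \<longleftrightarrow> adj EL x y" if "x \<notin> T" "y \<notin> T" for EL x y
    using that by (simp add: rel_def)
  have relT: "rel EL T x y \<longleftrightarrow> rel EL' T x y" if "x \<in> T \<or> y \<in> T" for EL EL' x y
    using that by (auto simp: rel_def)
  {
    case (Toggle a b u c z A EL e ls m)
    let ?EL = "if adj EL a b then filter (\<lambda>(p, q). \<not> (p = a \<and> q = b \<or> p = b \<and> q = a)) EL else (a, b) # EL"
    have *: "a \<in> set A" "b \<in> set A" "u \<in> set A" "a \<noteq> b" "u \<noteq> a" "u \<noteq> b" "cl \<or> inner r u" "\<not> adj EL u a" "\<not> adj EL u b"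
      "nbrs_ok EL A u (\<lambda>y. adj EL a y \<or> adj EL b y)" and r: "chk r cl ks fl z A ?EL c = Some (e, ls)"
      using Toggle.prems(1) unfolding chk.simps if_None_eq_Some by simp_all
    have nT: "a \<notin> T" "b \<notin> T" "u \<notin> T" using * Toggle.prems(2) by auto
    show ?case
    proof (rule ws_edge_change[where E = "rel EL T" and E' = "rel ?EL T" and a = a and b = b and u = u, OF adjR adjR])
      show "rel ?EL T a b \<longleftrightarrow> \<not> rel EL T a b"
        using nT *(4) by (auto simp: relA adj_iff)
      show "rel ?EL T x y \<longleftrightarrow> rel EL T x y" if "{x, y} \<noteq> {a, b}" for x y
      proof (cases "x \<in> T \<or> y \<in> T")
        case False
        then show ?thesis using that by (auto simp: relA adj_iff doubleton_eq_iff)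
      qed (rule relT)
      show "rel EL T a y \<or> rel EL T b y" if "y \<in> set A \<union> T" "rel EL T u y" for y
      proof -
        have "y \<notin> T" using inner_rel[OF T *(7) nT(3)] that(2) by blast
        then show ?thesis using that nbrs_okD[OF *(10)] nT by (auto simp: relA)
      qed
      show "ws e m (rel ?EL T) (set A \<union> T)" by (rule Toggle.IH[OF r Toggle.prems(2-4)])
    qed (use * nT finT in \<open>auto simp: relA\<close>)
  next
    case (Del x u c z A EL b ls m)
    have *: "x \<in> set A" "u \<in> set A" "u \<noteq> x" "cl \<or> inner r u" "\<not> adj EL u x" "nbrs_ok EL A u (adj EL x)"
      and r: "chk r cl ks fl z (removeAll x A) (without x EL) c = Some (b, ls)"
      using Del.prems(1) by (auto split: if_splits)
    have nT: "x \<notin> T" "u \<notin> T" using * Del.prems(2) by auto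
    have "set (removeAll x A) \<inter> T = {}" using Del.prems(2) by auto
    then have "ws b m (rel (without x EL) T) (set (removeAll x A) \<union> T)"
      by (rule Del.IH[OF r _ Del.prems(3,4)])
    moreover have "set (removeAll x A) \<union> T = (set A \<union> T) - {x}" using nT by auto
    ultimately have "ws b m (rel (without x EL) T) ((set A \<union> T) - {x})" by simp
    then have "ws b m (rel EL T) ((set A \<union> T) - {x})"
      by (rule ws_cong) (auto simp: rel_def adj_iff without_def)
    moreover have "ws b m (rel EL T) ((set A \<union> T) - {x}) \<longleftrightarrow> ws b m (rel EL T) (set A \<union> T)"
    proof (rule ws_fold[OF adjR, where u = u])
      show "rel EL T x y" if "y \<in> set A \<union> T" "rel EL T u y" for y
      proof -
        have "y \<notin> T" using inner_rel[OF T *(4) nT(2)] that(2) by blast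
        then show ?thesis using that nbrs_okD[OF *(6)] nT by (auto simp: relA)
      qed
    qed (use * nT finT in \<open>auto simp: relA\<close>)
    ultimately show ?case by simp
  next
    case (Add x N u c z A EL b ls m)
    let ?EL = "map (Pair x) N @ without x EL"
    have *: "x \<notin> set A" "u \<in> set A" "u \<notin> set N" "x \<notin> set N" "cl \<or> inner r u \<and> inner r x" "nbrs_ok EL A u (\<lambda>y. y \<in> set N)"
      and r: "chk r cl ks fl z (x # A) ?EL c = Some (b, ls)"
      using Add.prems(1) by (auto split: if_splits)
    have nT: "x \<notin> T" "u \<notin> T" using *(5) inner_not_tail[OF T] by auto
    have ux: "u \<noteq> x" using *(1,2) by auto
    have "set (x # A) \<inter> T = {}" using Add.prems(2) nT by auto
    then have 1: "ws b m (rel ?EL T) (set (x # A) \<union> T)"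
      by (rule Add.IH[OF r _ Add.prems(3,4)])
    have adjx: "adj ?EL x y \<longleftrightarrow> y \<in> set N" if "y \<noteq> x" for y
      using that by (auto simp: adj_iff without_def)
    have adjo: "adj ?EL p q \<longleftrightarrow> adj EL p q" if "p \<noteq> x" "q \<noteq> x" for p q
      using that by (auto simp: adj_iff without_def)
    have eq: "set A \<union> T = (set (x # A) \<union> T) - {x}" using *(1) nT by auto
    have "ws b m (rel ?EL T) ((set (x # A) \<union> T) - {x}) \<longleftrightarrow> ws b m (rel ?EL T) (set (x # A) \<union> T)"
    proof (rule ws_fold[OF adjR, where u = u])
      show "rel ?EL T x y" if "y \<in> set (x # A) \<union> T" "rel ?EL T u y" for y
      proof -
        have yT: "y \<notin> T" using inner_rel[OF T _ nT(2)] that(2) *(5) by blast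
        have a: "adj ?EL u y" using that(2) yT nT by (simp add: relA)
        have "y \<noteq> x"
        proof
          assume "y = x"
          then have "adj ?EL x u" using a unfolding adj_iff by blast
          then show False using *(3) adjx[OF ux] by simp
        qed
        then have "adj EL u y" "y \<in> set A" using a that(1) yT adjo[OF ux] by auto
        then have "y \<in> set N" by (rule nbrs_okD[OF *(6)])
        then show ?thesis using adjx[OF \<open>y \<noteq> x\<close>] relA[OF nT(1) yT] by simp
      qed
      show "\<not> rel ?EL T u x"
      proof
        assume "rel ?EL T u x"
        then have "rel ?EL T x u" by (rule adjacencyD(1)[OF adjR])
        then show False using *(3) adjx[OF ux] relA[OF nT] by simp
      qed
    qed (use * ux finT in auto)
    then have "ws b m (rel ?EL T) ((set (x # A) \<union> T) - {x})" using 1 by (rule iffD2)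
    then have "ws b m (rel ?EL T) (set A \<union> T)" by (subst eq)
    then show ?case
    proof (rule ws_cong)
      show "rel EL T p q \<longleftrightarrow> rel ?EL T p q" if "p \<in> set A \<union> T" "q \<in> set A \<union> T" for p q
      proof -
        have "p \<noteq> x" "q \<noteq> x" using that *(1) nT by auto
        then show ?thesis using adjo by (simp add: rel_def)
      qed
    qed
  next
    case (Split v w c d z A EL b ls m)
    let ?A = "removeAll v A" and ?B = "filter (\<lambda>y. y \<noteq> v \<and> \<not> adj EL v y) A"
    let ?EB = "filter (\<lambda>(p, q). p \<in> set ?B \<and> q \<in> set ?B) EL"
    have *: "v \<in> set A" "w \<in> set A" "cl \<or> inner r v \<and> inner r w" "adj EL v w" "nbrs_ok EL A w (\<lambda>y. y = v \<or> adj EL v y)"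
      and conn: "z \<Longrightarrow> list_all (\<lambda>x. x = w \<or> \<not> adj EL x w \<or> list_ex (\<lambda>y. \<not> adj EL x y \<and> \<not> adj EL y w) ?A
             \<or> cl \<and> list_all (\<lambda>y. y = x \<or> y = w) ?A) ?A"
      using Split.prems(1) by (auto split: if_splits)
    let ?c1 = "chk r cl ks fl z ?A (without v EL) c" and ?c2 = "chk r cl ks fl False ?B ?EB d"
    have body: "(case ?c1 of None \<Rightarrow> None | Some (b1, l1) \<Rightarrow>
        (case ?c2 of None \<Rightarrow> None | Some (b2, l2) \<Rightarrow> Some (b1 \<or> b2, l1 @ l2))) = Some (b, ls)"
      using Split.prems(1) unfolding chk.simps if_None_eq_Some Let_def by (elim conjE)
    obtain b1 l1 where r1: "?c1 = Some (b1, l1)"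
      using body by (cases ?c1) auto
    obtain b2 l2 where r2: "?c2 = Some (b2, l2)"
      using body unfolding r1 by (cases ?c2) auto
    have r: "?c1 = Some (b1, l1)" "?c2 = Some (b2, l2)" "b = (b1 \<or> b2)" "ls = l1 @ l2"
      using r1 r2 body unfolding r1 r2 by simp_all
    have nT: "v \<notin> T" "w \<notin> T" using * Split.prems(2) by auto
    have d: "set ?A \<inter> T = {}" "set ?B \<inter> T = {}" using Split.prems(2) by auto
    have "ws b1 m (rel (without v EL) T) (set ?A \<union> T)"
      by (rule Split.IH(1)[OF r(1) d(1) _ Split.prems(4)]) (use Split.prems(3) r(4) in auto)
    then have 1: "ws b1 m (rel EL T) (set ?A \<union> T)"
      by (rule ws_cong) (use nT in \<open>auto simp: rel_def adj_iff without_def\<close>)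
    have "ws b2 (Suc m) (rel ?EB T) (set ?B \<union> T)"
      by (rule Split.IH(2)[OF r(2) d(2)]) (use Split.prems(3) r(4) in auto)
    then have 2: "ws b2 (Suc m) (rel EL T) (set ?B \<union> T)"
      by (rule ws_cong) (auto simp: rel_def adj_iff)
    have vT: "\<not> rel EL T v y" if "y \<in> T" for y
      using inner_rel[OF T _ nT(1) that] *(3) by blast
    have eqA: "set ?A \<union> T = (set A \<union> T) - {v}" using nT by auto
    have eqB: "set ?B \<union> T = {y \<in> set A \<union> T. y \<noteq> v \<and> \<not> rel EL T v y}"
    proof -
      have "rel EL T v y \<longleftrightarrow> adj EL v y" if "y \<in> set A" for y
        using that Split.prems(2) by (intro relA nT) auto
      then show ?thesis using nT vT by auto
    qed
    show ?case
      unfolding r(3)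
    proof (rule ws_split[OF adjR, where v = v and w = w])
      show "rel EL T v w" using *(4) nT by (simp add: relA)
      show "y = v \<or> rel EL T v y" if "y \<in> set A \<union> T" "rel EL T w y" for y
      proof -
        have "y \<notin> T" using inner_rel[OF T _ nT(2)] that(2) *(3) by blast
        then show ?thesis using that nbrs_okD[OF *(5)] nT by (auto simp: relA)
      qed
      show "(\<exists>y\<in>set A \<union> T - {v}. \<not> rel EL T x y \<and> \<not> rel EL T y w) \<or> set A \<union> T - {v} = {x, w}"
        if "m = 0" and x: "x \<in> set A \<union> T - {v}" "x \<noteq> w" "rel EL T x w" for x
      proof -
        have z: z using Split.prems(4) \<open>m = 0\<close> by (auto split: if_splits)
        have "\<not> rel EL T w x" if "x \<in> T"
          using inner_rel[OF T _ nT(2) that] *(3) by blast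
        then have xT: "x \<notin> T" using x(3) adjacencyD(1)[OF adjR] by blast
        then have xA: "x \<in> set ?A" using x(1) by auto
        have "adj EL x w" using x(3) xT nT by (simp add: relA)
        then consider "list_ex (\<lambda>y. \<not> adj EL x y \<and> \<not> adj EL y w) ?A" | "cl" "list_all (\<lambda>y. y = x \<or> y = w) ?A"
          using conn[OF z] xA x(2) unfolding list_all_iff by blast
        then show ?thesis
        proof cases
          case 1
          then obtain y where "y \<in> set ?A" "\<not> adj EL x y" "\<not> adj EL y w" unfolding list_ex_iff by blast
          moreover have "y \<notin> T" using \<open>y \<in> set ?A\<close> d(1) by blast
          ultimately show ?thesis using xT nT by (intro disjI1 bexI[of _ y]) (auto simp: relA)
        next
          case 2
          have "T = {}" using T 2(1) by (simp add: tail_ok_def)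
          moreover have "w \<in> set ?A" using *(2,4) by (auto simp: adj_iff)
          ultimately show ?thesis using 2(2) xA eqA unfolding list_all_iff by blast
        qed
      qed
      show "ws b1 m (rel EL T) (set A \<union> T - {v})" using 1 unfolding eqA .
      show "ws b2 (Suc m) (rel EL T) {y \<in> set A \<union> T. y \<noteq> v \<and> \<not> rel EL T v y}"
        using 2 unfolding eqB .
    qed (use * finT in auto)
  next
    case (Iso u z A EL b ls m)
    have *: "u \<in> set A" "cl \<or> inner r u" "nbrs_ok EL A u (\<lambda>y. False)" and b: "b = False"
      using Iso.prems(1) by (auto split: if_splits)
    have nT: "u \<notin> T" using *(1) Iso.prems(2) by auto
    show ?case
      unfolding b
    proof (rule ws_isolated[OF adjR, where u = u])
      show "\<not> rel EL T u y" if "y \<in> set A \<union> T" for y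
        using that inner_rel[OF T *(2) nT] nbrs_okD[OF *(3)] nT by (cases "y \<in> T") (auto simp: relA)
    qed (use * finT in auto)
  next
    case (Leaf k s z A EL b ls m)
    let ?rem = "columns s @ map (shift s) (ks k)"
    have loc: "s \<le> r" "cl \<or> list_all (local r) (map (shift s) (ks k))"
      and *: "\<not> z" "even s" "same_set A (filter (\<lambda>x. x \<notin> set ?rem) (columns r))"
      "same_graph A EL (gedges A)" "b = fl k" "ls = [(k, s)]"
      using Leaf.prems(1) by (auto split: if_splits)
    obtain m' where m': "m = Suc m'" using Leaf.prems(4) *(1) by (auto simp: gr0_conv_Suc)
    have "s \<le> n" and w: "ws b m grid (strip (ks k) (n - s))"
      using Leaf.prems(3)[of k s m'] *(5,6) m' by auto
    have "ws b m grid (strip ?rem n)"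
      using ws_shift[OF w *(2)] \<open>s \<le> n\<close> by simp
    moreover have "strip ?rem n = set A \<union> T"
    proof (rule strip_eq[OF T])
      show "set A = set (columns r) - set ?rem" using *(3) by (auto simp: same_set_def list_all_iff)
      show "cl \<or> list_all (local r) ?rem" using loc by (auto simp: set_columns list_all_iff)
    qed
    ultimately have "ws b m grid (set A \<union> T)" by simp
    then show ?case
    proof (rule ws_cong)
      have "adj EL x y \<longleftrightarrow> grid x y" if "x \<in> set A" "y \<in> set A" for x y
      proof -
        have "adj EL x y \<longleftrightarrow> adj (gedges A) x y"
          using *(4) that unfolding same_graph_def list_all_iff by (auto simp: adj_iff)
        then show ?thesis using adj_gedges[OF that] by simp
      qed
      then show "rel EL T x y \<longleftrightarrow> grid x y" if "x \<in> set A \<union> T" "y \<in> set A \<union> T" for x y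
        using that by (auto simp: rel_def)
    qed
  next
    case (Empty z A EL b ls m)
    have "A = []" "T = {}" "b" "m > 0" using Empty T by (auto simp: tail_ok_def split: if_splits)
    then show ?case using ws_empty[of "m - 1"] by (simp add: ws_mono)
  }
qed

section \<open>The strip graphs\<close>

text \<open>The key graphs are obtained from the strip by removing the vertices \<open>rems k\<close> at its left end, for
  \<open>k < 7\<close>. They and the certificates were found by computer search.\<close>

definition rems :: "nat \<Rightarrow> vertex list" where
  "rems k = [[Vg 1 1, Vg 2 1, Vg 3 1, Vg 2 2, Vg 3 2, Vg 3 3], [Vg 1 1, Vg 2 1, Vg 3 1, Vg 2 2, Vg 3 2], [Vg 1 1, Vg 2 1,
    Vg 3 1, Vg 1 2, Vg 2 3], [Vg 1 1, Vg 2 1, Vg 1 2], [Vg 1 1, Vg 2 1], [Vg 3 1, Vg 2 2], []] ! k"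

text \<open>The property is claimed for all odd lengths, so key 4 is excluded: with one column it is
  a single vertex, hence contractible. In long strips keys 0 and 6 keep a sphere because their
  splittings contain key 1, and key 1 occurs in its own; the open certificate of every family has a
  leaf with key 1 or 6.\<close>

definition nontrivial :: "nat \<Rightarrow> bool" where
  "nontrivial k \<longleftrightarrow> k = 0 \<or> k = 1 \<or> k = 6"

definition front :: "nat \<Rightarrow> nat \<Rightarrow> vertex list" where
  "front k r = filter (\<lambda>x. x \<notin> set (rems k)) (columns r)"

text \<open>The condition on the leaves makes the recursion terminate: a leaf is shorter or, at
  equal length, has a smaller key number. The numbering of the keys respects this; for instance keys
  4 and 5 refer to key 0 at equal length.\<close>

definition key_ok :: "nat \<Rightarrow> nat \<Rightarrow> bool \<Rightarrow> cert \<Rightarrow> bool" where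
  "key_ok k r cl c \<longleftrightarrow> (cl \<or> list_all (local r) (rems k)) \<and>
     (case chk r cl rems nontrivial False (front k r) (gedges (front k r)) c of None \<Rightarrow> False
      | Some (b, ls) \<Rightarrow> (nontrivial k \<longrightarrow> b) \<and>
          list_all (\<lambda>(k', s). k' < 7 \<and> even s \<and> s \<le> r \<and> (s > 0 \<or> k' < k)) ls)"

fun is_grid :: "vertex \<Rightarrow> bool" where
  "is_grid (Vg i j) = True"
| "is_grid _ = False"

definition fam_ok :: "vertex list \<Rightarrow> (vertex \<times> vertex) list \<Rightarrow> nat \<Rightarrow> bool \<Rightarrow> cert \<Rightarrow> bool" where
  "fam_ok X XE r cl c \<longleftrightarrow> list_all (\<lambda>x. \<not> is_grid x) X \<and>
     list_all (\<lambda>(p, q). p \<noteq> q \<and> p \<in> set X \<and> (q \<in> set X \<or> q \<in> set (columns r))) XE \<and>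
     (case chk r cl rems nontrivial True (X @ columns r) (XE @ gedges (columns r)) c of None \<Rightarrow> False
      | Some (b, ls) \<Rightarrow> b \<and> list_all (\<lambda>(k', s). k' < 7 \<and> even s \<and> s \<le> r) ls)"

definition covered :: "(nat \<Rightarrow> bool \<Rightarrow> cert \<Rightarrow> bool) \<Rightarrow> nat \<Rightarrow> bool" where
  "covered P n \<longleftrightarrow> (\<exists>r cl c. P r cl c \<and> (if cl then r = n else r \<le> n))"

text \<open>One open certificate serves all lengths from \<open>r\<close> on. There are
  \<open>r div 2\<close> odd lengths below \<open>r\<close>, each with its own closed
  certificate.\<close>

definition covers :: "(nat \<Rightarrow> bool \<Rightarrow> cert \<Rightarrow> bool) \<Rightarrow> nat \<Rightarrow> cert \<Rightarrow> cert list \<Rightarrow> bool" where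
  "covers P r c cs \<longleftrightarrow> P r False c \<and> length cs = r div 2 \<and>
     list_all (\<lambda>i. P (2 * i + 1) True (cs ! i)) [0..<length cs]"

lemma covers_imp_covered:
  assumes "covers P r c cs" and "odd n"
  shows "covered P n"
proof (cases "n < r")
  case True
  obtain i where i: "n = 2 * i + 1" using \<open>odd n\<close> by (rule oddE)
  then have "i < length cs" using True assms(1) by (auto simp: covers_def)
  then have "P n True (cs ! i)"
    using assms(1) i by (auto simp: covers_def list_all_iff)
  then show ?thesis unfolding covered_def by (metis (full_types))
next
  case False
  then show ?thesis using assms(1) unfolding covers_def covered_def by (metis (full_types) not_less)
qed

text \<open>Write K0(n), ..., K6(n) for the independence complexes of the key graphs with n columns,
  \<Sigma> for suspension and \<or> for wedge. In a certificate every \<open>Split\<close> puts one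
  \<Sigma> on its second branch, and an \<open>Iso\<close> branch is contractible. The open
  certificate thus reads, after at least one suspension and up to homotopy, K0(n) = \<Sigma> K2(n-2)
  \<or> \<Sigma> K1(n-2); the closed ones settle the lengths 1, 3 and 5. The equations below are to
  be read in the same way.\<close>

lemma covers_key_0: "covers (key_ok 0) 6
    (Split (Vg 2 3) (Vg 1 2) (Del (Vg 1 4) (Vg 1 2) (Split (Vg 1 2) (Vg 1 3) (Iso (Vg 1 3)) (Del (Vg 2 5) (Vg 3 4)
    (Leaf 2 2)))) (Leaf 1 2))
    [Empty,
    Split (Vg 1 2) (Vg 1 3) (Split (Vg 1 3) (Vg 2 3) (Iso (Vg 2 3)) Empty) Empty,
    Del (Vg 2 4) (Vg 3 5) (Split (Vg 1 3) (Vg 1 2) (Del (Vg 3 4) (Vg 1 2) (Split (Vg 1 2) (Vg 2 3) (Iso (Vg 2 3))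
    (Leaf 1 2))) (Del (Vg 2 5) (Vg 3 4) (Iso (Vg 1 5))))]"
  by code_simp

text \<open>K1(n) = \<Sigma> K3(n-2) \<or> \<Sigma> K1(n-2).\<close>

lemma covers_key_1: "covers (key_ok 1) 5
    (Split (Vg 2 3) (Vg 1 2) (Del (Vg 1 4) (Vg 1 2) (Split (Vg 1 2) (Vg 1 3) (Iso (Vg 1 3)) (Leaf 3 2))) (Leaf 1 2))
    [Empty,
    Del (Vg 1 2) (Vg 3 3) (Leaf 6 2)]"
  by code_simp

text \<open>K2(n) = \<Sigma> K3(n-2) \<or> \<Sigma>^3 K1(n-4). The new vertices \<open>Vc 2\<close>
  and \<open>Vc 3\<close> enter as twins of \<open>Vg 3 2\<close> and \<open>Vg 3 4\<close>; a twin
  is a witness for toggling an edge at the vertex it doubles. In the deletion of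
  \<open>Vg 1 4\<close> they are removed as dominated vertices, and in its link an
  \<open>Add\<close> followed by a \<open>Del\<close> renames them back.\<close>

lemma covers_key_2: "covers (key_ok 2) 6
    (Toggle (Vg 1 4) (Vg 3 3) (Vg 2 2) (Toggle (Vg 1 4) (Vg 2 6) (Vg 3 4) (Toggle (Vg 1 4) (Vg 3 6) (Vg 3 4) (Add
    (Vc 2) [Vg 2 2, Vg 3 3] (Vg 3 2) (Toggle (Vg 1 4) (Vg 3 2) (Vc 2) (Toggle (Vc 2) (Vg 3 3) (Vg 1 3) (Add (Vc 3)
    [Vg 2 4, Vg 3 3, Vg 3 5] (Vg 3 4) (Toggle (Vg 1 4) (Vg 3 4) (Vc 3) (Toggle (Vc 3) (Vg 1 5) (Vg 3 4) (Toggle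
    (Vc 3) (Vg 2 6) (Vg 3 4) (Toggle (Vc 3) (Vg 3 6) (Vg 3 4) (Toggle (Vc 3) (Vg 3 3) (Vg 2 5) (Split (Vg 1 4)
    (Vg 3 3) (Del (Vc 3) (Vg 2 5) (Del (Vc 2) (Vg 1 3) (Del (Vg 3 2) (Vg 1 3) (Split (Vg 1 3) (Vg 2 2) (Iso
    (Vg 2 2)) (Leaf 3 2))))) (Add (Vg 3 4) [Vg 3 5] (Vc 3) (Del (Vc 3) (Vg 3 4) (Add (Vg 3 2) [Vg 2 2] (Vc 2) (Del
    (Vc 2) (Vg 3 2) (Split (Vg 2 2) (Vg 3 2) (Iso (Vg 3 2)) (Split (Vg 3 4) (Vg 3 5) (Iso (Vg 3 5))
    (Leaf 1 4))))))))))))))))))))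
    [Empty,
    Del (Vg 2 2) (Vg 3 3) (Iso (Vg 1 3)),
    Del (Vg 2 4) (Vg 3 5) (Toggle (Vg 3 2) (Vg 2 5) (Vg 1 3) (Toggle (Vg 3 2) (Vg 1 3) (Vg 1 5) (Split (Vg 3 2)
    (Vg 2 2) (Del (Vg 1 4) (Vg 2 2) (Split (Vg 1 3) (Vg 2 2) (Iso (Vg 2 2)) (Del (Vg 3 5) (Vg 1 5) (Split (Vg 1 5)
    (Vg 2 5) (Iso (Vg 2 5)) (Split (Vg 3 3) (Vg 3 4) (Iso (Vg 3 4)) Empty))))) (Split (Vg 1 4) (Vg 1 5) (Iso
    (Vg 1 5)) (Split (Vg 3 4) (Vg 3 5) (Iso (Vg 3 5)) Empty)))))]"
  by code_simp

text \<open>K3(n) = \<Sigma> K5(n-2) \<or> \<Sigma> K4(n-2).\<close>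

lemma covers_key_3: "covers (key_ok 3) 5
    (Split (Vg 2 2) (Vg 3 1) (Del (Vg 3 3) (Vg 3 1) (Split (Vg 3 1) (Vg 3 2) (Iso (Vg 3 2)) (Del (Vg 2 4) (Vg 1 3)
    (Leaf 5 2)))) (Leaf 4 2))
    [Iso (Vg 3 1),
    Del (Vg 2 2) (Vg 3 3) (Del (Vg 3 3) (Vg 1 3) (Split (Vg 1 3) (Vg 2 3) (Iso (Vg 2 3)) (Split (Vg 3 1) (Vg 3 2)
    (Iso (Vg 3 2)) Empty)))]"
  by code_simp

text \<open>K4(n) = \<Sigma> K0(n) \<or> \<Sigma> K4(n-2); the first summand is not shorter, but its
  key number is smaller.\<close>

lemma covers_key_4: "covers (key_ok 4) 4
    (Split (Vg 2 2) (Vg 1 2) (Del (Vg 3 3) (Vg 3 1) (Split (Vg 3 1) (Vg 3 2) (Iso (Vg 3 2)) (Leaf 0 0))) (Leaf 4 2))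
    [Iso (Vg 3 1),
    Del (Vg 2 2) (Vg 3 3) (Del (Vg 3 3) (Vg 3 1) (Split (Vg 3 1) (Vg 3 2) (Iso (Vg 3 2)) (Leaf 0 0)))]"
  by code_simp

text \<open>K5(n) = \<Sigma> K0(n) \<or> \<Sigma>^3 K4(n-4), with twins \<open>Vc 2\<close> of
  \<open>Vg 1 3\<close> and \<open>Vc 3\<close> of \<open>Vg 2 1\<close>.\<close>

lemma covers_key_5: "covers (key_ok 5) 5
    (Toggle (Vg 3 3) (Vg 1 2) (Vg 2 1) (Toggle (Vg 3 3) (Vg 1 5) (Vg 1 3) (Toggle (Vg 3 3) (Vg 2 5) (Vg 1 3) (Add
    (Vc 2) [Vg 1 2, Vg 1 4, Vg 2 3] (Vg 1 3) (Toggle (Vg 3 3) (Vg 1 3) (Vc 2) (Toggle (Vc 2) (Vg 1 5) (Vg 1 3)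
    (Toggle (Vc 2) (Vg 2 5) (Vg 1 3) (Toggle (Vc 2) (Vg 3 4) (Vg 1 3) (Toggle (Vc 2) (Vg 1 2) (Vg 2 4) (Add (Vc 3)
    [Vg 1 1, Vg 3 2] (Vg 2 1) (Toggle (Vg 3 3) (Vg 2 1) (Vc 3) (Toggle (Vc 3) (Vg 1 3) (Vg 2 1) (Toggle (Vc 3)
    (Vg 2 3) (Vg 2 1) (Toggle (Vc 3) (Vg 3 2) (Vg 1 2) (Split (Vg 3 3) (Vg 3 2) (Del (Vc 3) (Vg 1 2) (Del (Vc 2)
    (Vg 2 4) (Del (Vg 1 1) (Vg 3 2) (Split (Vg 2 1) (Vg 3 2) (Iso (Vg 3 2)) (Leaf 0 0))))) (Add (Vg 2 1) [Vg 1 1]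
    (Vc 3) (Del (Vc 3) (Vg 2 1) (Add (Vg 1 3) [Vg 1 4] (Vc 2) (Del (Vc 2) (Vg 1 3) (Split (Vg 1 1) (Vg 2 1) (Iso
    (Vg 2 1)) (Split (Vg 1 3) (Vg 1 4) (Iso (Vg 1 4)) (Leaf 4 4))))))))))))))))))))))
    [Split (Vg 1 1) (Vg 2 1) (Iso (Vg 2 1)) Empty,
    Toggle (Vg 1 1) (Vg 3 3) (Vg 1 3) (Del (Vg 1 1) (Vg 3 2) (Del (Vg 3 3) (Vg 2 1) (Split (Vg 2 1) (Vg 3 2) (Iso
    (Vg 3 2)) (Leaf 0 0))))]"
  by code_simp

text \<open>K6(n) = \<Sigma>^4 K6(n-6) \<or> \<Sigma>^3 K4(n-4) \<or> \<Sigma> K1(n).\<close>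

lemma covers_key_6: "covers (key_ok 6) 7
    (Split (Vg 2 1) (Vg 3 1) (Del (Vg 2 2) (Vg 1 1) (Del (Vg 1 3) (Vg 1 1) (Del (Vg 2 3) (Vg 1 1) (Split (Vg 1 1)
    (Vg 1 2) (Iso (Vg 1 2)) (Del (Vg 3 3) (Vg 3 1) (Split (Vg 3 1) (Vg 3 2) (Iso (Vg 3 2)) (Split (Vg 2 4) (Vg 1 4)
    (Del (Vg 2 5) (Vg 3 4) (Del (Vg 1 6) (Vg 1 4) (Split (Vg 1 4) (Vg 1 5) (Iso (Vg 1 5)) (Del (Vg 2 6) (Vg 3 4)
    (Del (Vg 3 6) (Vg 3 4) (Split (Vg 3 4) (Vg 3 5) (Iso (Vg 3 5)) (Leaf 6 6))))))) (Leaf 4 4)))))))) (Leaf 1 0))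
    [Del (Vg 1 1) (Vg 3 1) (Split (Vg 2 1) (Vg 3 1) (Iso (Vg 3 1)) Empty),
    Toggle (Vg 3 1) (Vg 2 3) (Vg 1 1) (Del (Vg 3 1) (Vg 3 3) (Toggle (Vg 1 1) (Vg 2 3) (Vg 3 2) (Toggle (Vg 1 1)
    (Vg 3 2) (Vg 1 3) (Del (Vg 1 1) (Vg 3 3) (Del (Vg 2 2) (Vg 3 3) (Del (Vg 3 3) (Vg 2 1) (Split (Vg 2 1) (Vg 3 2)
    (Iso (Vg 3 2)) (Leaf 0 0)))))))),
    Del (Vg 2 2) (Vg 1 1) (Del (Vg 2 4) (Vg 3 5) (Split (Vg 2 1) (Vg 3 1) (Del (Vg 1 3) (Vg 1 1) (Del (Vg 2 3)
    (Vg 1 1) (Split (Vg 1 1) (Vg 1 2) (Iso (Vg 1 2)) (Del (Vg 3 3) (Vg 3 1) (Split (Vg 3 1) (Vg 3 2) (Iso (Vg 3 2))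
    (Del (Vg 2 5) (Vg 3 4) (Split (Vg 1 4) (Vg 1 5) (Iso (Vg 1 5)) (Split (Vg 3 4) (Vg 3 5) (Iso (Vg 3 5))
    Empty)))))))) (Split (Vg 1 3) (Vg 1 2) (Del (Vg 3 3) (Vg 1 2) (Del (Vg 3 4) (Vg 1 2) (Split (Vg 1 2) (Vg 2 3)
    (Iso (Vg 2 3)) (Leaf 1 2)))) (Del (Vg 3 5) (Vg 1 5) (Split (Vg 1 5) (Vg 2 5) (Iso (Vg 2 5)) (Split (Vg 3 3)
    (Vg 3 4) (Iso (Vg 3 4)) Empty))))))]"
  by code_simp

text \<open>The certificates are those of key 6, the strip itself, but now for the complex without
  suspension: the unsuspended splits also pass the connectivity condition of
  \<open>ws_split\<close>, and the leaves all lie in suspended links.\<close>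

lemma covers_Gamma4: "covers (fam_ok []
    []) 7
    (Split (Vg 2 1) (Vg 3 1) (Del (Vg 2 2) (Vg 1 1) (Del (Vg 1 3) (Vg 1 1) (Del (Vg 2 3) (Vg 1 1) (Split (Vg 1 1)
    (Vg 1 2) (Iso (Vg 1 2)) (Del (Vg 3 3) (Vg 3 1) (Split (Vg 3 1) (Vg 3 2) (Iso (Vg 3 2)) (Split (Vg 2 4) (Vg 1 4)
    (Del (Vg 2 5) (Vg 3 4) (Del (Vg 1 6) (Vg 1 4) (Split (Vg 1 4) (Vg 1 5) (Iso (Vg 1 5)) (Del (Vg 2 6) (Vg 3 4)
    (Del (Vg 3 6) (Vg 3 4) (Split (Vg 3 4) (Vg 3 5) (Iso (Vg 3 5)) (Leaf 6 6))))))) (Leaf 4 4)))))))) (Leaf 1 0))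
    [Del (Vg 1 1) (Vg 3 1) (Split (Vg 2 1) (Vg 3 1) (Iso (Vg 3 1)) Empty),
    Toggle (Vg 3 1) (Vg 2 3) (Vg 1 1) (Del (Vg 3 1) (Vg 3 3) (Toggle (Vg 1 1) (Vg 2 3) (Vg 3 2) (Toggle (Vg 1 1)
    (Vg 3 2) (Vg 1 3) (Del (Vg 1 1) (Vg 3 3) (Del (Vg 2 2) (Vg 3 3) (Del (Vg 3 3) (Vg 2 1) (Split (Vg 2 1) (Vg 3 2)
    (Iso (Vg 3 2)) (Leaf 0 0)))))))),
    Del (Vg 2 2) (Vg 1 1) (Del (Vg 2 4) (Vg 3 5) (Split (Vg 2 1) (Vg 3 1) (Del (Vg 1 3) (Vg 1 1) (Del (Vg 2 3)
    (Vg 1 1) (Split (Vg 1 1) (Vg 1 2) (Iso (Vg 1 2)) (Del (Vg 3 3) (Vg 3 1) (Split (Vg 3 1) (Vg 3 2) (Iso (Vg 3 2))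
    (Del (Vg 2 5) (Vg 3 4) (Split (Vg 1 4) (Vg 1 5) (Iso (Vg 1 5)) (Split (Vg 3 4) (Vg 3 5) (Iso (Vg 3 5))
    Empty)))))))) (Split (Vg 1 3) (Vg 1 2) (Del (Vg 3 3) (Vg 1 2) (Del (Vg 3 4) (Vg 1 2) (Split (Vg 1 2) (Vg 2 3)
    (Iso (Vg 2 3)) (Leaf 1 2)))) (Del (Vg 3 5) (Vg 1 5) (Split (Vg 1 5) (Vg 2 5) (Iso (Vg 2 5)) (Split (Vg 3 3)
    (Vg 3 4) (Iso (Vg 3 4)) Empty))))))]"
  by code_simp

text \<open>With N columns, the open certificate splits the complex as \<Sigma>^2 K6(N-2) \<or>
  \<Sigma> K4(N).\<close>

lemma covers_Lambda4: "covers (fam_ok [Vg' 1, Vg' 2, Vg' 3]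
    [(Vg' 1, Vg' 2), (Vg' 1, Vg 1 1), (Vg' 1, Vg 2 1), (Vg' 2, Vg' 3), (Vg' 2, Vg 2 1), (Vg' 2, Vg 1 1), (Vg' 3, Vg 3 1)]) 4
    (Del (Vg 2 1) (Vg' 3) (Split (Vg' 2) (Vg' 1) (Del (Vg 1 2) (Vg' 1) (Split (Vg 1 1) (Vg' 1) (Iso (Vg' 1)) (Del
    (Vg 2 2) (Vg' 3) (Del (Vg 3 2) (Vg' 3) (Split (Vg 3 1) (Vg' 3) (Iso (Vg' 3)) (Leaf 6 2)))))) (Leaf 4 0)))
    [Del (Vg' 2) (Vg 3 1) (Del (Vg 2 1) (Vg' 3) (Split (Vg 1 1) (Vg' 1) (Iso (Vg' 1)) (Split (Vg 3 1) (Vg' 3) (Iso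
    (Vg' 3)) Empty))),
    Del (Vg 2 1) (Vg' 3) (Toggle (Vg' 3) (Vg 2 3) (Vg 3 2) (Toggle (Vg' 3) (Vg 2 2) (Vg 3 3) (Toggle (Vg' 3)
    (Vg 1 1) (Vg 1 3) (Del (Vg' 3) (Vg' 1) (Del (Vg 2 2) (Vg 3 3) (Del (Vg 3 3) (Vg 3 1) (Split (Vg 3 1) (Vg 3 2)
    (Iso (Vg 3 2)) (Split (Vg' 1) (Vg' 2) (Del (Vg 1 2) (Vg' 2) (Split (Vg 1 1) (Vg' 2) (Iso (Vg' 2)) (Split
    (Vg 1 3) (Vg 2 3) (Iso (Vg 2 3)) Empty))) (Leaf 0 0)))))))))]"
  by code_simp

text \<open>Splits as \<Sigma> K1(N) \<or> \<Sigma> K3(N).\<close>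

lemma covers_A4: "covers (fam_ok [Va 1]
    [(Va 1, Vg 1 1), (Va 1, Vg 2 1)]) 4
    (Split (Vg 1 1) (Va 1) (Del (Vg 3 1) (Va 1) (Del (Vg 2 2) (Va 1) (Del (Vg 3 2) (Va 1) (Split (Vg 2 1) (Va 1) (Iso
    (Va 1)) (Leaf 1 0))))) (Leaf 3 0))
    [Del (Va 1) (Vg 3 1) (Del (Vg 1 1) (Vg 3 1) (Split (Vg 2 1) (Vg 3 1) (Iso (Vg 3 1)) Empty)),
    Del (Vg 2 2) (Vg 3 3) (Split (Vg 1 1) (Va 1) (Del (Vg 3 1) (Va 1) (Del (Vg 3 2) (Va 1) (Split (Vg 2 1) (Va 1)
    (Iso (Va 1)) (Leaf 1 0)))) (Del (Vg 3 3) (Vg 1 3) (Split (Vg 1 3) (Vg 2 3) (Iso (Vg 2 3)) (Split (Vg 3 1)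
    (Vg 3 2) (Iso (Vg 3 2)) Empty))))]"
  by code_simp

text \<open>Splits as \<Sigma>^2 K1(N) \<or> \<Sigma>^2 K2(N) \<or> \<Sigma> K4(N).\<close>

lemma covers_B4: "covers (fam_ok [Vb 1, Vb 2, Vb 3, Vb 4]
    [(Vb 1, Vb 3), (Vb 1, Vb 4), (Vb 2, Vb 3), (Vb 3, Vb 4), (Vb 2, Vg 1 1), (Vb 2, Vg 2 1), (Vb 3, Vg 1 1), (Vb 3, Vg 2 1), (Vb 4, Vg 3 1)]) 4
    (Split (Vb 3) (Vb 1) (Del (Vg 3 1) (Vb 1) (Split (Vb 1) (Vb 4) (Iso (Vb 4)) (Split (Vg 1 1) (Vb 2) (Del (Vg 2 2)
    (Vb 2) (Del (Vg 3 2) (Vb 2) (Split (Vg 2 1) (Vb 2) (Iso (Vb 2)) (Leaf 1 0)))) (Del (Vg 2 3) (Vg 3 2)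
    (Leaf 2 0))))) (Leaf 4 0))
    [Del (Vb 3) (Vg 3 1) (Del (Vg 3 1) (Vb 1) (Split (Vb 1) (Vb 4) (Iso (Vb 4)) (Split (Vb 2) (Vg 1 1) (Split
    (Vg 1 1) (Vg 2 1) (Iso (Vg 2 1)) Empty) Empty))),
    Del (Vg 2 2) (Vg 3 3) (Split (Vb 3) (Vb 1) (Del (Vg 3 1) (Vb 1) (Split (Vb 1) (Vb 4) (Iso (Vb 4)) (Split
    (Vg 1 1) (Vb 2) (Del (Vg 3 2) (Vb 2) (Split (Vg 2 1) (Vb 2) (Iso (Vb 2)) (Leaf 1 0))) (Del (Vg 2 3) (Vg 3 2)
    (Iso (Vg 1 3)))))) (Del (Vg 3 3) (Vg 3 1) (Split (Vg 3 1) (Vg 3 2) (Iso (Vg 3 2)) (Leaf 0 0))))]"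
  by code_simp

text \<open>Splits as \<Sigma> K2(N) \<or> \<Sigma>^2 K4(N-2) \<or> \<Sigma> K1(N). Here
  \<open>Vc 1\<close> belongs to the family, while \<open>Vc 2\<close> is an auxiliary twin of
  \<open>Vg 1 1\<close>.\<close>

lemma covers_C4: "covers (fam_ok [Vc 1]
    [(Vc 1, Vg 1 1), (Vc 1, Vg 2 1), (Vc 1, Vg 3 1)]) 4
    (Split (Vg 2 1) (Vg 3 1) (Toggle (Vg 2 3) (Vg 3 1) (Vg 1 1) (Del (Vg 2 3) (Vg 3 2) (Toggle (Vg 3 1) (Vg 1 3)
    (Vg 1 1) (Add (Vc 2) [Vg 1 2, Vc 1] (Vg 1 1) (Toggle (Vg 3 1) (Vg 1 1) (Vc 2) (Toggle (Vc 2) (Vg 1 3) (Vg 1 1)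
    (Toggle (Vc 2) (Vg 3 2) (Vg 1 1) (Toggle (Vc 2) (Vc 1) (Vg 2 2) (Split (Vg 3 1) (Vc 1) (Del (Vc 2) (Vg 2 2) (Del
    (Vg 1 2) (Vc 1) (Split (Vg 1 1) (Vc 1) (Iso (Vc 1)) (Leaf 2 0)))) (Add (Vg 1 1) [Vg 1 2] (Vc 2) (Del (Vc 2)
    (Vg 1 1) (Split (Vg 1 1) (Vg 1 2) (Iso (Vg 1 2)) (Leaf 4 2))))))))))))) (Leaf 1 0))
    [Del (Vg 1 1) (Vg 3 1) (Split (Vc 1) (Vg 2 1) (Split (Vg 2 1) (Vg 3 1) (Iso (Vg 3 1)) Empty) Empty),
    Toggle (Vg 3 1) (Vg 2 3) (Vg 1 1) (Del (Vg 3 1) (Vg 3 3) (Del (Vg 2 2) (Vg 3 3) (Split (Vg 1 1) (Vc 1) (Del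
    (Vg 3 2) (Vc 1) (Split (Vg 2 1) (Vc 1) (Iso (Vc 1)) (Leaf 1 0))) (Del (Vg 2 3) (Vg 3 2) (Iso (Vg 1 3))))))]"
  by code_simp

text \<open>Splits as \<Sigma> K5(N) \<or> \<Sigma>^2 K1(N) \<or> \<Sigma> K4(N), with an auxiliary
  twin \<open>Vc 2\<close> of \<open>Vd 4\<close>.\<close>

lemma covers_D4: "covers (fam_ok [Vd 1, Vd 2, Vd 3, Vd 4]
    [(Vd 1, Vd 2), (Vd 1, Vd 3), (Vd 1, Vd 4), (Vd 2, Vd 3), (Vd 3, Vd 4), (Vd 2, Vg 1 1), (Vd 2, Vg 2 1), (Vd 3, Vg 1 1), (Vd 3, Vg 2 1), (Vd 4, Vg 3 1)]) 4
    (Split (Vd 3) (Vd 1) (Toggle (Vg 2 2) (Vd 1) (Vg 1 1) (Del (Vg 2 2) (Vd 4) (Toggle (Vd 2) (Vg 3 2) (Vd 4) (Add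
    (Vc 2) [Vg 3 1, Vd 1] (Vd 4) (Toggle (Vd 2) (Vd 4) (Vc 2) (Toggle (Vc 2) (Vg 1 1) (Vd 4) (Toggle (Vc 2) (Vg 3 2)
    (Vd 4) (Toggle (Vc 2) (Vd 1) (Vg 2 1) (Split (Vd 2) (Vd 1) (Del (Vc 2) (Vg 2 1) (Del (Vg 3 1) (Vd 1) (Split
    (Vd 1) (Vd 4) (Iso (Vd 4)) (Leaf 5 0)))) (Add (Vd 4) [Vg 3 1] (Vc 2) (Del (Vc 2) (Vd 4) (Split (Vg 3 1) (Vd 4)
    (Iso (Vd 4)) (Leaf 1 0))))))))))))) (Leaf 4 0))
    [Del (Vd 3) (Vg 3 1) (Toggle (Vd 1) (Vg 3 1) (Vg 1 1) (Split (Vd 1) (Vd 4) (Del (Vg 2 1) (Vd 4) (Split (Vg 1 1)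
    (Vd 2) (Iso (Vd 2)) (Split (Vg 3 1) (Vd 4) (Iso (Vd 4)) Empty))) (Split (Vg 1 1) (Vg 2 1) (Iso (Vg 2 1))
    Empty))),
    Toggle (Vg 1 1) (Vg 2 2) (Vg 3 3) (Toggle (Vg 1 1) (Vg 3 3) (Vg 1 3) (Toggle (Vg 1 1) (Vd 4) (Vg 3 2) (Del
    (Vg 1 1) (Vd 1) (Del (Vg 2 2) (Vg 3 3) (Split (Vd 3) (Vd 1) (Toggle (Vg 2 1) (Vg 1 2) (Vg 3 3) (Toggle (Vg 2 1)
    (Vg 3 3) (Vg 1 3) (Split (Vg 2 1) (Vg 3 2) (Del (Vd 4) (Vd 2) (Split (Vd 1) (Vd 2) (Iso (Vd 2)) (Del (Vg 3 3)
    (Vg 3 1) (Split (Vg 3 1) (Vg 3 2) (Iso (Vg 3 2)) (Leaf 0 0))))) (Split (Vg 1 3) (Vg 2 3) (Iso (Vg 2 3)) (Split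
    (Vd 1) (Vd 4) (Iso (Vd 4)) Empty))))) (Del (Vg 3 3) (Vg 3 1) (Split (Vg 3 1) (Vg 3 2) (Iso (Vg 3 2))
    (Leaf 0 0))))))))]"
  by code_simp

lemma ws_keys:
  assumes "odd n" and "k < 7"
  shows "ws (nontrivial k) (Suc m) grid (strip (rems k) n)"
  using assms
\<comment> \<open>There are 7 keys. A nonzero even shift lowers the first term by at least 14, while
  \<open>k\<close> grows by at most 6; without a shift \<open>k\<close> drops.\<close>
proof (induction "7 * n + k" arbitrary: n k m rule: less_induct)
  case less
  have "k \<in> {0, 1, 2, 3, 4, 5, 6}" using less.prems(2) by auto
  then have "covered (key_ok k) n"
    using covers_key_0 covers_key_1 covers_key_2 covers_key_3 covers_key_4 covers_key_5 covers_key_6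
    by (auto intro: covers_imp_covered[OF _ less.prems(1)])
  then obtain r cl c where ok: "key_ok k r cl c" and rn: "if cl then r = n else r \<le> n"
    unfolding covered_def by blast
  let ?A = "front k r"
  obtain b ls where chk: "chk r cl rems nontrivial False ?A (gedges ?A) c = Some (b, ls)"
    using ok by (auto simp: key_ok_def split: option.splits)
  have b: "nontrivial k \<Longrightarrow> b"
    and ls: "\<And>k' s. (k', s) \<in> set ls \<Longrightarrow> k' < 7 \<and> even s \<and> s \<le> r \<and> (s > 0 \<or> k' < k)"
    and loc: "cl \<or> list_all (local r) (rems k)"
    using ok by (auto simp: key_ok_def chk list_all_iff)
  define T where "T = (if cl then {} else tail r n)"
  have T: "tail_ok r cl n T" using rn by (auto simp: tail_ok_def T_def)
  have A: "set ?A = set (columns r) - set (rems k)" by (auto simp: front_def)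
  have AT: "set ?A \<inter> T = {}" using columns_tail[OF T] A by blast
  have "ws b (Suc m) (rel (gedges ?A) T) (set ?A \<union> T)"
  proof (rule chk_sound[OF chk T AT])
    fix k' s m assume *: "(k', s) \<in> set ls"
    note l = ls[OF *]
    have "s \<le> n" using l rn by (auto split: if_splits)
    \<comment> \<open>\<open>n\<close> is odd and \<open>s\<close> is even, so at least one column
      remains.\<close>
    moreover have "s \<noteq> n" using l less.prems(1) by auto
    ultimately have s: "s < n" by simp
    have "ws (nontrivial k') (Suc m) grid (strip (rems k') (n - s))"
    proof (rule less.hyps)
      show "7 * (n - s) + k' < 7 * n + k"
      proof (cases "s = 0")
        case True then show ?thesis using l by simp
      next
        case False
        then have "s \<ge> 2" using l by presburger
        then have "7 * (n - s) + 14 \<le> 7 * n" using s by linarith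
        then show ?thesis using l by linarith
      qed
      show "odd (n - s)" using l s less.prems(1) by simp
    qed (use l in simp)
    then show "s \<le> n \<and> ws (nontrivial k') (Suc m) grid (strip (rems k') (n - s))" using s by simp
  qed simp
  then have "ws b (Suc m) grid (set ?A \<union> T)"
  proof (rule ws_cong)
    show "grid x y \<longleftrightarrow> rel (gedges ?A) T x y" if "x \<in> set ?A \<union> T" "y \<in> set ?A \<union> T" for x y
      using that adj_gedges[of x ?A y] by (auto simp: rel_def)
  qed
  then have "ws b (Suc m) grid (strip (rems k) n)"
    using strip_eq[OF T A loc] by simp
  then show ?case using b by (rule ws_mono)
qed

section \<open>From the grid back to the graphs of the statement\<close>

lemma Gamma4_edges:
  assumes "u \<in> fst (Gamma4 n)" "v \<in> fst (Gamma4 n)"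
  shows "{u, v} \<in> snd (Gamma4 n) \<longleftrightarrow> grid u v"
proof -
  obtain i j k l where uv: "u = Vg i j" "v = Vg k l"
    and ij: "i \<in> {1..3}" "j \<in> {1..2 * n + 1}" "k \<in> {1..3}" "l \<in> {1..2 * n + 1}"
    using assms by (auto simp: Gamma4_def)
  show ?thesis
  proof
    assume "{u, v} \<in> snd (Gamma4 n)"
    then consider (1) i j where "{u, v} = {Vg i j, Vg (i + 1) j}" | (2) i j where "{u, v} = {Vg i j, Vg i (j + 1)}"
      | (3) i j where "{u, v} = {Vg i j, Vg (i + 1) (j + 1)}" "(i + j) mod 2 = 1"
      | (4) i j where "{u, v} = {Vg i (j + 1), Vg (i + 1) j}" "(i + j) mod 2 = 1"
      unfolding Gamma4_def snd_conv by blast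
    then obtain a b where ab: "{u, v} = {a, b}" "b \<in> set (fwd a)"
    proof cases
      \<comment> \<open>An antidiagonal is listed by \<open>fwd\<close> at its end in the earlier
        column, which is the second vertex of the pair.\<close>
      case (4 i j)
      then have "(i + 1 + j) mod 2 = 0" by presburger
      then show thesis using 4 by (intro that[of "Vg (i + 1) j" "Vg i (j + 1)"]) (auto simp: insert_commute)
    qed (use that in \<open>fastforce+\<close>)
    then show "grid u v" by (auto simp: grid_def doubleton_eq_iff simp del: fwd.simps)
  next
    have fwd: "{Vg i j, Vg k l} \<in> snd (Gamma4 n)"
      if kl: "Vg k l \<in> set (fwd (Vg i j))" "i \<in> {1..3}" "j \<in> {1..2 * n + 1}" "k \<in> {1..3}" "l \<in> {1..2 * n + 1}" for i j k l
    proof -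
      have "k = i + 1 \<and> l = j \<or> k = i \<and> l = j + 1 \<or> k = i + 1 \<and> l = j + 1 \<and> (i + j) mod 2 = 1
          \<or> k = i - 1 \<and> l = j + 1 \<and> (i + j) mod 2 = 0"
        using kl(1) by (auto split: if_splits)
      then consider "k = i + 1" "l = j" | "k = i" "l = j + 1" | "k = i + 1" "l = j + 1" "(i + j) mod 2 = 1"
        | "i = k + 1" "l = j + 1" "(k + j) mod 2 = 1"
      proof (elim disjE conjE)
        assume "k = i - 1" "l = j + 1" "(i + j) mod 2 = 0"
        moreover have "i \<ge> 1" using kl(2) by simp
        ultimately have "i = k + 1" "(k + j) mod 2 = 1" by presburger+
        then show thesis using \<open>l = j + 1\<close> that by blast
      qed (use that in blast)+
      then show ?thesis
      proof cases
        case 1 then show ?thesis using kl by (fastforce simp: Gamma4_def)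
      next
        case 2 then show ?thesis using kl by (fastforce simp: Gamma4_def)
      next
        case 3 then show ?thesis using kl by (fastforce simp: Gamma4_def)
      next
        case 4
        then have "{Vg k (j + 1), Vg (k + 1) j} \<in> snd (Gamma4 n)" using kl by (fastforce simp: Gamma4_def)
        then show ?thesis using 4 by (simp add: insert_commute)
      qed
    qed
    assume "grid u v"
    then show "{u, v} \<in> snd (Gamma4 n)"
      using fwd[of k l i j] fwd[of i j k l] ij by (auto simp: grid_def uv insert_commute simp del: fwd.simps)
  qed
qed

lemma Gamma4_vertices: "fst (Gamma4 n) = set (columns (2 * n + 1))"
  by (simp add: Gamma4_def set_columns)

text \<open>\<open>chk_sound\<close> is applied with \<open>m = 0\<close>; every leaf comes with at
  least one suspension, as \<open>ws_keys\<close> provides. What remains is to recognise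
  \<open>Ind G\<close> as the complex of the explicit front, new vertices included, together with
  the tail.\<close>

lemma family_wedge:
  assumes covers: "covers (fam_ok X XE) r0 c0 cs"
    and G: "G = extend_graph (Gamma4 n) (set X) ((\<lambda>(p, q). {p, q}) ` set XE)"
  shows "\<exists>ds. ds \<noteq> [] \<and> geometric_realization (Ind G) homotopy_equivalent_space wedge_of_spheres ds"
proof -
  let ?n = "2 * n + 1"
  have "covered (fam_ok X XE) ?n" by (rule covers_imp_covered[OF covers]) simp
  then obtain r cl c where ok: "fam_ok X XE r cl c" and rn: "if cl then r = ?n else r \<le> ?n"
    unfolding covered_def by blast
  let ?A = "X @ columns r" and ?EL = "XE @ gedges (columns r)"
  obtain ls where chk: "chk r cl rems nontrivial True ?A ?EL c = Some (True, ls)"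
    using ok by (auto simp: fam_ok_def split: option.splits)
  have ls: "\<And>k s. (k, s) \<in> set ls \<Longrightarrow> k < 7 \<and> even s \<and> s \<le> r"
    and X: "\<And>x. x \<in> set X \<Longrightarrow> \<not> is_grid x"
    and XE: "\<And>p q. (p, q) \<in> set XE \<Longrightarrow> p \<noteq> q \<and> p \<in> set X \<and> (q \<in> set X \<or> q \<in> set (columns r))"
    using ok by (auto simp: fam_ok_def chk list_all_iff)
  define T where "T = (if cl then {} else tail r ?n)"
  have T: "tail_ok r cl ?n T" using rn by (auto simp: tail_ok_def T_def)
  have gridT: "is_grid x" if "x \<in> T" for x
    using that by (auto simp: T_def tail_def split: if_splits)
  have gridC: "is_grid x" if "x \<in> set (columns m)" for x m
    using that by (auto simp: set_columns)
  have AT: "set ?A \<inter> T = {}" using columns_tail[OF T] X gridT by auto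
  have "ws True 0 (rel ?EL T) (set ?A \<union> T)"
  proof (rule chk_sound[OF chk T AT])
    fix k s m assume "(k, s) \<in> set ls"
    note l = ls[OF this]
    have "s \<le> ?n" using l rn by (auto split: if_splits)
    moreover have "odd (?n - s)" using l \<open>s \<le> ?n\<close> by simp
    ultimately show "s \<le> ?n \<and> ws (nontrivial k) (Suc m) grid (strip (rems k) (?n - s))"
      using ws_keys l by blast
  qed simp
  moreover have "Ind G = indc (rel ?EL T) (set ?A \<union> T)"
  proof -
    have cols: "set (columns ?n) = set (columns r) \<union> T"
      using strip_eq[OF T, of "columns r" "[]"] by (simp add: strip_def set_columns)
    have V: "fst G = set ?A \<union> T"
      using cols by (auto simp: G extend_graph_def Gamma4_vertices)
    have E: "{u, v} \<in> snd G \<longleftrightarrow> rel ?EL T u v" if uvG: "u \<in> fst G" "v \<in> fst G" for u v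
    proof -
      have ext: "{u, v} \<in> (\<lambda>(p, q). {p, q}) ` set XE \<longleftrightarrow> (u, v) \<in> set XE \<or> (v, u) \<in> set XE"
        by (auto simp: doubleton_eq_iff)
      have Gam: "{u, v} \<in> snd (Gamma4 n) \<longleftrightarrow> u \<notin> set X \<and> v \<notin> set X \<and> grid u v"
      proof (cases "u \<in> set X \<or> v \<in> set X")
        case True
        have "e \<subseteq> fst (Gamma4 n)" if "e \<in> snd (Gamma4 n)" for e
          using simple_graphs_4(1)[of "Gamma4 n" n] that by (auto simp: simple_graph_def)
        then show ?thesis using True X gridC unfolding Gamma4_vertices by blast
      next
        case False
        then have "u \<in> fst (Gamma4 n)" "v \<in> fst (Gamma4 n)"
          using uvG by (auto simp: G extend_graph_def)
        then show ?thesis using Gamma4_edges False by blast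
      qed
      have nograd: "\<not> grid x y" if "\<not> is_grid x \<or> \<not> is_grid y" for x y
        using that by (cases x; cases y) (auto simp: grid_def split: if_splits)
      have ge: "is_grid p \<and> is_grid q" if "(p, q) \<in> set (gedges (columns r))" for p q
        using that gridC by (auto simp: gedges_def)
      have XE_T: "p \<notin> T" "q \<notin> T" if "(p, q) \<in> set XE" for p q
        using XE[OF that] AT by auto
      consider "u \<in> T \<or> v \<in> T" | "u \<notin> T" "v \<notin> T" "u \<in> set X \<or> v \<in> set X"
        | "u \<in> set (columns r)" "v \<in> set (columns r)" "u \<notin> T" "v \<notin> T" "u \<notin> set X" "v \<notin> set X"
        using uvG unfolding V set_append by blast
      then show ?thesis
      proof cases
        case 1
        then have "(u, v) \<notin> set XE" "(v, u) \<notin> set XE" using XE_T by blast+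
        moreover have "u \<notin> set X \<and> v \<notin> set X" if "grid u v" using nograd that X by blast
        ultimately show ?thesis using 1 Gam ext by (auto simp: G extend_graph_def rel_def)
      next
        case 2
        have "(u, v) \<notin> set (gedges (columns r))" "(v, u) \<notin> set (gedges (columns r))"
          using ge 2(3) X by blast+
        then show ?thesis using 2 Gam ext XE by (auto simp: G extend_graph_def rel_def adj_iff)
      next
        case 3
        then have "(u, v) \<notin> set XE" "(v, u) \<notin> set XE" using XE by blast+
        moreover have "adj ?EL u v \<longleftrightarrow> adj (gedges (columns r)) u v"
          using calculation by (auto simp: adj_iff)
        ultimately show ?thesis
          using 3 Gam ext adj_gedges[OF 3(1,2)] by (auto simp: G extend_graph_def rel_def)
      qed
    qed
    have "Ind G = indc (\<lambda>u v. {u, v} \<in> snd G) (fst G)"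
      by (auto simp: Ind_def independent_set_def indc_def)
    also have "\<dots> = indc (rel ?EL T) (fst G)"
      unfolding indc_def using E by (intro Collect_cong conj_cong refl ball_cong) (auto simp: subset_iff)
    finally show ?thesis using V by simp
  qed
  ultimately show ?thesis using ws_0 by metis
qed

theorem theorem4p7:
  fixes n :: nat and G :: "vertex graph"
  assumes "G \<in> {Gamma4 n, Lambda4 n, A4 n, B4 n, C4 n, D4 n}"
  shows "\<exists>ds. ds \<noteq> [] \<and>
    geometric_realization (Ind G) homotopy_equivalent_space wedge_of_spheres ds"
proof -
  consider "G = Gamma4 n" | "G = Lambda4 n" | "G = A4 n" | "G = B4 n" | "G = C4 n" | "G = D4 n"
    using assms by blast
  then show ?thesis
  proof cases
    case 1 then show ?thesis by (intro family_wedge[OF covers_Gamma4]) (simp_all add: extend_graph_def)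
  next
    case 2 then show ?thesis by (intro family_wedge[OF covers_Lambda4]) (simp_all add: extend_graph_def Lambda4_def)
  next
    case 3 then show ?thesis by (intro family_wedge[OF covers_A4]) (simp_all add: extend_graph_def A4_def)
  next
    case 4 then show ?thesis by (intro family_wedge[OF covers_B4]) (simp_all add: extend_graph_def B4_def)
  next
    case 5 then show ?thesis by (intro family_wedge[OF covers_C4]) (simp_all add: extend_graph_def C4_def)
  next
    case 6 then show ?thesis by (intro family_wedge[OF covers_D4]) (simp_all add: extend_graph_def D4_def)
  qed
qed

end
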